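(* Consider the PST theory of a chiral two-form gauge field in six dimensions, with action $$S=\int d^6x\,\sqrt{-g}\left(\frac14E^{\mu\nu}B_{\mu\nu}-\mathcal H(s,p)\right),$$ where $\mathcal H(s,p)$ satisfies the PST gauge-invariance condition $$\mathcal H_s^2+\frac{2s}{p}\,\mathcal H_s\mathcal H_p+\mathcal H_p^2=1 .$$ The variation of the PST Lagrangian density with respect to the auxiliary scalar field $a(x)$, $$\frac{\delta\mathcal L}{\delta a(x)}\sim\varepsilon^{\mu\nu\rho\kappa\lambda\sigma}(E_{\mu\nu}-H_{\mu\nu})\,\partial_\rho\Big((E_{\kappa\lambda}-H_{\kappa\lambda})v_\sigma\Big),$$ vanishes when the non-linear self-duality condition $E_{\mu\nu}=H_{\mu\nu}(B)$ is satisfied. As a consequence, the on-shell Lagrangian density $$\mathcal L^{\text{on-shell}}_{\rm PST}=(s\mathcal H_s+p\mathcal H_p)-\mathcal H(s,p)$$ is manifestly six-dimensional relativistic invariant and independent of the auxiliary vector field $v^\mu$.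
   Context: The space-time metric $g_{\mu\nu}$ has mostly plus signature; subscripts $s,p$ on $\mathcal H$ denote partial derivatives. $A_{\mu\nu}$ is the two-form gauge field, $F_{\mu\nu\rho}=3\partial_{[\mu}A_{\nu\rho]}$ its field strength, and $F^{*\mu\nu\rho}=\frac{1}{3!\sqrt{-g}}\varepsilon^{\mu\nu\rho\lambda\sigma\kappa}F_{\lambda\sigma\kappa}$ its dual, with $\varepsilon^{012345}=-1$. The auxiliary vector is $v_\mu=\partial_\mu a/\sqrt{-g^{\nu\lambda}\partial_\nu a\,\partial_\lambda a}$, so $v_\mu v^\mu=-1$. Further, $E_{\mu\nu}=F_{\mu\nu\rho}v^\rho$, $B_{\mu\nu}=F^*_{\mu\nu\rho}v^\rho$, $s=\frac14B_{\mu\nu}B^{\mu\nu}$, $p=\sqrt{p_\mu p^\mu}$ with $p^\mu=-\frac{1}{8\sqrt{-g}}\varepsilon^{\mu\nu\rho\lambda\sigma\kappa}B_{\rho\lambda}B_{\sigma\kappa}v_\nu$, and $H_{\mu\nu}=2\,\partial\mathcal H/\partial B^{\mu\nu}=(\mathcal H_s+2sp^{-1}\mathcal H_p)B_{\mu\nu}+p^{-1}\mathcal H_p\,B_{\mu\rho}B^{\rho\tau}B_{\tau\nu}$. The self-duality condition $E_{\mu\nu}=H_{\mu\nu}(B)$ is the equation of motion of $A_{\mu\nu}$ after fixing the local symmetry $\delta A_{\mu\nu}=2v_{[\mu}\Phi_{\nu]}$; "on-shell" means that it holds. The symbol $\sim$ means equality up to a non-zero factor. The on-shell density is written without the overall factor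 $\sqrt{-g}$; its form follows from $H_{\mu\nu}B^{\mu\nu}=4s\mathcal H_s+4p\mathcal H_p$.
   Formalization: Independence of v and relativistic invariance are shown for auxiliary vectors joined, up to sign, by a continuous deformation keeping (s,p) in the domain (p>0) of H, and for orientation-preserving frame changes; otherwise H could differ by constants on separate parts of its domain. *)

theory Defs
  imports "HOL-Analysis.Analysis" "HOL-Combinatorics.Permutations"
begin

section \<open>Differentiability\<close>

fun Ck_on :: "nat \<Rightarrow> ('a::euclidean_space \<Rightarrow> real) \<Rightarrow> 'a set \<Rightarrow> bool" where
  "Ck_on 0 f X \<longleftrightarrow> continuous_on X f"
| "Ck_on (Suc k) f X \<longleftrightarrow>
     (\<forall>x\<in>X. f differentiable (at x)) \<and>
     (\<forall>b\<in>Basis. Ck_on k (\<lambda>x. frechet_derivative f (at x) b) X)"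

definition partial_deriv :: "6 \<Rightarrow> (real^6 \<Rightarrow> real) \<Rightarrow> real^6 \<Rightarrow> real" where
  "partial_deriv \<mu> f x = frechet_derivative f (at x) (axis \<mu> 1)"

text \<open>
  The derivative \<open>\<delta>S/\<delta>a\<close> of an action \<open>S K\<close>, the integral of a Lagrangian density over a compact
  region \<open>K\<close>. Continuity of \<open>D\<close> makes it unique on an open \<open>X\<close>.
\<close>

definition has_functional_derivative ::
    "(real^6) set \<Rightarrow> ((real^6) set \<Rightarrow> (real^6 \<Rightarrow> real) \<Rightarrow> real) \<Rightarrow>
     (real^6 \<Rightarrow> real) \<Rightarrow> (real^6 \<Rightarrow> real) \<Rightarrow> bool" where
  "has_functional_derivative X S a D \<longleftrightarrow>
     continuous_on X D \<and>
     (\<forall>K \<phi>. compact K \<and> K \<subseteq> X \<and> Ck_on 2 \<phi> UNIV \<and> closure {x. \<phi> x \<noteq> 0} \<subseteq> K \<longrightarrow>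
        ((\<lambda>t. S K (\<lambda>x. a x + t * \<phi> x)) has_real_derivative integral K (\<lambda>x. D x * \<phi> x)) (at 0))"


section \<open>Pointwise tensor algebra\<close>

text \<open>
  Tensors are arrays of components in a coordinate frame; the index type \<open>6\<close> has the elements
  \<open>0, \<dots>, 5\<close>. Metric, forms and the auxiliary vector are given by their lower components.
\<close>

definition minkowski :: "real^6^6" where
  "minkowski = (\<chi> i j. if i = j then (if i = 0 then - 1 else 1) else 0)"

definition lorentzian :: "real^6^6 \<Rightarrow> bool" where
  "lorentzian g \<longleftrightarrow> (\<exists>P. invertible P \<and> g = transpose P ** minkowski ** P)"

text \<open>The Levi-Civita symbol with upper indices, normalised by the value \<open>-1\<close> at \<open>0 1 2 3 4 5\<close>.\<close>

definition eps :: "6 \<Rightarrow> 6 \<Rightarrow> 6 \<Rightarrow> 6 \<Rightarrow> 6 \<Rightarrow> 6 \<Rightarrow> real" where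
  "eps i0 i1 i2 i3 i4 i5 =
     (let \<pi> = (\<lambda>_. i0)(1 := i1, 2 := i2, 3 := i3, 4 := i4, 5 := i5)
      in if bij \<pi> then - of_int (sign \<pi>) else 0)"

definition raise1 :: "real^6^6 \<Rightarrow> real^6 \<Rightarrow> real^6" where
  "raise1 g u = matrix_inv g *v u"

definition raise2 :: "real^6^6 \<Rightarrow> real^6^6 \<Rightarrow> real^6^6" where
  "raise2 g T = matrix_inv g ** T ** transpose (matrix_inv g)"

definition lower2 :: "real^6^6 \<Rightarrow> real^6^6 \<Rightarrow> real^6^6" where
  "lower2 g T = g ** T ** transpose g"

definition dual :: "real^6^6 \<Rightarrow> real^6^6^6 \<Rightarrow> real^6^6^6" where
  "dual g F = (\<chi> \<mu> \<nu> \<rho>. 1 / (fact 3 * sqrt (- det g)) *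
     (\<Sum>\<tau>\<in>UNIV. \<Sum>\<sigma>\<in>UNIV. \<Sum>\<kappa>\<in>UNIV. eps \<mu> \<nu> \<rho> \<tau> \<sigma> \<kappa> * F $ \<tau> $ \<sigma> $ \<kappa>))"

definition electric :: "real^6^6 \<Rightarrow> real^6^6^6 \<Rightarrow> real^6 \<Rightarrow> real^6^6" where
  "electric g F v = (\<chi> \<mu> \<nu>. \<Sum>\<rho>\<in>UNIV. F $ \<mu> $ \<nu> $ \<rho> * raise1 g v $ \<rho>)"

definition magnetic :: "real^6^6 \<Rightarrow> real^6^6^6 \<Rightarrow> real^6 \<Rightarrow> real^6^6" where
  "magnetic g F v = lower2 g (\<chi> \<mu> \<nu>. \<Sum>\<rho>\<in>UNIV. dual g F $ \<mu> $ \<nu> $ \<rho> * v $ \<rho>)"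

definition s_inv :: "real^6^6 \<Rightarrow> real^6^6^6 \<Rightarrow> real^6 \<Rightarrow> real" where
  "s_inv g F v = 1/4 *
     (\<Sum>\<mu>\<in>UNIV. \<Sum>\<nu>\<in>UNIV. magnetic g F v $ \<mu> $ \<nu> * raise2 g (magnetic g F v) $ \<mu> $ \<nu>)"

definition p_vec :: "real^6^6 \<Rightarrow> real^6^6^6 \<Rightarrow> real^6 \<Rightarrow> real^6" where
  "p_vec g F v = (\<chi> \<mu>. - 1 / (8 * sqrt (- det g)) *
     (\<Sum>\<nu>\<in>UNIV. \<Sum>\<rho>\<in>UNIV. \<Sum>\<tau>\<in>UNIV. \<Sum>\<sigma>\<in>UNIV. \<Sum>\<kappa>\<in>UNIV.
        eps \<mu> \<nu> \<rho> \<tau> \<sigma> \<kappa> * magnetic g F v $ \<rho> $ \<tau> * magnetic g F v $ \<sigma> $ \<kappa> * v $ \<nu>))"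

definition p_inv :: "real^6^6 \<Rightarrow> real^6^6^6 \<Rightarrow> real^6 \<Rightarrow> real" where
  "p_inv g F v = sqrt (p_vec g F v \<bullet> (g *v p_vec g F v))"

definition H_s :: "(real \<Rightarrow> real \<Rightarrow> real) \<Rightarrow> real \<Rightarrow> real \<Rightarrow> real" where
  "H_s H s p = deriv (\<lambda>t. H t p) s"

definition H_p :: "(real \<Rightarrow> real \<Rightarrow> real) \<Rightarrow> real \<Rightarrow> real \<Rightarrow> real" where
  "H_p H s p = deriv (\<lambda>t. H s t) p"

definition H_tensor ::
    "(real \<Rightarrow> real \<Rightarrow> real) \<Rightarrow> real^6^6 \<Rightarrow> real^6^6^6 \<Rightarrow> real^6 \<Rightarrow> real^6^6" where
  "H_tensor H g F v =
     (let B = magnetic g F v; s = s_inv g F v; p = p_inv g F v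
      in (H_s H s p + 2 * s / p * H_p H s p) *\<^sub>R B +
         (H_p H s p / p) *\<^sub>R (B ** raise2 g B ** B))"

definition self_dual ::
    "(real \<Rightarrow> real \<Rightarrow> real) \<Rightarrow> real^6^6 \<Rightarrow> real^6^6^6 \<Rightarrow> real^6 \<Rightarrow> bool" where
  "self_dual H g F v \<longleftrightarrow> electric g F v = H_tensor H g F v"

text \<open>Both densities are written without the factor \<open>sqrt (- det g)\<close>.\<close>

definition pst_lagrangian ::
    "(real \<Rightarrow> real \<Rightarrow> real) \<Rightarrow> real^6^6 \<Rightarrow> real^6^6^6 \<Rightarrow> real^6 \<Rightarrow> real" where
  "pst_lagrangian H g F v = 1/4 *
     (\<Sum>\<mu>\<in>UNIV. \<Sum>\<nu>\<in>UNIV. raise2 g (electric g F v) $ \<mu> $ \<nu> * magnetic g F v $ \<mu> $ \<nu>)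
     - H (s_inv g F v) (p_inv g F v)"

definition onshell_lagrangian ::
    "(real \<Rightarrow> real \<Rightarrow> real) \<Rightarrow> real^6^6 \<Rightarrow> real^6^6^6 \<Rightarrow> real^6 \<Rightarrow> real" where
  "onshell_lagrangian H g F v =
     (let s = s_inv g F v; p = p_inv g F v in s * H_s H s p + p * H_p H s p - H s p)"

text \<open>
  The auxiliary vectors \<open>w\<close> for which \<open>(s, p)\<close> lies in the domain \<open>U\<close> of \<open>H\<close>. Two of them are
  linked if one can be deformed continuously into the other, up to sign, without leaving this
  set. Vectors that are not linked may lead to different connected components of \<open>U\<close>, on which
  \<open>H\<close> can be changed by unrelated additive constants.
\<close>

definition aux_vectors :: "(real \<times> real) set \<Rightarrow> real^6^6 \<Rightarrow> real^6^6^6 \<Rightarrow> (real^6) set" where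
  "aux_vectors U g F = {w. w \<bullet> raise1 g w = - 1 \<and> (s_inv g F w, p_inv g F w) \<in> U}"

definition aux_linked ::
    "(real \<times> real) set \<Rightarrow> real^6^6 \<Rightarrow> real^6^6^6 \<Rightarrow> real^6 \<Rightarrow> real^6 \<Rightarrow> bool" where
  "aux_linked U g F v w \<longleftrightarrow>
     connected_component (aux_vectors U g F) v w \<or> connected_component (aux_vectors U g F) (- v) w"

text \<open>
  Change of frame with Jacobian matrix \<open>P\<close>; it is a Lorentz transformation if \<open>frame_metric P g = g\<close>.
  Only \<open>det P > 0\<close> is a symmetry of the self-duality condition: a reversal of the orientation
  changes the sign of \<open>dual\<close>.
\<close>

definition frame_metric :: "real^6^6 \<Rightarrow> real^6^6 \<Rightarrow> real^6^6" where
  "frame_metric P g = transpose P ** g ** P"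

definition frame_covector :: "real^6^6 \<Rightarrow> real^6 \<Rightarrow> real^6" where
  "frame_covector P u = transpose P *v u"

definition frame_three_form :: "real^6^6 \<Rightarrow> real^6^6^6 \<Rightarrow> real^6^6^6" where
  "frame_three_form P F = (\<chi> \<mu> \<nu> \<rho>.
     \<Sum>\<alpha>\<in>UNIV. \<Sum>\<beta>\<in>UNIV. \<Sum>\<gamma>\<in>UNIV. P $ \<alpha> $ \<mu> * P $ \<beta> $ \<nu> * P $ \<gamma> $ \<rho> * F $ \<alpha> $ \<beta> $ \<gamma>)"


section \<open>Fields\<close>

definition gradient :: "(real^6 \<Rightarrow> real) \<Rightarrow> real^6 \<Rightarrow> real^6" where
  "gradient a x = (\<chi> \<mu>. partial_deriv \<mu> a x)"

definition aux_norm :: "(real^6 \<Rightarrow> real^6^6) \<Rightarrow> (real^6 \<Rightarrow> real) \<Rightarrow> real^6 \<Rightarrow> real" where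
  "aux_norm g a x = sqrt (- (gradient a x \<bullet> raise1 (g x) (gradient a x)))"

definition aux_vector :: "(real^6 \<Rightarrow> real^6^6) \<Rightarrow> (real^6 \<Rightarrow> real) \<Rightarrow> real^6 \<Rightarrow> real^6" where
  "aux_vector g a x = (1 / aux_norm g a x) *\<^sub>R gradient a x"

text \<open>\<open>3 \<partial>\<^bsub>[\<mu>\<^esub>A\<^bsub>\<nu>\<rho>]\<^esub>\<close> for antisymmetric \<open>A\<close>, with antisymmetrisation of unit weight.\<close>

definition field_strength :: "(real^6 \<Rightarrow> real^6^6) \<Rightarrow> real^6 \<Rightarrow> real^6^6^6" where
  "field_strength A x = (\<chi> \<mu> \<nu> \<rho>.
     partial_deriv \<mu> (\<lambda>y. A y $ \<nu> $ \<rho>) x +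
     partial_deriv \<nu> (\<lambda>y. A y $ \<rho> $ \<mu>) x +
     partial_deriv \<rho> (\<lambda>y. A y $ \<mu> $ \<nu>) x)"

definition pst_action ::
    "(real \<Rightarrow> real \<Rightarrow> real) \<Rightarrow> (real^6 \<Rightarrow> real^6^6) \<Rightarrow> (real^6 \<Rightarrow> real^6^6) \<Rightarrow>
     (real^6) set \<Rightarrow> (real^6 \<Rightarrow> real) \<Rightarrow> real" where
  "pst_action H g A K a = integral K (\<lambda>x.
     sqrt (- det (g x)) * pst_lagrangian H (g x) (field_strength A x) (aux_vector g a x))"

definition duality_defect ::
    "(real \<Rightarrow> real \<Rightarrow> real) \<Rightarrow> (real^6 \<Rightarrow> real^6^6) \<Rightarrow> (real^6 \<Rightarrow> real^6^6) \<Rightarrow>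
     (real^6 \<Rightarrow> real) \<Rightarrow> real^6 \<Rightarrow> real^6^6" where
  "duality_defect H g A a x =
     electric (g x) (field_strength A x) (aux_vector g a x) -
     H_tensor H (g x) (field_strength A x) (aux_vector g a x)"

definition a_variation ::
    "(real \<Rightarrow> real \<Rightarrow> real) \<Rightarrow> (real^6 \<Rightarrow> real^6^6) \<Rightarrow> (real^6 \<Rightarrow> real^6^6) \<Rightarrow>
     (real^6 \<Rightarrow> real) \<Rightarrow> real^6 \<Rightarrow> real" where
  "a_variation H g A a x =
     (\<Sum>\<mu>\<in>UNIV. \<Sum>\<nu>\<in>UNIV. \<Sum>\<rho>\<in>UNIV. \<Sum>\<kappa>\<in>UNIV. \<Sum>\<tau>\<in>UNIV. \<Sum>\<sigma>\<in>UNIV.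
        eps \<mu> \<nu> \<rho> \<kappa> \<tau> \<sigma> * duality_defect H g A a x $ \<mu> $ \<nu> *
        partial_deriv \<rho> (\<lambda>y. duality_defect H g A a y $ \<kappa> $ \<tau> * aux_vector g a y $ \<sigma>) x)"

end

theory Submission
  imports Defs
begin

text \<open>
  Write \<open>\<Delta> = E - H(B)\<close>. Decomposing \<open>F\<close> and its dual along \<open>v\<close> expresses the \<open>v\<close>-variation of the
  Lagrangian through the forms \<open>\<epsilon>(\<delta>v, v, B, B)\<close>, \<open>\<epsilon>(\<delta>v, v, E, E)\<close> and \<open>\<epsilon>(\<delta>v, v, E, H)\<close>. The
  gauge-invariance condition says exactly that \<open>\<epsilon>(\<delta>v, v, B, B) = \<epsilon>(\<delta>v, v, H, H)\<close>, which is a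
  polynomial identity in the rest frame of \<open>v\<close>. So the variation is a multiple of
  \<open>\<epsilon>(\<delta>v, v, \<Delta>, \<Delta>)\<close>; as \<open>v\<close> is proportional to \<open>\<partial>a\<close>, integration by parts gives \<open>\<delta>S/\<delta>a\<close>.

  The variation with respect to \<open>F\<close> is the pairing of \<open>\<Delta>\<close> with \<open>B(\<delta>F)\<close> plus a term independent
  of \<open>v\<close>. Since mixed second differences agree, \<open>\<Delta>\<close> obeys a linear estimate when \<open>v\<close> is
  deformed at fixed \<open>F\<close>: once zero it stays zero, and the Lagrangian, whose \<open>v\<close>-variation is quadratic
  in \<open>\<Delta>\<close>, stays constant. On shell it equals \<open>s H\<^sub>s + p H\<^sub>p - H\<close>. Lorentz invariance is the
  covariance of all constructions under changes of frame of positive determinant.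
\<close>

text \<open>Differentiating \<Delta> along \<open>v\<close> directly would bring in second
  derivatives of \<open>H\<close> and the differentiated gauge condition. Comparing mixed
  differences of the Lagrangian uses only its two first-order variations and a Lipschitz bound for
  \<Delta>. The estimate closes because the \<open>v\<close>-variation is quadratic: a change of
  \<open>F\<close> of size \<open>h\<close> alters it by at most a multiple of
  \<open>h * sup |\<Delta>| + h * h\<close>, so after division by \<open>h\<close> the bound is
  linear in \<open>sup |\<Delta>|\<close>, with a factor proportional to the radius of the
  neighbourhood. Independence of \<open>v\<close> is an algebraic statement at one point, so
  \<open>F\<close> may be perturbed among all alternating tensors.

  The constant of the functional derivative arises as follows. Splitting \<open>F\<close> along
  \<open>v\<close> gives \<open>- 1 / (2 * sqrt (- det g))\<close>, and the quarter in the
  Lagrangian turns this into \<open>- 1 / (8 * sqrt (- det g))\<close>. The density factor of the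
  action cancels the root. In the divergence both factors \<Delta> contribute equally, which leaves
  \<open>1 / 4\<close>.\<close>

lemma UNIV_6: "(UNIV :: 6 set) = {0, 1, 2, 3, 4, 5}"
proof (rule card_subset_eq [symmetric])
  show "card {0, 1, 2, 3, 4, 5 :: 6} = card (UNIV :: 6 set)" by simp
qed auto

lemma sum_6: "sum f (UNIV :: 6 set) = f 0 + f 1 + f 2 + f 3 + f 4 + f 5"
  unfolding UNIV_6 by (simp add: add.assoc)

lemma prod_6: "prod f (UNIV :: 6 set) = f 0 * f 1 * f 2 * f 3 * f 4 * f 5"
  unfolding UNIV_6 by (simp add: mult.assoc)

lemma forall_6: "(\<forall>i::6. P i) \<longleftrightarrow> P 0 \<and> P 1 \<and> P 2 \<and> P 3 \<and> P 4 \<and> P 5"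
  using UNIV_6 by (metis (full_types) UNIV_I empty_iff insert_iff)

section \<open>The Levi-Civita symbol and determinants\<close>

definition tuple :: "'a \<Rightarrow> 'a \<Rightarrow> 'a \<Rightarrow> 'a \<Rightarrow> 'a \<Rightarrow> 'a \<Rightarrow> 6 \<Rightarrow> 'a" where
  "tuple i0 i1 i2 i3 i4 i5 = (\<lambda>_. i0)(1 := i1, 2 := i2, 3 := i3, 4 := i4, 5 := i5)"

lemma tuple_simps [simp]:
  "tuple i0 i1 i2 i3 i4 i5 0 = i0" "tuple i0 i1 i2 i3 i4 i5 1 = i1" "tuple i0 i1 i2 i3 i4 i5 2 = i2"
  "tuple i0 i1 i2 i3 i4 i5 3 = i3" "tuple i0 i1 i2 i3 i4 i5 4 = i4" "tuple i0 i1 i2 i3 i4 i5 5 = i5"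
  by (simp_all add: tuple_def)

lemma tuple_eta: "tuple (\<pi> 0) (\<pi> 1) (\<pi> 2) (\<pi> 3) (\<pi> 4) (\<pi> 5) = \<pi>"
proof
  fix k :: 6
  have "\<forall>k. tuple (\<pi> 0) (\<pi> 1) (\<pi> 2) (\<pi> 3) (\<pi> 4) (\<pi> 5) k = \<pi> k"
    unfolding forall_6 by simp
  then show "tuple (\<pi> 0) (\<pi> 1) (\<pi> 2) (\<pi> 3) (\<pi> 4) (\<pi> 5) k = \<pi> k" ..
qed

lemma sum_tuple:
  fixes f :: "(6 \<Rightarrow> 6) \<Rightarrow> real"
  shows "(\<Sum>i0\<in>UNIV. \<Sum>i1\<in>UNIV. \<Sum>i2\<in>UNIV. \<Sum>i3\<in>UNIV. \<Sum>i4\<in>UNIV. \<Sum>i5\<in>UNIV.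
      f (tuple i0 i1 i2 i3 i4 i5)) = (\<Sum>\<pi>\<in>UNIV. f \<pi>)"
  unfolding sum.cartesian_product
  by (rule sum.reindex_bij_witness [where i = "\<lambda>\<pi>. (\<pi> 0, \<pi> 1, \<pi> 2, \<pi> 3, \<pi> 4, \<pi> 5)"
        and j = "\<lambda>(i0, i1, i2, i3, i4, i5). tuple i0 i1 i2 i3 i4 i5"])
    (auto simp: tuple_eta)

text \<open>Seen as a function of one map on the index type, \<open>eps\<close> turns six nested
  sums into a sum over all maps, which is the shape of the Leibniz formula.\<close>

definition eps_fun :: "(6 \<Rightarrow> 6) \<Rightarrow> real" where
  "eps_fun \<pi> = (if bij \<pi> then - of_int (sign \<pi>) else 0)"

lemma eps_eq: "eps i0 i1 i2 i3 i4 i5 = eps_fun (tuple i0 i1 i2 i3 i4 i5)"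
  by (simp add: eps_def eps_fun_def tuple_def Let_def)

lemma permutes_UNIV_iff_bij: "\<pi> permutes UNIV \<longleftrightarrow> bij \<pi>"
  by (auto intro: bij_imp_permutes permutes_bij)

text \<open>Permuting the rows contributes the sign; a map \<open>j\<close> that is not bijective
  selects some row twice, and both sides vanish. The minus sign undoes the normalisation of
  \<open>eps_fun\<close>.\<close>

lemma det_select_rows:
  fixes P :: "real^6^6"
  shows "det (\<chi> k. P $ j k) = - (det P * eps_fun j)"
proof (cases "bij j")
  case True
  then have "j permutes UNIV" by (simp add: permutes_UNIV_iff_bij)
  then show ?thesis using True by (simp add: det_permute_rows eps_fun_def)
next
  case False
  then have "\<not> inj j"
    by (simp add: bij_def finite_UNIV_inj_surj)
  then obtain a b where "a \<noteq> b" "j a = j b"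
    by (auto simp: inj_def)
  then show ?thesis
    using False by (simp add: eps_fun_def det_identical_rows [of a b] row_def)
qed

text \<open>The Leibniz expansion of the determinant whose rows are selected by \<open>j\<close>;
  maps that are not permutations drop out because \<open>eps_fun\<close> vanishes on them.\<close>

lemma sum_eps_fun:
  fixes P :: "real^6^6"
  shows "(\<Sum>\<pi>\<in>UNIV. eps_fun \<pi> * (\<Prod>k\<in>UNIV. P $ j k $ \<pi> k)) = det P * eps_fun j"
proof -
  have "(\<Sum>\<pi>\<in>UNIV. eps_fun \<pi> * (\<Prod>k\<in>UNIV. P $ j k $ \<pi> k)) =
        (\<Sum>\<pi>\<in>{\<pi>. \<pi> permutes UNIV}. - (of_int (sign \<pi>) * (\<Prod>k\<in>UNIV. P $ j k $ \<pi> k)))"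
    by (rule sum.mono_neutral_cong_right)
      (auto simp: eps_fun_def permutes_UNIV_iff_bij)
  also have "\<dots> = - det (\<chi> k. P $ j k)"
    by (simp add: det_def sum_negf)
  finally show ?thesis by (simp add: det_select_rows)
qed

text \<open>The transformation law of \<open>eps\<close> as a tensor density. The covariance of all
  contractions with \<open>eps\<close> goes back to it.\<close>

lemma sum_eps:
  fixes P :: "real^6^6"
  shows "(\<Sum>i0\<in>UNIV. \<Sum>i1\<in>UNIV. \<Sum>i2\<in>UNIV. \<Sum>i3\<in>UNIV. \<Sum>i4\<in>UNIV. \<Sum>i5\<in>UNIV.
      eps i0 i1 i2 i3 i4 i5 *
      (P $ j0 $ i0 * P $ j1 $ i1 * P $ j2 $ i2 * P $ j3 $ i3 * P $ j4 $ i4 * P $ j5 $ i5)) =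
    det P * eps j0 j1 j2 j3 j4 j5"
  using sum_eps_fun [of P "tuple j0 j1 j2 j3 j4 j5"]
  by (subst (asm) sum_tuple [symmetric]) (simp add: eps_eq prod_6)

lemma eps_fun_swap:
  assumes "a \<noteq> b"
  shows "eps_fun (\<pi> \<circ> Transposition.transpose a b) = - eps_fun \<pi>"
proof -
  have bij: "bij (\<pi> \<circ> Transposition.transpose a b) \<longleftrightarrow> bij \<pi>"
    by (metis bij_betw_comp_iff bij_transpose)
  show ?thesis
  proof (cases "bij \<pi>")
    case True
    then have "permutation \<pi>"
      by (meson bij_imp_permutes finite permutation_permutes UNIV_I)
    then have "sign (\<pi> \<circ> Transposition.transpose a b) = - sign \<pi>"
      using assms by (simp add: sign_compose permutation_swap_id sign_swap_id)
    then show ?thesis using True bij by (simp add: eps_fun_def)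
  qed (simp add: eps_fun_def bij)
qed

text \<open>Adjacent transpositions generate all permutations, so chains of these five rules give
  every rearrangement of the indices.\<close>

lemma eps_swap:
  "eps b a c d e f = - eps a b c d e f"
  "eps a c b d e f = - eps a b c d e f"
  "eps a b d c e f = - eps a b c d e f"
  "eps a b c e d f = - eps a b c d e f"
  "eps a b c d f e = - eps a b c d e f"
proof -
  have *: "tuple b a c d e f = tuple a b c d e f \<circ> Transposition.transpose 0 1"
    "tuple a c b d e f = tuple a b c d e f \<circ> Transposition.transpose 1 2"
    "tuple a b d c e f = tuple a b c d e f \<circ> Transposition.transpose 2 3"
    "tuple a b c e d f = tuple a b c d e f \<circ> Transposition.transpose 3 4"
    "tuple a b c d f e = tuple a b c d e f \<circ> Transposition.transpose 4 5"
    unfolding fun_eq_iff forall_6 by (simp_all add: Transposition.transpose_def)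
  show "eps b a c d e f = - eps a b c d e f" "eps a c b d e f = - eps a b c d e f"
    "eps a b d c e f = - eps a b c d e f" "eps a b c e d f = - eps a b c d e f"
    "eps a b c d f e = - eps a b c d e f"
    unfolding eps_eq * by (simp_all add: eps_fun_swap)
qed

lemma eps_fun_eq_0: "\<pi> a = \<pi> b \<Longrightarrow> a \<noteq> b \<Longrightarrow> eps_fun \<pi> = 0"
  by (auto simp: eps_fun_def bij_def inj_def)

lemma eps_repeated [simp]:
  "eps a a c d e f = 0" "eps a b a d e f = 0" "eps a b c a e f = 0" "eps a b c d a f = 0"
  "eps a b c d e a = 0" "eps a b b d e f = 0" "eps a b c b e f = 0" "eps a b c d b f = 0"
  "eps a b c d e b = 0" "eps a b c c e f = 0" "eps a b c d c f = 0" "eps a b c d e c = 0"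
  "eps a b c d d f = 0" "eps a b c d e d = 0" "eps a b c d e e = 0"
  unfolding eps_eq
  by (simp_all add: eps_fun_eq_0 [of _ 0 1]
      eps_fun_eq_0 [of _ 0 2]
      eps_fun_eq_0 [of _ 0 3]
      eps_fun_eq_0 [of _ 0 4]
      eps_fun_eq_0 [of _ 0 5]
      eps_fun_eq_0 [of _ 1 2]
      eps_fun_eq_0 [of _ 1 3]
      eps_fun_eq_0 [of _ 1 4]
      eps_fun_eq_0 [of _ 1 5]
      eps_fun_eq_0 [of _ 2 3]
      eps_fun_eq_0 [of _ 2 4]
      eps_fun_eq_0 [of _ 2 5]
      eps_fun_eq_0 [of _ 3 4]
      eps_fun_eq_0 [of _ 3 5]
      eps_fun_eq_0 [of _ 4 5])

lemma eps_012345: "eps 0 1 2 3 4 5 = - 1"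
proof -
  have "tuple 0 1 2 3 4 5 = (id :: 6 \<Rightarrow> 6)"
    unfolding fun_eq_iff forall_6 by simp
  then show ?thesis by (simp add: eps_eq eps_fun_def)
qed

lemma eps_square:
  assumes "distinct [a, b, c, d, e, f]"
  shows "eps a b c d e f * eps a b c d e f = 1"
proof -
  have "\<forall>i. \<forall>j. tuple a b c d e f i = tuple a b c d e f j \<longrightarrow> i = j"
    unfolding forall_6 using assms by auto
  then have "inj (tuple a b c d e f)" by (simp add: inj_def)
  then have "bij (tuple a b c d e f)" by (simp add: bij_def finite_UNIV_inj_surj)
  then show ?thesis by (simp add: eps_eq eps_fun_def flip: of_int_mult)
qed

lemma sum_UNIV_tuple:
  fixes h :: "6 \<Rightarrow> real"
  assumes "distinct [a, b, c, d, e, f]"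
  shows "sum h UNIV = h a + h b + h c + h d + h e + h f"
proof -
  have "{a, b, c, d, e, f} = (UNIV :: 6 set)"
    by (rule card_subset_eq) (use assms in auto)
  then have "sum h UNIV = sum h {a, b, c, d, e, f}" by simp
  also have "\<dots> = h a + h b + h c + h d + h e + h f"
    using assms by (simp add: add.assoc)
  finally show ?thesis .
qed

lemma ex_complement:
  fixes i j k :: 6
  assumes "distinct [i, j, k]"
  obtains a b c where "distinct [i, j, k, a, b, c]"
proof -
  have "card (UNIV - {i, j, k}) = 3"
    using assms by (simp add: card_Diff_subset)
  then obtain a b c where "UNIV - {i, j, k} = {a, b, c}" "a \<noteq> b" "b \<noteq> c" "a \<noteq> c"
    by (metis card_3_iff)
  then have "distinct [i, j, k, a, b, c]" using assms by auto
  then show ?thesis using that by blast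
qed

section \<open>Alternating three-forms and their metric-free dual\<close>

definition alternating :: "real^6^6^6 \<Rightarrow> bool" where
  "alternating F \<longleftrightarrow> (\<forall>i j k. F $ j $ i $ k = - (F $ i $ j $ k) \<and> F $ i $ k $ j = - (F $ i $ j $ k))"

lemma alternatingD:
  assumes "alternating F"
  shows "F $ j $ i $ k = - (F $ i $ j $ k)" "F $ i $ k $ j = - (F $ i $ j $ k)"
  using assms unfolding alternating_def by blast+

text \<open>The dual stripped of metric and normalisation; \<open>dual_eq\<close> restores the
  factor \<open>1 / (6 * sqrt (- det g))\<close>.\<close>

definition epsc :: "real^6^6^6 \<Rightarrow> real^6^6^6" where
  "epsc T = (\<chi> i j k. \<Sum>l\<in>UNIV. \<Sum>m\<in>UNIV. \<Sum>n\<in>UNIV. eps i j k l m n * T $ l $ m $ n)"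

text \<open>Only the six orderings of the complementary triple contribute, and the signs of
  \<open>eps\<close> and \<open>F\<close> cancel, so the six terms are equal.\<close>

lemma epsc_alternating:
  assumes F: "alternating F" and d: "distinct [i, j, k, a, b, c]"
  shows "epsc F $ i $ j $ k = 6 * eps i j k a b c * F $ a $ b $ c"
proof -
  have F': "F $ a $ c $ b = - (F $ a $ b $ c)" "F $ b $ a $ c = - (F $ a $ b $ c)"
    "F $ b $ c $ a = F $ a $ b $ c" "F $ c $ a $ b = F $ a $ b $ c" "F $ c $ b $ a = - (F $ a $ b $ c)"
    using alternatingD(2) [OF F, of a b c] alternatingD(1) [OF F, of a b c]
      alternatingD(2) [OF F, of b a c] alternatingD(1) [OF F, of a c b]
      alternatingD(2) [OF F, of c a b] by simp_all
  have e: "eps i j k a c b = - (eps i j k a b c)" "eps i j k b a c = - (eps i j k a b c)"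
    "eps i j k b c a = eps i j k a b c" "eps i j k c a b = eps i j k a b c"
    "eps i j k c b a = - (eps i j k a b c)"
    using eps_swap(5) [of i j k a b c] eps_swap(4) [of i j k a b c]
      eps_swap(5) [of i j k b a c] eps_swap(4) [of i j k a c b] eps_swap(5) [of i j k c a b]
    by simp_all
  show ?thesis
    unfolding epsc_def by (simp add: sum_UNIV_tuple [OF d] e F')
qed

lemma alternating_epsc: "alternating (epsc T)"
  unfolding alternating_def
proof (intro allI)
  fix i j k
  show "epsc T $ j $ i $ k = - (epsc T $ i $ j $ k) \<and> epsc T $ i $ k $ j = - (epsc T $ i $ j $ k)"
    by (simp add: epsc_def eps_swap(1) [of j i] eps_swap(2) [of i k j] sum_negf)
qed

text \<open>Nine adjacent transpositions, an odd number: exchanging two blocks of three indices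
  costs a sign.\<close>

lemma eps_rotate: "eps d e f a b c = - eps a b c d e f"
proof -
  have "eps d e f a b c = - eps d e a f b c" by (rule eps_swap)
  also have "\<dots> = eps d a e f b c" by (simp add: eps_swap(2) [of d e])
  also have "\<dots> = - eps a d e f b c" by (rule eps_swap)
  also have "\<dots> = eps a d e b f c" by (simp add: eps_swap(4) [of a d e f])
  also have "\<dots> = - eps a d b e f c" by (rule eps_swap)
  also have "\<dots> = eps a b d e f c" by (simp add: eps_swap(2) [of a d])
  also have "\<dots> = - eps a b d e c f" by (rule eps_swap)
  also have "\<dots> = eps a b d c e f" by (simp add: eps_swap(4) [of a b d e])
  also have "\<dots> = - eps a b c d e f" by (rule eps_swap)
  finally show ?thesis .
qed

lemma alternating_repeated:
  assumes "alternating F"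
  shows "F $ i $ i $ k = 0" "F $ i $ k $ k = 0" "F $ i $ k $ i = 0"
proof -
  show a: "F $ i $ i $ k = 0" "F $ i $ k $ k = 0" for i k
    using alternatingD(1) [OF assms, of i i k] alternatingD(2) [OF assms, of i k k] by simp_all
  show "F $ i $ k $ i = 0"
    using alternatingD(1) [OF assms, of i k i] a by simp
qed

text \<open>Each application contributes a factor 6 for the orderings of the complementary triple,
  and \<open>eps_rotate\<close> supplies the sign. Repeated indices give zero on both sides.\<close>

lemma epsc_epsc:
  assumes F: "alternating F"
  shows "epsc (epsc F) = (- 36) *\<^sub>R F"
proof -
  have "epsc (epsc F) $ i $ j $ k = - 36 * F $ i $ j $ k" for i j k
  proof (cases "distinct [i, j, k]")
    case True
    then obtain a b c where d: "distinct [i, j, k, a, b, c]" by (rule ex_complement)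
    then have d': "distinct [a, b, c, i, j, k]" by auto
    have "epsc (epsc F) $ i $ j $ k = 6 * eps i j k a b c * (6 * eps a b c i j k * F $ i $ j $ k)"
      using epsc_alternating [OF alternating_epsc d, of F] epsc_alternating [OF F d'] by simp
    also have "\<dots> = - 36 * (eps i j k a b c * eps i j k a b c) * F $ i $ j $ k"
      by (simp add: eps_rotate [of a b c])
    finally show ?thesis by (simp add: eps_square [OF d])
  next
    case False
    then show ?thesis
      using alternating_repeated [OF F] alternating_repeated [OF alternating_epsc] by auto
  qed
  then show ?thesis by (simp add: vec_eq_iff)
qed

lemma sum_triple:
  fixes f :: "6 \<Rightarrow> 6 \<Rightarrow> 6 \<Rightarrow> real"
  shows "(\<Sum>i\<in>UNIV. \<Sum>j\<in>UNIV. \<Sum>k\<in>UNIV. f i j k) = (\<Sum>(i, j, k)\<in>UNIV. f i j k)"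
  by (simp add: sum.cartesian_product)

lemma inner_triple:
  fixes S T :: "real^6^6^6"
  shows "S \<bullet> T = (\<Sum>i\<in>UNIV. \<Sum>j\<in>UNIV. \<Sum>k\<in>UNIV. S $ i $ j $ k * T $ i $ j $ k)"
  by (simp add: inner_vec_def)

definition at3 :: "real^6^6^6 \<Rightarrow> 6 \<times> 6 \<times> 6 \<Rightarrow> real" where
  "at3 T = (\<lambda>(i, j, k). T $ i $ j $ k)"

text \<open>With indices grouped into triples, \<open>eps\<close> is a square matrix acting on
  three-tensors and \<open>cube3\<close> is the third tensor power of \<open>P\<close>, so the laws
  below become matrix identities.\<close>

definition eps33 :: "6 \<times> 6 \<times> 6 \<Rightarrow> 6 \<times> 6 \<times> 6 \<Rightarrow> real" where
  "eps33 = (\<lambda>(i, j, k) (l, m, n). eps i j k l m n)"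

definition cube3 :: "real^6^6 \<Rightarrow> 6 \<times> 6 \<times> 6 \<Rightarrow> 6 \<times> 6 \<times> 6 \<Rightarrow> real" where
  "cube3 P = (\<lambda>(a, b, c) (i, j, k). P $ a $ i * P $ b $ j * P $ c $ k)"

lemma at3_eqI: "(\<And>t. at3 S t = at3 T t) \<Longrightarrow> S = T"
  by (auto simp: at3_def vec_eq_iff split: prod.splits)

lemma at3_scaleR: "at3 (c *\<^sub>R T) t = c * at3 T t"
  by (simp add: at3_def split: prod.splits)

lemma at3_epsc: "at3 (epsc T) t = (\<Sum>d\<in>UNIV. eps33 t d * at3 T d)"
  by (cases t) (simp add: at3_def epsc_def eps33_def sum_triple case_prod_unfold)

lemma at3_frame: "at3 (frame_three_form P T) t = (\<Sum>d\<in>UNIV. cube3 P d t * at3 T d)"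
  by (cases t) (simp add: at3_def frame_three_form_def cube3_def sum_triple case_prod_unfold)

lemma inner_at3: "S \<bullet> T = (\<Sum>t\<in>UNIV. at3 S t * at3 T t)"
  by (simp add: inner_triple sum_triple at3_def case_prod_unfold)

lemma cube3_transpose: "cube3 (transpose P) s t = cube3 P t s"
  by (simp add: cube3_def transpose_def split: prod.splits)

lemma sum_eps33:
  "(\<Sum>s\<in>UNIV. \<Sum>t\<in>UNIV. cube3 P a s * cube3 P d t * eps33 s t) = det P * eps33 a d"
proof -
  obtain a1 a2 a3 d1 d2 d3 where ad: "a = (a1, a2, a3)" "d = (d1, d2, d3)"
    by (metis prod_cases3)
  have "det P * eps33 a d = (\<Sum>i0\<in>UNIV. \<Sum>i1\<in>UNIV. \<Sum>i2\<in>UNIV. \<Sum>i3\<in>UNIV. \<Sum>i4\<in>UNIV. \<Sum>i5\<in>UNIV.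
      eps i0 i1 i2 i3 i4 i5 *
      (P $ a1 $ i0 * P $ a2 $ i1 * P $ a3 $ i2 * P $ d1 $ i3 * P $ d2 $ i4 * P $ d3 $ i5))"
    by (simp add: sum_eps ad eps33_def)
  also have "\<dots> = (\<Sum>s\<in>UNIV. \<Sum>t\<in>UNIV. cube3 P a s * cube3 P d t * eps33 s t)"
    by (simp add: sum_triple ad case_prod_unfold cube3_def eps33_def mult_ac)
  finally show ?thesis by simp
qed

text \<open>If \<open>R\<close> is the third tensor power of \<open>P\<close> and \<open>e\<close>
  the matrix \<open>eps33\<close>, this is \<open>R e R^T = det P e\<close>, that is,
  \<open>sum_eps\<close> with its six indices split into two triples. Singular \<open>P\<close> are
  included, which \<open>omega_transverse\<close> exploits.\<close>

theorem frame_epsc: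
  "frame_three_form (transpose P) (epsc (frame_three_form P T)) = det P *\<^sub>R epsc T"
proof (rule at3_eqI)
  fix a
  have "at3 (frame_three_form (transpose P) (epsc (frame_three_form P T))) a =
     (\<Sum>s\<in>UNIV. \<Sum>t\<in>UNIV. \<Sum>d\<in>UNIV. (cube3 P a s * cube3 P d t * eps33 s t) * at3 T d)"
    by (simp add: at3_frame at3_epsc cube3_transpose sum_distrib_left mult_ac)
  also have "\<dots> = (\<Sum>s\<in>UNIV. \<Sum>d\<in>UNIV. \<Sum>t\<in>UNIV. (cube3 P a s * cube3 P d t * eps33 s t) * at3 T d)"
    by (rule sum.cong [OF refl], rule sum.swap)
  also have "\<dots> = (\<Sum>d\<in>UNIV. \<Sum>s\<in>UNIV. \<Sum>t\<in>UNIV. (cube3 P a s * cube3 P d t * eps33 s t) * at3 T d)"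
    by (rule sum.swap)
  also have "\<dots> = (\<Sum>d\<in>UNIV. det P * eps33 a d * at3 T d)"
    by (simp only: sum_distrib_right [symmetric] sum_eps33)
  finally show "at3 (frame_three_form (transpose P) (epsc (frame_three_form P T))) a =
      at3 (det P *\<^sub>R epsc T) a"
    by (simp add: at3_epsc at3_scaleR sum_distrib_left mult_ac)
qed

lemma inner_frame: "frame_three_form P S \<bullet> T = S \<bullet> frame_three_form (transpose P) T"
  by (simp add: inner_at3 at3_frame cube3_transpose sum_distrib_left sum_distrib_right mult_ac)
    (rule sum.swap)

text \<open>Up to a constant factor, the wedge product of the alternating parts of two
  three-tensors; it changes sign under exchange because the degree is odd.\<close>

definition omega :: "real^6^6^6 \<Rightarrow> real^6^6^6 \<Rightarrow> real" where
  "omega S T = S \<bullet> epsc T"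

lemma omega_frame: "omega (frame_three_form P S) (frame_three_form P T) = det P * omega S T"
  by (simp add: omega_def inner_frame frame_epsc)

lemma eps33_swap: "eps33 s t = - eps33 t s"
proof -
  obtain a b c d e f where "s = (a, b, c)" "t = (d, e, f)" by (metis prod_cases3)
  then show ?thesis by (simp add: eps33_def eps_rotate [of d e f a b c])
qed

lemma omega_commute: "omega S T = - omega T S"
proof -
  have "omega S T = (\<Sum>s\<in>UNIV. \<Sum>t\<in>UNIV. at3 S s * (eps33 s t * at3 T t))"
    by (simp add: omega_def inner_at3 at3_epsc sum_distrib_left)
  also have "\<dots> = (\<Sum>t\<in>UNIV. \<Sum>s\<in>UNIV. at3 S s * (eps33 s t * at3 T t))"
    by (rule sum.swap)
  also have "\<dots> = - omega T S"
  proof -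
    have "at3 S s * (eps33 s t * at3 T t) = - (at3 T t * (eps33 t s * at3 S s))" for s t
      by (simp add: eps33_swap [of s t])
    then show ?thesis
      by (simp add: omega_def inner_at3 at3_epsc sum_distrib_left sum_negf)
  qed
  finally show ?thesis .
qed

lemma linear_epsc: "linear epsc"
  by (rule linearI) (simp_all add: epsc_def vec_eq_iff sum.distrib sum_distrib_left algebra_simps)

lemma linear_frame_three_form: "linear (frame_three_form P)"
  by (rule linearI)
    (simp_all add: frame_three_form_def vec_eq_iff sum.distrib sum_distrib_left algebra_simps)

lemma bilinear_omega: "bilinear omega"
  unfolding bilinear_def omega_def
  by (auto intro!: linearI simp: inner_simps linear_add [OF linear_epsc] linear_scale [OF linear_epsc])

section \<open>Metric tensors and changes of frame\<close>

lemma transpose_minkowski: "transpose minkowski = minkowski"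
  by (auto simp: minkowski_def transpose_def vec_eq_iff)

lemma minkowski_mult: "minkowski *v x = (\<chi> i. if i = 0 then - x $ i else x $ i)"
  unfolding vec_eq_iff forall_6 by (simp add: minkowski_def matrix_vector_mult_def sum_6)

lemma minkowski_sq: "minkowski ** minkowski = mat 1"
  by (simp add: matrix_eq flip: matrix_vector_mul_assoc) (simp add: minkowski_mult vec_eq_iff)

lemma det_minkowski: "det minkowski = - 1"
proof -
  have "det minkowski = (\<Prod>i\<in>UNIV. minkowski $ i $ i)"
    by (rule det_diagonal) (simp add: minkowski_def)
  then show ?thesis by (simp add: prod_6 minkowski_def)
qed

lemma lorentzian_minkowski: "lorentzian minkowski"
  unfolding lorentzian_def by (rule exI [of _ "mat 1"]) (auto simp: invertible_def)

lemma lorentzian_frame: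
  assumes "lorentzian g" "invertible P"
  shows "lorentzian (frame_metric P g)"
proof -
  obtain Q where "invertible Q" "g = transpose Q ** minkowski ** Q"
    using assms by (auto simp: lorentzian_def)
  then have "frame_metric P g = transpose (Q ** P) ** minkowski ** (Q ** P)"
    by (simp add: frame_metric_def matrix_transpose_mul matrix_mul_assoc)
  then show ?thesis
    unfolding lorentzian_def using \<open>invertible Q\<close> assms(2) invertible_mult by blast
qed

lemma
  assumes "lorentzian g"
  shows lorentzian_transpose: "transpose g = g"
    and lorentzian_det: "det g < 0"
    and lorentzian_invertible: "invertible g"
proof -
  obtain Q where Q: "invertible Q" "g = transpose Q ** minkowski ** Q"
    using assms by (auto simp: lorentzian_def)
  show "transpose g = g"
    by (simp add: Q matrix_transpose_mul transpose_minkowski matrix_mul_assoc)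
  have "det Q \<noteq> 0" using Q(1) invertible_det_nz by blast
  then show *: "det g < 0"
    by (simp add: Q det_mul det_minkowski) (metis not_real_square_gt_zero)
  show "invertible g" using * invertible_det_nz by fastforce
qed

lemma matrix_inv_mult:
  fixes A :: "real^'n^'n"
  assumes "invertible A"
  shows "A ** matrix_inv A = mat 1" "matrix_inv A ** A = mat 1"
  using someI_ex [OF assms [unfolded invertible_def]] by (simp_all add: matrix_inv_def)

lemma matrix_inv_unique:
  fixes A B :: "real^'n^'n"
  assumes "A ** B = mat 1"
  shows "matrix_inv A = B"
proof -
  have "invertible A" unfolding invertible_def
    using assms matrix_left_right_inverse by blast
  then have "matrix_inv A ** (A ** B) = B"
    by (simp add: matrix_mul_assoc matrix_inv_mult)
  then show ?thesis using assms by simp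
qed

lemma matrix_inv_minkowski: "matrix_inv minkowski = minkowski"
  by (rule matrix_inv_unique) (rule minkowski_sq)

lemma transpose_matrix_inv:
  fixes g :: "real^'n^'n"
  assumes "transpose g = g" "invertible g"
  shows "transpose (matrix_inv g) = matrix_inv g"
proof -
  have "transpose (matrix_inv g ** g) = mat 1"
    by (simp add: matrix_inv_mult assms transpose_mat)
  then have "g ** transpose (matrix_inv g) = mat 1"
    by (simp add: matrix_transpose_mul assms)
  then show ?thesis by (metis matrix_inv_unique)
qed

lemma raise1_cancel: "invertible g \<Longrightarrow> g *v raise1 g u = u"
  by (simp add: raise1_def matrix_vector_mul_assoc matrix_inv_mult)

lemma raise1_commute:
  assumes "transpose g = g" "invertible g"
  shows "u \<bullet> raise1 g w = raise1 g u \<bullet> w"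
  by (metis assms raise1_def transpose_matrix_inv dot_lmul_matrix transpose_matrix_vector)

lemma raise2_lower2:
  assumes "transpose g = g" "invertible g"
  shows "raise2 g (lower2 g C) = C"
proof -
  have "raise2 g (lower2 g C) = (matrix_inv g ** g) ** C ** (g ** matrix_inv g)"
    by (simp add: raise2_def lower2_def assms transpose_matrix_inv matrix_mul_assoc)
  then show ?thesis by (simp add: assms matrix_inv_mult)
qed

definition ip :: "real^6^6 \<Rightarrow> real^6^6 \<Rightarrow> real^6^6 \<Rightarrow> real" where
  "ip g X Y = X \<bullet> raise2 g Y"

lemma ip_sum: "ip g X Y = (\<Sum>\<mu>\<in>UNIV. \<Sum>\<nu>\<in>UNIV. X $ \<mu> $ \<nu> * raise2 g Y $ \<mu> $ \<nu>)"
  by (simp add: ip_def inner_vec_def)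

definition cube :: "real^6^6 \<Rightarrow> real^6^6 \<Rightarrow> real^6^6" where
  "cube g B = B ** raise2 g B ** B"

definition contr :: "real^6^6^6 \<Rightarrow> real^6 \<Rightarrow> real^6^6" where
  "contr T w = (\<chi> i j. \<Sum>k\<in>UNIV. T $ i $ j $ k * w $ k)"

definition tensor :: "real^6^6 \<Rightarrow> real^6 \<Rightarrow> real^6^6^6" where
  "tensor X u = (\<chi> i j k. X $ i $ j * u $ k)"

text \<open>Lowering the indices makes the dual a three-form of the same kind as \<open>F\<close>,
  so that it can be dualised again.\<close>

definition ldual :: "real^6^6 \<Rightarrow> real^6^6^6 \<Rightarrow> real^6^6^6" where
  "ldual g F = frame_three_form g (dual g F)"

lemma dual_eq: "dual g F = (1 / (6 * sqrt (- det g))) *\<^sub>R epsc F"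
  by (simp add: dual_def epsc_def vec_eq_iff fact_numeral)

lemma electric_eq: "electric g F v = contr F (raise1 g v)"
  by (simp add: electric_def contr_def)

lemma matrix_entry: "(A ** B) $ i $ j = (\<Sum>k\<in>UNIV. A $ i $ k * B $ k $ j)"
  by (simp add: matrix_matrix_mult_def)

lemma contr_frame: "contr (frame_three_form P T) u = transpose P ** contr T (P *v u) ** P"
proof -
  have "contr (frame_three_form P T) u $ i $ j = (transpose P ** contr T (P *v u) ** P) $ i $ j" for i j
  proof -
    have "contr (frame_three_form P T) u $ i $ j =
        (\<Sum>k\<in>UNIV. \<Sum>a\<in>UNIV. \<Sum>b\<in>UNIV. \<Sum>c\<in>UNIV. P $ a $ i * P $ b $ j * P $ c $ k * T $ a $ b $ c * u $ k)"
      by (simp add: contr_def frame_three_form_def sum_distrib_right)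
    also have "\<dots> = (\<Sum>a\<in>UNIV. \<Sum>k\<in>UNIV. \<Sum>b\<in>UNIV. \<Sum>c\<in>UNIV. P $ a $ i * P $ b $ j * P $ c $ k * T $ a $ b $ c * u $ k)"
      by (rule sum.swap)
    also have "\<dots> = (\<Sum>a\<in>UNIV. \<Sum>b\<in>UNIV. \<Sum>k\<in>UNIV. \<Sum>c\<in>UNIV. P $ a $ i * P $ b $ j * P $ c $ k * T $ a $ b $ c * u $ k)"
      by (rule sum.cong [OF refl], rule sum.swap)
    also have "\<dots> = (\<Sum>b\<in>UNIV. \<Sum>a\<in>UNIV. \<Sum>k\<in>UNIV. \<Sum>c\<in>UNIV. P $ a $ i * P $ b $ j * P $ c $ k * T $ a $ b $ c * u $ k)"
      by (rule sum.swap)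
    also have "\<dots> = (\<Sum>b\<in>UNIV. \<Sum>a\<in>UNIV. \<Sum>c\<in>UNIV. \<Sum>k\<in>UNIV. P $ a $ i * P $ b $ j * P $ c $ k * T $ a $ b $ c * u $ k)"
      by (rule sum.cong [OF refl], rule sum.cong [OF refl], rule sum.swap)
    also have "\<dots> = (transpose P ** contr T (P *v u) ** P) $ i $ j"
      by (simp add: matrix_entry contr_def transpose_def matrix_vector_mult_def
          sum_distrib_left sum_distrib_right mult_ac)
    finally show ?thesis .
  qed
  then show ?thesis by (simp add: vec_eq_iff)
qed

lemma sum_product3:
  fixes f g h :: "6 \<Rightarrow> real"
  shows "(\<Sum>i\<in>UNIV. f i) * (\<Sum>j\<in>UNIV. g j) * (\<Sum>k\<in>UNIV. h k) =
    (\<Sum>i\<in>UNIV. \<Sum>j\<in>UNIV. \<Sum>k\<in>UNIV. f i * g j * h k)"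
  unfolding sum_product [of f UNIV g UNIV] unfolding sum_distrib_right by (simp add: sum_distrib_left)

lemma frame_compose: "frame_three_form (A ** B) T = frame_three_form B (frame_three_form A T)"
proof (rule at3_eqI)
  fix t
  have *: "cube3 (A ** B) d t = (\<Sum>s\<in>UNIV. cube3 A d s * cube3 B s t)" for d
  proof -
    obtain a b c i j k where "d = (a, b, c)" "t = (i, j, k)" by (metis prod_cases3)
    then show ?thesis
      by (simp add: cube3_def matrix_entry sum_product3 sum_triple case_prod_unfold)
        (simp add: mult_ac)
  qed
  show "at3 (frame_three_form (A ** B) T) t = at3 (frame_three_form B (frame_three_form A T)) t"
    by (simp add: at3_frame * sum_distrib_left sum_distrib_right mult_ac) (rule sum.swap)
qed

text \<open>Lowering the third index of the dual and raising that of \<open>v\<close> cancel. Facts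
  about the electric part of an arbitrary alternating form thus apply to the magnetic part as
  well.\<close>

lemma magnetic_eq_electric:
  assumes "transpose g = g" "invertible g"
  shows "magnetic g F v = electric g (ldual g F) v"
proof -
  have "electric g (ldual g F) v = g ** contr (dual g F) (g *v raise1 g v) ** g"
    by (simp add: electric_eq ldual_def contr_frame assms)
  then show ?thesis
    by (simp add: assms raise1_cancel magnetic_def lower2_def contr_def)
qed

text \<open>\<open>frame_epsc\<close> with the metric as frame matrix produces \<open>det g\<close>,
  which is negative and cancels the sign in \<open>epsc_epsc\<close>: in Lorentzian signature the
  dual squares to \<open>+1\<close>, so real self-dual forms exist.\<close>

lemma ldual_ldual:
  assumes g: "transpose g = g" "det g < 0" and F: "alternating F"
  shows "ldual g (ldual g F) = F"
proof -
  let ?c = "1 / (6 * sqrt (- det g))"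
  have "ldual g (ldual g F) = ?c *\<^sub>R frame_three_form (transpose g) (epsc (frame_three_form g (?c *\<^sub>R epsc F)))"
    by (simp add: ldual_def dual_eq g linear_scale [OF linear_frame_three_form])
  also have "\<dots> = (?c * ?c * det g) *\<^sub>R epsc (epsc F)"
    by (simp add: frame_epsc linear_scale [OF linear_epsc])
  also have "?c * ?c * det g = - 1 / 36"
    using g by (simp add: field_simps)
  finally show ?thesis by (simp add: epsc_epsc [OF F])
qed

lemma alternating_frame:
  assumes "alternating F"
  shows "alternating (frame_three_form P F)"
  unfolding alternating_def
proof (intro allI conjI)
  fix i j k
  have *: "F $ a $ b $ c = - F $ b $ a $ c" "F $ a $ b $ c = - F $ a $ c $ b" for a b c
    by (rule alternatingD [OF assms])+
  have "frame_three_form P F $ j $ i $ k =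
     (\<Sum>b\<in>UNIV. \<Sum>a\<in>UNIV. \<Sum>c\<in>UNIV. P $ a $ j * P $ b $ i * P $ c $ k * F $ a $ b $ c)"
    unfolding frame_three_form_def by (simp, rule sum.swap)
  also have "\<dots> = (\<Sum>b\<in>UNIV. \<Sum>a\<in>UNIV. \<Sum>c\<in>UNIV. - (P $ b $ i * P $ a $ j * P $ c $ k * F $ b $ a $ c))"
    by (intro sum.cong refl) (subst *(1), simp)
  finally show "frame_three_form P F $ j $ i $ k = - (frame_three_form P F $ i $ j $ k)"
    by (simp add: frame_three_form_def sum_negf)
  have "frame_three_form P F $ i $ k $ j =
     (\<Sum>a\<in>UNIV. \<Sum>c\<in>UNIV. \<Sum>b\<in>UNIV. P $ a $ i * P $ b $ k * P $ c $ j * F $ a $ b $ c)"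
    unfolding frame_three_form_def by (simp, rule sum.cong [OF refl], rule sum.swap)
  also have "\<dots> = (\<Sum>a\<in>UNIV. \<Sum>c\<in>UNIV. \<Sum>b\<in>UNIV. - (P $ a $ i * P $ c $ j * P $ b $ k * F $ a $ c $ b))"
    by (intro sum.cong refl) (subst *(2), simp)
  finally show "frame_three_form P F $ i $ k $ j = - (frame_three_form P F $ i $ j $ k)"
    by (simp add: frame_three_form_def sum_negf)
qed

lemma alternating_scaleR: "alternating F \<Longrightarrow> alternating (c *\<^sub>R F)"
  unfolding alternating_def vector_scaleR_component real_scaleR_def by (metis mult_minus_right)

lemma alternating_ldual: "alternating (ldual g F)"
  by (simp add: ldual_def dual_eq alternating_frame alternating_scaleR alternating_epsc)

lemma frame_tensor: "frame_three_form P (tensor X u) = tensor (transpose P ** X ** P) (transpose P *v u)"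
proof -
  have "frame_three_form P (tensor X u) $ i $ j $ k =
     (\<Sum>b\<in>UNIV. \<Sum>a\<in>UNIV. \<Sum>c\<in>UNIV. P $ a $ i * P $ b $ j * P $ c $ k * (X $ a $ b * u $ c))" for i j k
    unfolding frame_three_form_def tensor_def by (simp, rule sum.swap)
  then show ?thesis
    by (simp add: vec_eq_iff tensor_def matrix_entry transpose_def matrix_vector_mult_def
          sum_distrib_left sum_distrib_right mult_ac)
qed

lemma inner_congruence:
  fixes X Y P :: "real^6^6"
  shows "(transpose P ** X ** P) \<bullet> Y = X \<bullet> (P ** Y ** transpose P)"
proof -
  have tr: "A \<bullet> B = trace (transpose A ** B)" for A B :: "real^6^6"
    by (simp add: inner_vec_def trace_def matrix_entry transpose_def) (rule sum.swap)
  have "(transpose P ** X ** P) \<bullet> Y = trace (transpose P ** (transpose X ** P ** Y))"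
    by (simp add: tr matrix_transpose_mul matrix_mul_assoc)
  also have "\<dots> = trace (transpose X ** P ** Y ** transpose P)"
    by (rule trace_mul_sym)
  also have "\<dots> = X \<bullet> (P ** Y ** transpose P)"
    by (simp add: tr matrix_mul_assoc)
  finally show ?thesis .
qed

definition antisym :: "real^6^6 \<Rightarrow> bool" where
  "antisym X \<longleftrightarrow> transpose X = - X"

lemma antisymD:
  assumes "antisym X"
  shows "X $ j $ i = - (X $ i $ j)"
proof -
  have "transpose X $ i $ j = (- X) $ i $ j" using assms unfolding antisym_def by metis
  then show ?thesis by (simp add: transpose_def)
qed

lemma antisym_diag: "antisym X \<Longrightarrow> X $ i $ i = 0"
  using antisymD [of X i i] by simp

lemma antisymI:
  assumes "\<And>i j. X $ j $ i = - (X $ i $ j)"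
  shows "antisym X"
proof -
  have "transpose X $ i $ j = (- X) $ i $ j" for i j
    unfolding transpose_def using assms [of i j] by (simp only: vec_lambda_beta vector_uminus_component)
  then show ?thesis by (simp add: antisym_def vec_eq_iff)
qed

lemma antisym_contr: "alternating F \<Longrightarrow> antisym (contr F w)"
proof (rule antisymI)
  fix i j assume "alternating F"
  then have "F $ j $ i $ k = - (F $ i $ j $ k)" for k by (rule alternatingD)
  then show "contr F w $ j $ i = - (contr F w $ i $ j)"
    by (simp add: contr_def sum_negf)
qed

lemma contr_contr:
  assumes F: "alternating F"
  shows "contr F w *v w = 0"
proof -
  have "(contr F w *v w) $ i = 0" for i
  proof -
    have "(contr F w *v w) $ i = (\<Sum>j\<in>UNIV. \<Sum>k\<in>UNIV. F $ i $ j $ k * w $ k * w $ j)"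
      by (simp add: contr_def matrix_vector_mult_def sum_distrib_right)
    also have "\<dots> = (\<Sum>k\<in>UNIV. \<Sum>j\<in>UNIV. F $ i $ j $ k * w $ k * w $ j)"
      by (rule sum.swap)
    also have "\<dots> = (\<Sum>k\<in>UNIV. \<Sum>j\<in>UNIV. - (F $ i $ k $ j * w $ j * w $ k))"
      by (intro sum.cong refl) (subst alternatingD(2) [OF F], simp)
    also have "\<dots> = - (contr F w *v w) $ i"
      by (simp add: contr_def matrix_vector_mult_def sum_distrib_right sum_negf)
    finally show ?thesis by simp
  qed
  then show ?thesis by (simp add: vec_eq_iff)
qed

lemma inner_tensor: "tensor X u \<bullet> T = X \<bullet> contr T u"
  by (simp add: inner_triple tensor_def contr_def inner_vec_def sum_distrib_left mult_ac)

lemma contr_scaleR: "contr (c *\<^sub>R F) u = c *\<^sub>R contr F u"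
  by (simp add: contr_def vec_eq_iff sum_distrib_left mult_ac)

lemma magnetic_contr: "magnetic g F v = lower2 g (contr (dual g F) v)"
  by (simp add: magnetic_def contr_def)

text \<open>The lowering in \<open>magnetic\<close> cancels the raising in \<open>ip\<close>; the
  metric survives only in the density factor.\<close>

lemma ip_magnetic:
  assumes "transpose g = g" "invertible g"
  shows "ip g X (magnetic g F u) = 1 / (6 * sqrt (- det g)) * omega (tensor X u) F"
  by (simp add: ip_def magnetic_contr raise2_lower2 assms omega_def inner_tensor dual_eq contr_scaleR)

section \<open>Contraction with the Levi-Civita symbol\<close>

lemma omega_tensor:
  "omega (tensor X u) (tensor Y v) =
    (\<Sum>i\<in>UNIV. \<Sum>j\<in>UNIV. \<Sum>k\<in>UNIV. \<Sum>l\<in>UNIV. \<Sum>m\<in>UNIV. \<Sum>n\<in>UNIV.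
      eps i j k l m n * X $ i $ j * u $ k * Y $ l $ m * v $ n)"
  by (simp add: omega_def inner_triple epsc_def tensor_def sum_distrib_left mult_ac)

lemma eps_swap_pairs: "eps l m k i j n = eps i j k l m n"
proof -
  have "eps l m k i j n = - eps l m i k j n" by (rule eps_swap)
  also have "\<dots> = eps l i m k j n" by (simp add: eps_swap(2) [of l m i])
  also have "\<dots> = - eps i l m k j n" by (rule eps_swap)
  also have "\<dots> = eps i l m j k n" by (simp add: eps_swap(4) [of i l m k])
  also have "\<dots> = - eps i l j m k n" by (rule eps_swap)
  also have "\<dots> = eps i j l m k n" by (simp add: eps_swap(2) [of i l j])
  also have "\<dots> = - eps i j l k m n" by (rule eps_swap)
  also have "\<dots> = eps i j k l m n" by (simp add: eps_swap(3) [of i j l])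
  finally show ?thesis .
qed

lemma sum_swap_pairs:
  fixes f :: "6 \<Rightarrow> 6 \<Rightarrow> 6 \<Rightarrow> 6 \<Rightarrow> 6 \<Rightarrow> 6 \<Rightarrow> real"
  shows "(\<Sum>i\<in>UNIV. \<Sum>j\<in>UNIV. \<Sum>k\<in>UNIV. \<Sum>l\<in>UNIV. \<Sum>m\<in>UNIV. \<Sum>n\<in>UNIV. f i j k l m n) =
    (\<Sum>i\<in>UNIV. \<Sum>j\<in>UNIV. \<Sum>k\<in>UNIV. \<Sum>l\<in>UNIV. \<Sum>m\<in>UNIV. \<Sum>n\<in>UNIV. f l m k i j n)"
  unfolding sum.cartesian_product
  by (rule sum.reindex_bij_witness [where i = "\<lambda>(i, j, k, l, m, n). (l, m, k, i, j, n)"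
        and j = "\<lambda>(i, j, k, l, m, n). (l, m, k, i, j, n)"]) auto

text \<open>Exchanging the two index pairs while \<open>u\<close> and \<open>v\<close> stay in place
  is an even permutation. Unlike \<open>omega_commute\<close> this is a symmetry, so it makes the
  expression a symmetric bilinear form in \<open>X\<close> and \<open>Y\<close> for fixed
  \<open>u\<close> and \<open>v\<close>.\<close>

lemma omega_tensor_commute: "omega (tensor X u) (tensor Y v) = omega (tensor Y u) (tensor X v)"
  unfolding omega_tensor
  by (subst sum_swap_pairs) (simp add: eps_swap_pairs mult_ac)

lemma epsc_permute:
  "epsc (\<chi> i j k. T $ i $ k $ j) = - epsc T"
  "epsc (\<chi> i j k. T $ j $ i $ k) = - epsc T"
proof -
  have "epsc (\<chi> i j k. T $ i $ k $ j) $ a $ b $ c = - epsc T $ a $ b $ c" for a b c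
  proof -
    have "epsc (\<chi> i j k. T $ i $ k $ j) $ a $ b $ c =
       (\<Sum>l\<in>UNIV. \<Sum>n\<in>UNIV. \<Sum>m\<in>UNIV. eps a b c l m n * T $ l $ n $ m)"
      unfolding epsc_def by (simp, rule sum.cong [OF refl], rule sum.swap)
    also have "\<dots> = (\<Sum>l\<in>UNIV. \<Sum>n\<in>UNIV. \<Sum>m\<in>UNIV. - (eps a b c l n m * T $ l $ n $ m))"
      by (intro sum.cong refl) (subst eps_swap(5), simp)
    finally show ?thesis by (simp add: epsc_def sum_negf)
  qed
  then show "epsc (\<chi> i j k. T $ i $ k $ j) = - epsc T" by (simp add: vec_eq_iff)
  have "epsc (\<chi> i j k. T $ j $ i $ k) $ a $ b $ c = - epsc T $ a $ b $ c" for a b c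
  proof -
    have "epsc (\<chi> i j k. T $ j $ i $ k) $ a $ b $ c =
       (\<Sum>m\<in>UNIV. \<Sum>l\<in>UNIV. \<Sum>n\<in>UNIV. eps a b c l m n * T $ m $ l $ n)"
      unfolding epsc_def by (simp, rule sum.swap)
    also have "\<dots> = (\<Sum>m\<in>UNIV. \<Sum>l\<in>UNIV. \<Sum>n\<in>UNIV. - (eps a b c m l n * T $ m $ l $ n))"
      by (intro sum.cong refl) (subst eps_swap(4), simp)
    finally show ?thesis by (simp add: epsc_def sum_negf)
  qed
  then show "epsc (\<chi> i j k. T $ j $ i $ k) = - epsc T" by (simp add: vec_eq_iff)
qed

text \<open>
  The projector \<open>1 + v \<otimes> n\<close> onto covectors annihilated by \<open>n\<close> is singular, so \<open>omega_frame\<close> kills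
  the contraction of purely transverse tensors; only the part of \<open>F\<close> along \<open>v\<close> survives.
\<close>

lemma omega_transverse:
  fixes v n :: "real^6"
  assumes F: "alternating F" and vn: "v \<bullet> n = - 1"
    and X: "X *v n = 0" "transpose X *v n = 0" and u: "u \<bullet> n = 0"
  shows "omega (tensor X u) F = - 3 * omega (tensor X u) (tensor (contr F n) v)"
proof -
  define P :: "real^6^6" where "P = mat 1 + (\<chi> a i. n $ a * v $ i)"
  define E where "E = contr F n"
  have P: "transpose P *v x = x + (n \<bullet> x) *\<^sub>R v" "P *v x = x + (v \<bullet> x) *\<^sub>R n" for x
  proof -
    have "transpose P = mat 1 + (\<chi> i a. n $ a * v $ i)"
      by (auto simp: P_def transpose_def mat_def vec_eq_iff)
    then show "transpose P *v x = x + (n \<bullet> x) *\<^sub>R v" "P *v x = x + (v \<bullet> x) *\<^sub>R n"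
      by (simp_all add: P_def matrix_vector_mult_add_rdistrib)
        (simp_all add: vec_eq_iff matrix_vector_mult_def inner_vec_def sum_distrib_left mult_ac)
  qed
  have "P *v n = 0" "n \<noteq> 0"
    using vn by (auto simp: P)
  then have det: "det P = 0"
    by (metis invertible_det_nz matrix_left_invertible_ker invertible_def)
  have "transpose P ** X ** P = X"
  proof -
    have "(X ** P) *v x = X *v x" for x
      by (simp add: P X matrix_vector_right_distrib matrix_vector_mult_scaleR
          flip: matrix_vector_mul_assoc)
    then have "X ** P = X" by (simp add: matrix_eq)
    moreover have "n v* X = 0" using X(2) by simp
    then have "(transpose X ** P) *v x = transpose X *v x" for x
      by (simp add: P matrix_vector_right_distrib matrix_vector_mult_scaleR
          flip: matrix_vector_mul_assoc)
    then have "transpose X ** P = transpose X" by (simp add: matrix_eq)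
    then have "transpose P ** X = X"
      by (metis matrix_transpose_mul transpose_transpose)
    ultimately show ?thesis by simp
  qed
  moreover have "transpose P *v u = u"
    using u P(1) [of u] by (simp add: inner_commute)
  ultimately have PXu: "frame_three_form P (tensor X u) = tensor X u"
    by (simp add: frame_tensor)
  have E: "antisym E" "E *v n = 0"
    using F by (simp_all add: E_def antisym_contr contr_contr)
  have n3: "(\<Sum>c\<in>UNIV. F $ a $ b $ c * n $ c) = E $ a $ b" for a b
    by (simp add: E_def contr_def)
  have n2: "(\<Sum>b\<in>UNIV. F $ a $ b $ c * n $ b) = - E $ a $ c" for a c
  proof -
    have "(\<Sum>b\<in>UNIV. F $ a $ b $ c * n $ b) = (\<Sum>b\<in>UNIV. - (F $ a $ c $ b * n $ b))"
      by (intro sum.cong refl) (subst alternatingD(2) [OF F], simp)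
    then show ?thesis by (simp add: sum_negf n3)
  qed
  have n1: "(\<Sum>a\<in>UNIV. F $ a $ b $ c * n $ a) = E $ b $ c" for b c
  proof -
    have "(\<Sum>a\<in>UNIV. F $ a $ b $ c * n $ a) = (\<Sum>a\<in>UNIV. - (F $ b $ a $ c * n $ a))"
      by (intro sum.cong refl) (subst alternatingD(1) [OF F], simp)
    then show ?thesis by (simp add: sum_negf n2)
  qed
  have En2: "(\<Sum>b\<in>UNIV. E $ a $ b * n $ b) = 0" for a
    using E(2) by (simp add: matrix_vector_mult_def vec_eq_iff)
  have En1: "(\<Sum>a\<in>UNIV. E $ a $ b * n $ a) = 0" for b
  proof -
    have "(\<Sum>a\<in>UNIV. E $ a $ b * n $ a) = (\<Sum>a\<in>UNIV. - (E $ b $ a * n $ a))"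
      by (intro sum.cong refl) (subst antisymD [OF E(1)], simp)
    then show ?thesis by (simp add: sum_negf En2)
  qed
  have P3: "(\<Sum>c\<in>UNIV. P $ c $ k * f c) = f k + v $ k * (\<Sum>c\<in>UNIV. f c * n $ c)" for f k
    by (simp add: P_def distrib_right sum.distrib)
      (simp add: mat_def if_distrib if_distribR mult_ac sum_distrib_left cong: if_cong)
  \<comment> \<open>Expanding the three projectors one index at a time; terms with two or three
    factors \<open>v\<close> vanish because \<open>E\<close> annihilates \<open>n\<close>.\<close>
  have "frame_three_form P F $ i $ j $ k = F $ i $ j $ k + tensor E v $ i $ j $ k
      - tensor E v $ i $ k $ j + tensor E v $ j $ k $ i" for i j k
  proof -
    have "frame_three_form P F $ i $ j $ k =
      (\<Sum>a\<in>UNIV. P $ a $ i * (\<Sum>b\<in>UNIV. P $ b $ j * (\<Sum>c\<in>UNIV. P $ c $ k * F $ a $ b $ c)))"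
      by (simp add: frame_three_form_def sum_distrib_left mult_ac)
    also have "\<dots> = (\<Sum>a\<in>UNIV. P $ a $ i * (\<Sum>b\<in>UNIV. P $ b $ j * (F $ a $ b $ k + v $ k * E $ a $ b)))"
      by (simp add: P3 n3)
    also have "\<dots> = (\<Sum>a\<in>UNIV. P $ a $ i * (F $ a $ j $ k + v $ k * E $ a $ j - v $ j * E $ a $ k))"
    proof -
      have "(\<Sum>b\<in>UNIV. (F $ a $ b $ k + v $ k * E $ a $ b) * n $ b) =
        (\<Sum>b\<in>UNIV. F $ a $ b $ k * n $ b) + v $ k * (\<Sum>b\<in>UNIV. E $ a $ b * n $ b)" for a
        by (simp add: algebra_simps sum.distrib sum_distrib_left)
      then show ?thesis by (simp add: P3 n2 En2)
    qed
    also have "\<dots> = F $ i $ j $ k + v $ k * E $ i $ j - v $ j * E $ i $ k + v $ i * E $ j $ k"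
    proof -
      have "(\<Sum>a\<in>UNIV. (F $ a $ j $ k + v $ k * E $ a $ j - v $ j * E $ a $ k) * n $ a) =
        (\<Sum>a\<in>UNIV. F $ a $ j $ k * n $ a) + v $ k * (\<Sum>a\<in>UNIV. E $ a $ j * n $ a)
        - v $ j * (\<Sum>a\<in>UNIV. E $ a $ k * n $ a)"
        by (simp add: algebra_simps sum.distrib sum_subtractf sum_distrib_left)
      then show ?thesis by (simp add: P3 n1 En1)
    qed
    finally show ?thesis by (simp add: tensor_def mult_ac)
  qed
  then have PF: "frame_three_form P F = F + tensor E v - (\<chi> i j k. tensor E v $ i $ k $ j)
      + (\<chi> i j k. tensor E v $ j $ k $ i)"
    by (simp add: vec_eq_iff)
  \<comment> \<open>A cyclic permutation is even and a transposition odd, so under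
    \<open>epsc\<close> the three correction terms are equal; hence the factor 3.\<close>
  have cyc: "epsc (\<chi> i j k. tensor E v $ j $ k $ i) = epsc (tensor E v)"
    using epsc_permute(2) [of "\<chi> i j k. tensor E v $ i $ k $ j"] epsc_permute(1) [of "tensor E v"]
    by simp
  have "epsc (frame_three_form P F) = epsc F + 3 *\<^sub>R epsc (tensor E v)"
    unfolding PF linear_add [OF linear_epsc] linear_diff [OF linear_epsc] cyc epsc_permute
    by (simp add: vec_eq_iff)
  then have "omega (tensor X u) (frame_three_form P F) =
      omega (tensor X u) F + 3 * omega (tensor X u) (tensor E v)"
    by (simp add: omega_def inner_simps)
  moreover have "omega (tensor X u) (frame_three_form P F) = 0"
    using omega_frame [of P "tensor X u" F] by (simp add: PXu det)
  ultimately show ?thesis by (simp add: E_def)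
qed

text \<open>The coefficient is \<open>- 3\<close> from \<open>omega_transverse\<close> times the
  \<open>1 / 6\<close> of \<open>ip_magnetic\<close>. The second formula is the first one applied to
  the dual form, whose magnetic part is \<open>electric g F u\<close> since the dual is an
  involution.\<close>

lemma
  assumes g: "lorentzian g" and F: "alternating F" and v: "v \<bullet> raise1 g v = - 1"
    and X: "antisym X" "X *v raise1 g v = 0" and u: "u \<bullet> raise1 g v = 0"
  shows ip_magnetic_transverse: "ip g X (magnetic g F u) =
      - 1 / (2 * sqrt (- det g)) * omega (tensor X u) (tensor (electric g F v) v)"
    and ip_electric_transverse: "ip g X (electric g F u) =
      - 1 / (2 * sqrt (- det g)) * omega (tensor X u) (tensor (magnetic g F v) v)"
proof -
  note sym = lorentzian_transpose [OF g] lorentzian_invertible [OF g]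
  have X': "transpose X *v raise1 g v = 0"
    using X unfolding antisym_def by (simp add: vec_eq_iff matrix_vector_mult_def sum_negf)
  have *: "ip g X (magnetic g F u) =
      - 1 / (2 * sqrt (- det g)) * omega (tensor X u) (tensor (electric g F v) v)"
    if "alternating F" for F
    using omega_transverse [OF that v X(2) X' u]
    by (simp add: ip_magnetic [OF sym] electric_eq)
  show "ip g X (magnetic g F u) =
      - 1 / (2 * sqrt (- det g)) * omega (tensor X u) (tensor (electric g F v) v)"
    by (rule * [OF F])
  have "electric g F u = magnetic g (ldual g F) u"
    by (simp add: magnetic_eq_electric [OF sym] ldual_ldual F sym lorentzian_det g)
  then show "ip g X (electric g F u) =
      - 1 / (2 * sqrt (- det g)) * omega (tensor X u) (tensor (magnetic g F v) v)"
    by (simp add: * alternating_ldual magnetic_eq_electric [OF sym, of F])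
qed

section \<open>Covariance\<close>

definition congr :: "real^6^6 \<Rightarrow> real^6^6 \<Rightarrow> real^6^6" where
  "congr P X = transpose P ** X ** P"

definition constitutive ::
    "(real \<Rightarrow> real \<Rightarrow> real) \<Rightarrow> real^6^6 \<Rightarrow> real^6^6 \<Rightarrow> real \<Rightarrow> real \<Rightarrow> real^6^6" where
  "constitutive H g B s p =
     (H_s H s p + 2 * s / p * H_p H s p) *\<^sub>R B + (H_p H s p / p) *\<^sub>R cube g B"

lemma H_tensor_eq:
  "H_tensor H g F v = constitutive H g (magnetic g F v) (s_inv g F v) (p_inv g F v)"
  by (simp add: H_tensor_def constitutive_def cube_def Let_def)

lemma s_inv_eq: "s_inv g F v = 1 / 4 * ip g (magnetic g F v) (magnetic g F v)"
  by (simp add: s_inv_def ip_sum)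

lemma eps_p_vec: "eps \<mu> \<nu> \<rho> \<tau> \<sigma> \<kappa> = eps \<rho> \<tau> \<mu> \<sigma> \<kappa> \<nu>"
proof -
  have "eps \<mu> \<nu> \<rho> \<tau> \<sigma> \<kappa> = - eps \<mu> \<rho> \<nu> \<tau> \<sigma> \<kappa>" by (rule eps_swap)
  also have "\<dots> = eps \<rho> \<mu> \<nu> \<tau> \<sigma> \<kappa>" by (simp add: eps_swap(1) [of \<mu> \<rho>])
  also have "\<dots> = - eps \<rho> \<mu> \<tau> \<nu> \<sigma> \<kappa>" by (rule eps_swap)
  also have "\<dots> = eps \<rho> \<tau> \<mu> \<nu> \<sigma> \<kappa>" by (simp add: eps_swap(2) [of \<rho> \<mu> \<tau>])
  also have "\<dots> = - eps \<rho> \<tau> \<mu> \<sigma> \<nu> \<kappa>" by (rule eps_swap)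
  also have "\<dots> = eps \<rho> \<tau> \<mu> \<sigma> \<kappa> \<nu>" by (simp add: eps_swap(5) [of \<rho> \<tau> \<mu> \<sigma> \<nu>])
  finally show ?thesis .
qed

text \<open>Testing \<open>p_vec\<close> against a covector expresses it through
  \<open>omega\<close>, for which covariance and the rest-frame formulas are available.\<close>

lemma inner_p_vec:
  "u \<bullet> p_vec g F v = - 1 / (8 * sqrt (- det g)) *
     omega (tensor (magnetic g F v) u) (tensor (magnetic g F v) v)"
proof -
  define B where "B = magnetic g F v"
  have "omega (tensor B u) (tensor B v) =
     (\<Sum>\<mu>\<in>UNIV. \<Sum>\<nu>\<in>UNIV. \<Sum>\<rho>\<in>UNIV. \<Sum>\<tau>\<in>UNIV. \<Sum>\<sigma>\<in>UNIV. \<Sum>\<kappa>\<in>UNIV.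
        eps \<rho> \<tau> \<mu> \<sigma> \<kappa> \<nu> * B $ \<rho> $ \<tau> * u $ \<mu> * B $ \<sigma> $ \<kappa> * v $ \<nu>)"
    unfolding omega_tensor sum.cartesian_product
    by (rule sum.reindex_bij_witness [where j = "\<lambda>(i, j, k, l, m, n). (k, n, i, j, l, m)"
        and i = "\<lambda>(k, n, i, j, l, m). (i, j, k, l, m, n)"]) auto
  also have "\<dots> = (\<Sum>\<mu>\<in>UNIV. u $ \<mu> * (\<Sum>\<nu>\<in>UNIV. \<Sum>\<rho>\<in>UNIV. \<Sum>\<tau>\<in>UNIV. \<Sum>\<sigma>\<in>UNIV. \<Sum>\<kappa>\<in>UNIV.
        eps \<mu> \<nu> \<rho> \<tau> \<sigma> \<kappa> * B $ \<rho> $ \<tau> * B $ \<sigma> $ \<kappa> * v $ \<nu>))"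
  proof -
    have "eps \<rho> \<tau> \<mu> \<sigma> \<kappa> \<nu> * B $ \<rho> $ \<tau> * u $ \<mu> * B $ \<sigma> $ \<kappa> * v $ \<nu> =
        u $ \<mu> * (eps \<mu> \<nu> \<rho> \<tau> \<sigma> \<kappa> * B $ \<rho> $ \<tau> * B $ \<sigma> $ \<kappa> * v $ \<nu>)" for \<mu> \<nu> \<rho> \<tau> \<sigma> \<kappa>
      by (simp add: eps_p_vec [of \<mu> \<nu> \<rho> \<tau> \<sigma> \<kappa>])
    then show ?thesis by (simp only: sum_distrib_left)
  qed
  finally show ?thesis
    by (simp add: inner_vec_def p_vec_def B_def [symmetric] sum_distrib_left mult_ac)
qed

context
  fixes g P :: "real^6^6"
  assumes g: "lorentzian g" and P: "det P > 0"
begin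

private lemma sym: "transpose g = g" "invertible g" "det g < 0"
  using lorentzian_transpose lorentzian_invertible lorentzian_det g by blast+

private lemma P_inv: "invertible P" "P ** matrix_inv P = mat 1" "matrix_inv P ** P = mat 1"
proof -
  show "invertible P" using P by (simp add: invertible_det_nz)
  then show "P ** matrix_inv P = mat 1" "matrix_inv P ** P = mat 1" by (rule matrix_inv_mult)+
qed

private lemma P_inv': "transpose (matrix_inv P) ** transpose P = mat 1"
  "transpose P ** transpose (matrix_inv P) = mat 1"
  by (simp_all add: P_inv transpose_mat flip: matrix_transpose_mul)

lemma matrix_inv_frame:
  "matrix_inv (frame_metric P g) = matrix_inv P ** matrix_inv g ** transpose (matrix_inv P)"
proof (rule matrix_inv_unique)
  have "frame_metric P g ** (matrix_inv P ** matrix_inv g ** transpose (matrix_inv P)) =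
    transpose P ** (g ** ((P ** matrix_inv P) ** matrix_inv g)) ** transpose (matrix_inv P)"
    by (simp add: frame_metric_def matrix_mul_assoc)
  then show "frame_metric P g ** (matrix_inv P ** matrix_inv g ** transpose (matrix_inv P)) = mat 1"
    by (simp add: P_inv P_inv' matrix_inv_mult sym)
qed

lemma raise1_frame: "P *v raise1 (frame_metric P g) (frame_covector P u) = raise1 g u"
proof -
  have "P *v raise1 (frame_metric P g) (frame_covector P u) =
    ((P ** matrix_inv P) ** matrix_inv g ** (transpose (matrix_inv P) ** transpose P)) *v u"
    by (simp only: raise1_def matrix_inv_frame frame_covector_def matrix_vector_mul_assoc matrix_mul_assoc)
  then show ?thesis by (simp add: P_inv P_inv' raise1_def)
qed

lemma electric_frame:
  "electric (frame_metric P g) (frame_three_form P F) (frame_covector P v) = congr P (electric g F v)"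
  by (simp add: electric_eq contr_frame raise1_frame congr_def)

lemma det_frame: "det (frame_metric P g) = det P * det P * det g"
  by (simp add: frame_metric_def det_mul)

text \<open>Here the orientation enters: the root yields the absolute value of \<open>det P\<close>,
  whereas \<open>omega\<close> scales with \<open>det P\<close> itself, and the two cancel only for
  a positive determinant.\<close>

lemma sqrt_det_frame: "sqrt (- det (frame_metric P g)) = det P * sqrt (- det g)"
proof -
  have "- det (frame_metric P g) = (det P)\<^sup>2 * (- det g)"
    by (simp add: det_frame power2_eq_square)
  then show ?thesis using P by (simp only: real_sqrt_mult real_sqrt_abs abs_of_pos)
qed

text \<open>The metric in the new frame ends in \<open>transpose P\<close>, which meets the inner
  \<open>P\<close> around \<open>epsc\<close>; \<open>frame_epsc\<close> absorbs both, and the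
  resulting \<open>det P\<close> cancels that of the density.\<close>

lemma ldual_frame: "ldual (frame_metric P g) (frame_three_form P F) = frame_three_form P (ldual g F)"
proof -
  define c where "c = 1 / (6 * sqrt (- det (frame_metric P g)))"
  have "ldual (frame_metric P g) (frame_three_form P F) =
    c *\<^sub>R frame_three_form P (frame_three_form g (frame_three_form (transpose P) (epsc (frame_three_form P F))))"
    by (simp add: ldual_def dual_eq c_def linear_scale [OF linear_frame_three_form])
      (simp add: frame_metric_def frame_compose)
  also have "\<dots> = (c * det P) *\<^sub>R frame_three_form P (frame_three_form g (epsc F))"
    by (simp add: frame_epsc linear_scale [OF linear_frame_three_form])
  also have "c * det P = 1 / (6 * sqrt (- det g))"
    using P by (simp add: c_def sqrt_det_frame)
  finally show ?thesis
    by (simp add: ldual_def dual_eq linear_scale [OF linear_frame_three_form])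
qed

lemma lorentzian_frame_metric: "lorentzian (frame_metric P g)"
  using lorentzian_frame g P_inv by blast

lemma magnetic_frame:
  "magnetic (frame_metric P g) (frame_three_form P F) (frame_covector P v) = congr P (magnetic g F v)"
  by (simp add: magnetic_eq_electric lorentzian_transpose lorentzian_invertible
      lorentzian_frame_metric g ldual_frame electric_frame)

lemma raise2_frame:
  "P ** raise2 (frame_metric P g) (congr P X) ** transpose P = raise2 g X"
proof -
  have t: "transpose (matrix_inv P ** matrix_inv g ** transpose (matrix_inv P)) =
    matrix_inv P ** transpose (matrix_inv g) ** transpose (matrix_inv P)"
    by (simp add: matrix_transpose_mul matrix_mul_assoc)
  have "P ** raise2 (frame_metric P g) (congr P X) ** transpose P =
    (P ** matrix_inv P) ** matrix_inv g ** (transpose (matrix_inv P) ** transpose P) ** X **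
    (P ** matrix_inv P) ** transpose (matrix_inv g) ** (transpose (matrix_inv P) ** transpose P)"
    by (simp only: raise2_def matrix_inv_frame congr_def t matrix_mul_assoc)
  then show ?thesis by (simp add: P_inv P_inv' raise2_def)
qed

lemma ip_frame: "ip (frame_metric P g) (congr P X) (congr P Y) = ip g X Y"
proof -
  have "ip (frame_metric P g) (congr P X) (congr P Y) =
      X \<bullet> (P ** raise2 (frame_metric P g) (congr P Y) ** transpose P)"
    by (simp only: ip_def congr_def [of P X] inner_congruence)
  then show ?thesis by (simp add: raise2_frame ip_def)
qed

lemma cube_frame: "cube (frame_metric P g) (congr P B) = congr P (cube g B)"
proof -
  have "cube (frame_metric P g) (congr P B) =
    transpose P ** B ** (P ** raise2 (frame_metric P g) (congr P B) ** transpose P) ** B ** P"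
    by (simp only: cube_def congr_def matrix_mul_assoc)
  also have "P ** raise2 (frame_metric P g) (congr P B) ** transpose P = raise2 g B"
    by (rule raise2_frame)
  finally show ?thesis by (simp only: cube_def congr_def matrix_mul_assoc)
qed

lemma omega_tensor_frame:
  "omega (tensor (congr P X) (frame_covector P u)) (tensor (congr P Y) (frame_covector P v)) =
    det P * omega (tensor X u) (tensor Y v)"
  by (simp only: congr_def frame_covector_def omega_frame flip: frame_tensor)

lemma s_inv_frame:
  "s_inv (frame_metric P g) (frame_three_form P F) (frame_covector P v) = s_inv g F v"
  by (simp add: s_inv_eq magnetic_frame ip_frame)

lemma p_vec_frame:
  "P *v p_vec (frame_metric P g) (frame_three_form P F) (frame_covector P v) = p_vec g F v"
proof -
  have "u \<bullet> (P *v p_vec (frame_metric P g) (frame_three_form P F) (frame_covector P v)) = u \<bullet> p_vec g F v" for u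
  proof -
    have "u \<bullet> (P *v p_vec (frame_metric P g) (frame_three_form P F) (frame_covector P v)) =
      frame_covector P u \<bullet> p_vec (frame_metric P g) (frame_three_form P F) (frame_covector P v)"
      by (simp add: frame_covector_def dot_lmul_matrix)
    also have "\<dots> = u \<bullet> p_vec g F v"
      using P by (simp add: inner_p_vec magnetic_frame omega_tensor_frame sqrt_det_frame)
    finally show ?thesis .
  qed
  then show ?thesis by (metis vector_eq_ldot)
qed

lemma inner_frame_metric: "x \<bullet> (frame_metric P g *v y) = (P *v x) \<bullet> (g *v (P *v y))"
  by (simp add: frame_metric_def dot_lmul_matrix inner_commute flip: matrix_vector_mul_assoc)
   (metis dot_lmul_matrix inner_commute)

lemma p_inv_frame:
  "p_inv (frame_metric P g) (frame_three_form P F) (frame_covector P v) = p_inv g F v"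
  by (simp add: p_inv_def inner_frame_metric p_vec_frame)

lemma congr_add: "congr P (a *\<^sub>R X + b *\<^sub>R Y) = a *\<^sub>R congr P X + b *\<^sub>R congr P Y"
  by (simp add: congr_def vec_eq_iff matrix_entry sum.distrib sum_distrib_left sum_distrib_right
      algebra_simps)

lemma H_tensor_frame:
  "H_tensor H (frame_metric P g) (frame_three_form P F) (frame_covector P v) = congr P (H_tensor H g F v)"
  by (simp add: H_tensor_eq s_inv_frame p_inv_frame magnetic_frame constitutive_def congr_add cube_frame)

lemma self_dual_frame:
  "self_dual H g F v \<Longrightarrow> self_dual H (frame_metric P g) (frame_three_form P F) (frame_covector P v)"
  by (simp add: self_dual_def electric_frame H_tensor_frame)

lemma onshell_lagrangian_frame:
  "onshell_lagrangian H (frame_metric P g) (frame_three_form P F) (frame_covector P v) = onshell_lagrangian H g F v"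
  by (simp add: onshell_lagrangian_def s_inv_frame p_inv_frame)

end

text \<open>The metric is brought to Minkowski form by the inverse of \<open>Q\<close>, a Lorentzian
  Householder reflection \<open>L\<close> sends the covector to the time axis up to sign, and a
  diagonal matrix \<open>D\<close> corrects this sign and the orientation.\<close>

lemma exists_rest_frame:
  assumes g: "lorentzian g" and v: "v \<bullet> raise1 g v = - 1"
  obtains P where "det P > 0" "frame_metric P g = minkowski" "frame_covector P v = axis 0 1"
proof -
  obtain Q where Q: "invertible Q" "g = transpose Q ** minkowski ** Q"
    using g by (auto simp: lorentzian_def)
  define P1 where "P1 = matrix_inv Q"
  have QP: "Q ** P1 = mat 1" by (simp add: P1_def matrix_inv_mult Q)
  then have QP': "transpose P1 ** transpose Q = mat 1"
    by (metis matrix_transpose_mul transpose_mat)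
  have P1: "frame_metric P1 g = minkowski"
  proof -
    have "frame_metric P1 g = (transpose P1 ** transpose Q) ** minkowski ** (Q ** P1)"
      by (simp add: frame_metric_def Q matrix_mul_assoc)
    then show ?thesis by (simp add: QP QP')
  qed
  define x where "x = frame_covector P1 v"
  have x: "x \<bullet> (minkowski *v x) = - 1"
  proof -
    have "matrix_inv g = P1 ** minkowski ** transpose P1"
    proof (rule matrix_inv_unique)
      have "g ** (P1 ** minkowski ** transpose P1) =
          transpose Q ** (minkowski ** ((Q ** P1) ** minkowski)) ** transpose P1"
        by (simp add: Q matrix_mul_assoc)
      also have "\<dots> = transpose (P1 ** Q)"
        by (simp add: QP minkowski_sq matrix_transpose_mul)
      also have "P1 ** Q = mat 1" using QP matrix_left_right_inverse by blast
      finally show "g ** (P1 ** minkowski ** transpose P1) = mat 1" by (simp add: transpose_mat)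
    qed
    then have "v \<bullet> raise1 g v = v \<bullet> (P1 *v (minkowski *v (transpose P1 *v v)))"
      by (simp add: raise1_def matrix_vector_mul_assoc matrix_mul_assoc del: transpose_matrix_vector)
    then show ?thesis
      using v by (simp add: x_def frame_covector_def dot_lmul_matrix)
  qed
  \<comment> \<open>The sign is opposite to that of \<open>x $ 0\<close>, so that
    \<open>n \<bullet> m = - 2 + 2 * d * x $ 0\<close> is at most \<open>- 2\<close> and the
    reflection exists.\<close>
  define d :: real where "d = (if x $ 0 \<ge> 0 then - 1 else 1)"
  define n where "n = x - d *\<^sub>R axis 0 1"
  define m where "m = minkowski *v n"
  define c where "c = 2 / (n \<bullet> m)"
  \<comment> \<open>The reflection in the hyperplane orthogonal to \<open>n\<close> with respect to
    \<open>minkowski\<close>. Since \<open>m \<bullet> x\<close> is half of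
    \<open>n \<bullet> m\<close>, its transpose maps \<open>x\<close> to
    \<open>x - n\<close>.\<close>
  define L where "L = mat 1 - c *\<^sub>R (\<chi> a i. m $ a * n $ i)"
  have d: "d * d = 1" by (simp add: d_def)
  have mink_axis: "minkowski *v axis 0 1 = - axis 0 (1 :: real)"
    by (simp add: minkowski_mult vec_eq_iff axis_def)
  have ms: "a \<bullet> (minkowski *v b) = (minkowski *v a) \<bullet> b" for a b
    by (metis dot_lmul_matrix transpose_matrix_vector transpose_minkowski)
  have a0: "axis 0 1 \<bullet> x = x $ 0" "x \<bullet> axis 0 1 = x $ 0" "axis 0 1 \<bullet> axis (0::6) (1::real) = 1"
    by (simp_all add: inner_axis inner_axis' )
  have nm: "n \<bullet> m = - 2 + 2 * d * x $ 0"
    using x d by (simp add: n_def m_def matrix_vector_mult_diff_distrib matrix_vector_mult_scaleR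
        mink_axis inner_simps a0 ms [of x "axis 0 1"])
      (simp add: ms [of "axis 0 1" x] mink_axis inner_simps a0 algebra_simps)
  then have nz: "n \<bullet> m \<noteq> 0" and xm: "m \<bullet> x = (n \<bullet> m) / 2"
  proof -
    show "n \<bullet> m \<noteq> 0" using nm by (simp add: d_def split: if_splits)
    have "m \<bullet> x = n \<bullet> (minkowski *v x)" by (simp add: m_def ms)
    then show "m \<bullet> x = (n \<bullet> m) / 2"
      using nm x by (simp add: n_def inner_simps ms [of "axis 0 1" x] mink_axis a0)
  qed
  have Lv: "L *v y = y - (c * (n \<bullet> y)) *\<^sub>R m" "transpose L *v y = y - (c * (m \<bullet> y)) *\<^sub>R n" for y
  proof -
    have "transpose L = mat 1 - c *\<^sub>R (\<chi> i a. m $ a * n $ i)"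
      by (auto simp: L_def transpose_def mat_def vec_eq_iff)
    then show "L *v y = y - (c * (n \<bullet> y)) *\<^sub>R m" "transpose L *v y = y - (c * (m \<bullet> y)) *\<^sub>R n"
      by (simp_all add: L_def matrix_vector_mult_diff_rdistrib scaleR_matrix_vector_assoc [symmetric])
        (simp_all add: vec_eq_iff matrix_vector_mult_def inner_vec_def sum_distrib_left mult_ac)
  qed
  have mm: "minkowski *v m = n"
    by (simp add: m_def matrix_vector_mul_assoc minkowski_sq)
  have L: "frame_metric L minkowski = minkowski"
  proof -
    have "frame_metric L minkowski *v y = minkowski *v y" for y
    proof -
      have "frame_metric L minkowski *v y = transpose L *v (minkowski *v (L *v y))"
        by (simp add: frame_metric_def matrix_vector_mul_assoc matrix_mul_assoc)
      also have "\<dots> = transpose L *v (minkowski *v y - (c * (n \<bullet> y)) *\<^sub>R n)"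
        by (simp only: Lv matrix_vector_mult_diff_distrib matrix_vector_mult_scaleR mm)
      also have "\<dots> = minkowski *v y - (c * (n \<bullet> y)) *\<^sub>R n
          - (c * (n \<bullet> y - c * (n \<bullet> y) * (n \<bullet> m))) *\<^sub>R n"
        by (simp only: Lv inner_diff_right ms mm inner_scaleR_right inner_commute [of m n])
      also have "c * (n \<bullet> y - c * (n \<bullet> y) * (n \<bullet> m)) = - (c * (n \<bullet> y))"
        using nz by (simp add: c_def field_simps)
      finally show ?thesis by simp
    qed
    then show ?thesis by (simp add: matrix_eq)
  qed
  have Lx: "frame_covector L x = d *\<^sub>R axis 0 1"
    using nz by (simp only: frame_covector_def Lv xm) (simp add: c_def n_def)
  \<comment> \<open>\<open>D\<close> multiplies the time axis by \<open>d\<close> and the first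
    spatial axis by \<open>e\<close>; the latter does not affect the image of \<open>v\<close> and
    is free to make the total determinant positive.\<close>
  define e :: real where "e = (if det (P1 ** L) * d > 0 then 1 else - 1)"
  define D :: "real^6^6" where "D = (\<chi> i j. if i = j then (if i = 0 then d else if i = 1 then e else 1) else 0)"
  have e: "e * e = 1" by (simp add: e_def)
  have Dt: "transpose D = D" by (auto simp: D_def transpose_def vec_eq_iff)
  have Dv: "D *v y = (\<chi> i. (if i = 0 then d else if i = 1 then e else 1) * y $ i)" for y
    unfolding vec_eq_iff forall_6 by (simp add: D_def matrix_vector_mult_def sum_6)
  have "D *v (minkowski *v (D *v y)) = minkowski *v y" for y
    unfolding vec_eq_iff forall_6 using d e by (simp add: Dv minkowski_mult flip: mult.assoc)
  then have D: "frame_metric D minkowski = minkowski"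
    by (simp add: frame_metric_def matrix_eq Dt flip: matrix_vector_mul_assoc)
  have Dx: "frame_covector D (d *\<^sub>R axis 0 1) = axis 0 1"
    unfolding vec_eq_iff forall_6 using d by (simp add: frame_covector_def Dt Dv axis_def)
  have "det D = (\<Prod>i\<in>UNIV. D $ i $ i)"
    by (rule det_diagonal) (simp add: D_def)
  then have detD: "det D = d * e" by (simp add: prod_6 D_def)
  have compose: "frame_metric (A ** B) h = frame_metric B (frame_metric A h)"
    "frame_covector (A ** B) y = frame_covector B (frame_covector A y)" for A B h y
    by (simp_all add: frame_metric_def frame_covector_def matrix_transpose_mul matrix_mul_assoc
        matrix_vector_mul_assoc del: transpose_matrix_vector)
  have "det P1 \<noteq> 0" using QP det_mul [of Q P1] by auto
  moreover have "det L \<noteq> 0"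
    using arg_cong [OF L, of det] by (auto simp: frame_metric_def det_mul det_minkowski)
  ultimately have "det (P1 ** L) * d \<noteq> 0" using d by (auto simp: det_mul)
  then have "det (P1 ** L) * d * e > 0"
    unfolding e_def by (auto simp: not_less less_le)
  then have "det (P1 ** L ** D) > 0"
    by (simp add: det_mul [of _ D] detD mult.assoc)
  moreover have "frame_metric (P1 ** L ** D) g = minkowski"
    by (simp add: compose P1 L D)
  moreover have "frame_covector (P1 ** L ** D) v = axis 0 1"
    by (simp add: compose Lx Dx flip: x_def)
  ultimately show thesis by (rule that)
qed

section \<open>The rest frame\<close>

definition rank :: "6 \<Rightarrow> nat" where
  "rank i = (if i = 0 then 0 else if i = 1 then 1 else if i = 2 then 2 else if i = 3 then 3
    else if i = 4 then 4 else 5)"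

text \<open>The rank conditions turn the antisymmetry of \<open>eps\<close> into terminating rewrite rules.\<close>

lemma eps_sort:
  "rank a < rank b \<Longrightarrow> eps b a c d e f = - eps a b c d e f"
  "rank b < rank c \<Longrightarrow> eps a c b d e f = - eps a b c d e f"
  "rank c < rank d \<Longrightarrow> eps a b d c e f = - eps a b c d e f"
  "rank d < rank e \<Longrightarrow> eps a b c e d f = - eps a b c d e f"
  "rank e < rank f \<Longrightarrow> eps a b c d f e = - eps a b c d e f"
  by (rule eps_swap)+

lemma rank_simps: "rank 0 = 0" "rank 1 = 1" "rank 2 = 2" "rank 3 = 3" "rank 4 = 4" "rank 5 = 5"
  by (simp_all add: rank_def)

definition spatial :: "real^6^6 \<Rightarrow> bool" where
  "spatial X \<longleftrightarrow> antisym X \<and> (\<forall>j. X $ 0 $ j = 0)"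

lemma spatial_simps:
  assumes "spatial X"
  shows "X $ 0 $ j = 0" "X $ j $ 0 = 0" "X $ j $ j = 0"
    "X $ 2 $ 1 = - (X $ 1 $ 2)" "X $ 3 $ 1 = - (X $ 1 $ 3)" "X $ 4 $ 1 = - (X $ 1 $ 4)" "X $ 5 $ 1 = - (X $ 1 $ 5)" "X $ 3 $ 2 = - (X $ 2 $ 3)" "X $ 4 $ 2 = - (X $ 2 $ 4)" "X $ 5 $ 2 = - (X $ 2 $ 5)" "X $ 4 $ 3 = - (X $ 3 $ 4)" "X $ 5 $ 3 = - (X $ 3 $ 5)" "X $ 5 $ 4 = - (X $ 4 $ 5)"
proof -
  have X: "antisym X" "X $ 0 $ j = 0" for j using assms by (simp_all add: spatial_def)
  show "X $ 0 $ j = 0" "X $ j $ 0 = 0" "X $ j $ j = 0"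
    using antisymD [OF X(1), of 0 j] antisym_diag [OF X(1)] X(2) by simp_all
qed (rule antisymD, use assms in \<open>simp add: spatial_def\<close>)+

lemma epsc_rest:
  "epsc (tensor Y (axis 0 1)) $ i $ j $ k = (\<Sum>l\<in>UNIV. \<Sum>m\<in>UNIV. eps i j k l m 0 * Y $ l $ m)"
  by (simp add: epsc_def tensor_def sum_6 axis_def)

text \<open>The bracket at \<open>u $ m\<close> is, up to sign, the polarised Pfaffian of the 4 by 4
  minors of \<open>X\<close> and \<open>Y\<close> that omit the indices 0 and \<open>m\<close>; the
  factor 4 counts the two orders within each antisymmetric pair.\<close>

lemma omega_rest:
  assumes X: "spatial X" and Y: "spatial Y"
  shows "omega (tensor X u) (tensor Y (axis 0 1)) = 4 * (
      u $ 1 * (X $ 2 $ 3 * Y $ 4 $ 5 - X $ 2 $ 4 * Y $ 3 $ 5 + X $ 2 $ 5 * Y $ 3 $ 4 + X $ 3 $ 4 * Y $ 2 $ 5 - X $ 3 $ 5 * Y $ 2 $ 4 + X $ 4 $ 5 * Y $ 2 $ 3) 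
      - u $ 2 * (X $ 1 $ 3 * Y $ 4 $ 5 - X $ 1 $ 4 * Y $ 3 $ 5 + X $ 1 $ 5 * Y $ 3 $ 4 + X $ 3 $ 4 * Y $ 1 $ 5 - X $ 3 $ 5 * Y $ 1 $ 4 + X $ 4 $ 5 * Y $ 1 $ 3) 
      + u $ 3 * (X $ 1 $ 2 * Y $ 4 $ 5 - X $ 1 $ 4 * Y $ 2 $ 5 + X $ 1 $ 5 * Y $ 2 $ 4 + X $ 2 $ 4 * Y $ 1 $ 5 - X $ 2 $ 5 * Y $ 1 $ 4 + X $ 4 $ 5 * Y $ 1 $ 2) 
      - u $ 4 * (X $ 1 $ 2 * Y $ 3 $ 5 - X $ 1 $ 3 * Y $ 2 $ 5 + X $ 1 $ 5 * Y $ 2 $ 3 + X $ 2 $ 3 * Y $ 1 $ 5 - X $ 2 $ 5 * Y $ 1 $ 3 + X $ 3 $ 5 * Y $ 1 $ 2) 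
      + u $ 5 * (X $ 1 $ 2 * Y $ 3 $ 4 - X $ 1 $ 3 * Y $ 2 $ 4 + X $ 1 $ 4 * Y $ 2 $ 3 + X $ 2 $ 3 * Y $ 1 $ 4 - X $ 2 $ 4 * Y $ 1 $ 3 + X $ 3 $ 4 * Y $ 1 $ 2))" (is "_ = ?rhs")
proof -
  define T where "T = epsc (tensor Y (axis 0 1))"
  have T: "alternating T" unfolding T_def by (rule alternating_epsc)
  have base: "T $ 1 $ 2 $ 3 = 2 * Y $ 4 $ 5" "T $ 1 $ 2 $ 4 = - 2 * Y $ 3 $ 5" "T $ 1 $ 2 $ 5 = 2 * Y $ 3 $ 4"
    "T $ 1 $ 3 $ 4 = 2 * Y $ 2 $ 5" "T $ 1 $ 3 $ 5 = - 2 * Y $ 2 $ 4" "T $ 1 $ 4 $ 5 = 2 * Y $ 2 $ 3"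
    "T $ 2 $ 3 $ 4 = - 2 * Y $ 1 $ 5" "T $ 2 $ 3 $ 5 = 2 * Y $ 1 $ 4" "T $ 2 $ 4 $ 5 = - 2 * Y $ 1 $ 3"
    "T $ 3 $ 4 $ 5 = 2 * Y $ 1 $ 2"
    unfolding T_def epsc_rest
    by (simp_all add: sum_6 spatial_simps [OF Y] eps_sort rank_simps eps_012345)
  have T0: "T $ i $ j $ 0 = 0" for i j
    by (simp add: T_def epsc_rest)
  have sort: "rank a < rank b \<Longrightarrow> T $ b $ a $ c = - T $ a $ b $ c"
    "rank b < rank c \<Longrightarrow> T $ a $ c $ b = - T $ a $ b $ c" for a b c
    by (rule alternatingD [OF T])+
  have "omega (tensor X u) (tensor Y (axis 0 1)) =
      (\<Sum>i\<in>UNIV. \<Sum>j\<in>UNIV. \<Sum>k\<in>UNIV. X $ i $ j * u $ k * T $ i $ j $ k)"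
    by (simp add: omega_def inner_triple T_def tensor_def)
  also have "\<dots> = ?rhs"
    unfolding sum_6
    by (simp only: spatial_simps [OF X] alternating_repeated [OF T] T0 sort rank_simps base
        mult_zero_left mult_zero_right add_0_left add_0_right less_numeral_simps
        rel_simps zero_less_one one_less_numeral_iff simp_thms)
      algebra
  finally show ?thesis .
qed

lemma sum_minkowski: "(\<Sum>k\<in>UNIV. minkowski $ i $ k * f k) = (if i = 0 then - f i else f i)"
  using arg_cong [OF minkowski_mult [of "\<chi> k. f k"], of "\<lambda>x. x $ i"]
  by (simp add: matrix_vector_mult_def)

text \<open>Raising an index changes only the sign of time components, and these are zero.\<close>

lemma raise2_rest:
  assumes "spatial X"
  shows "raise2 minkowski X = X"
proof -
  have m: "minkowski $ l $ j = minkowski $ j $ l" for j l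
    by (simp add: minkowski_def)
  have "raise2 minkowski X $ i $ j = (\<Sum>l\<in>UNIV. minkowski $ j $ l * (\<Sum>k\<in>UNIV. minkowski $ i $ k * X $ k $ l))" for i j
    by (simp add: raise2_def matrix_inv_minkowski transpose_minkowski matrix_entry m [of _ j] mult.commute)
  then show ?thesis
    by (simp add: vec_eq_iff sum_minkowski spatial_simps [OF assms])
qed

lemma ip_rest:
  assumes X: "spatial X" and Y: "spatial Y"
  shows "ip minkowski X Y = 2 * (X $ 1 $ 2 * Y $ 1 $ 2 + X $ 1 $ 3 * Y $ 1 $ 3 + X $ 1 $ 4 * Y $ 1 $ 4 + X $ 1 $ 5 * Y $ 1 $ 5 + X $ 2 $ 3 * Y $ 2 $ 3 + X $ 2 $ 4 * Y $ 2 $ 4 + X $ 2 $ 5 * Y $ 2 $ 5 + X $ 3 $ 4 * Y $ 3 $ 4 + X $ 3 $ 5 * Y $ 3 $ 5 + X $ 4 $ 5 * Y $ 4 $ 5)"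
  unfolding ip_sum raise2_rest [OF Y]
  by (simp add: sum_6 spatial_simps [OF X] spatial_simps [OF Y])

lemma cube_rest:
  assumes X: "spatial X"
  shows "cube minkowski X $ i $ j = (\<Sum>k\<in>UNIV. \<Sum>l\<in>UNIV. X $ i $ l * X $ l $ k * X $ k $ j)"
  by (simp add: cube_def raise2_rest [OF X] matrix_entry sum_distrib_right)

lemma antisym_cube:
  assumes g: "transpose g = g" "invertible g" and X: "antisym X"
  shows "antisym (cube g X)"
  using X unfolding antisym_def cube_def
  by (simp add: raise2_def matrix_transpose_mul g transpose_matrix_inv matrix_mul_assoc)
    (simp add: vec_eq_iff matrix_entry sum_negf)

lemma spatial_cube:
  assumes X: "spatial X"
  shows "spatial (cube minkowski X)"
  using X antisym_cube [OF transpose_minkowski lorentzian_invertible [OF lorentzian_minkowski]]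
  by (auto simp: spatial_def cube_rest)

text \<open>
  If \<open>\<plusminus>\<lambda>\<^sub>1, \<plusminus>\<lambda>\<^sub>2, 0\<close> are the skew eigenvalues of \<open>B\<close>, then \<open>s = (\<lambda>\<^sub>1\<^sup>2 + \<lambda>\<^sub>2\<^sup>2) / 2\<close>, the quadratic form is
  proportional to \<open>\<lambda>\<^sub>1 \<lambda>\<^sub>2\<close>, and \<open>2 s\<^sup>2 + D = (\<lambda>\<^sub>1 \<lambda>\<^sub>2)\<^sup>2\<close>. The proof avoids the normal form: these are
  polynomial identities in the ten entries of \<open>B\<close>.
\<close>

lemma rest_frame_identities:
  assumes B: "spatial B"
  defines "C \<equiv> cube minkowski B"
  defines "s \<equiv> ip minkowski B B / 4" and "D \<equiv> ip minkowski C B / 4"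
  shows "omega (tensor B u) (tensor C (axis 0 1)) = - s * omega (tensor B u) (tensor B (axis 0 1))" (is ?a)
    and "omega (tensor C u) (tensor C (axis 0 1)) =
      (2 * s * s + D) * omega (tensor B u) (tensor B (axis 0 1))" (is ?b)
    and "(\<Sum>m\<in>UNIV - {0}. (omega (tensor B (axis m 1)) (tensor B (axis 0 1)))\<^sup>2) = 64 * (2 * s * s + D)" (is ?c)
proof -
  note S = spatial_simps [OF B]
  have C: "spatial C" unfolding C_def by (rule spatial_cube [OF B])
  define S where "S = B $ 1 $ 2 * B $ 1 $ 2 + B $ 1 $ 3 * B $ 1 $ 3 + B $ 1 $ 4 * B $ 1 $ 4 + B $ 1 $ 5 * B $ 1 $ 5 + B $ 2 $ 3 * B $ 2 $ 3 + B $ 2 $ 4 * B $ 2 $ 4 + B $ 2 $ 5 * B $ 2 $ 5 + B $ 3 $ 4 * B $ 3 $ 4 + B $ 3 $ 5 * B $ 3 $ 5 + B $ 4 $ 5 * B $ 4 $ 5"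
  define T where "T = C $ 1 $ 2 * B $ 1 $ 2 + C $ 1 $ 3 * B $ 1 $ 3 + C $ 1 $ 4 * B $ 1 $ 4 + C $ 1 $ 5 * B $ 1 $ 5 + C $ 2 $ 3 * B $ 2 $ 3 + C $ 2 $ 4 * B $ 2 $ 4 + C $ 2 $ 5 * B $ 2 $ 5 + C $ 3 $ 4 * B $ 3 $ 4 + C $ 3 $ 5 * B $ 3 $ 5 + C $ 4 $ 5 * B $ 4 $ 5"
  have s: "s = S / 2" and D: "D = T / 2"
    by (simp_all add: s_def D_def S_def T_def ip_rest [OF B B] ip_rest [OF C B])
  have c: "C $ 1 $ 2 = (\<Sum>k\<in>UNIV. \<Sum>l\<in>UNIV. B $ 1 $ l * B $ l $ k * B $ k $ 2)"
    "C $ 1 $ 3 = (\<Sum>k\<in>UNIV. \<Sum>l\<in>UNIV. B $ 1 $ l * B $ l $ k * B $ k $ 3)"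
    "C $ 1 $ 4 = (\<Sum>k\<in>UNIV. \<Sum>l\<in>UNIV. B $ 1 $ l * B $ l $ k * B $ k $ 4)"
    "C $ 1 $ 5 = (\<Sum>k\<in>UNIV. \<Sum>l\<in>UNIV. B $ 1 $ l * B $ l $ k * B $ k $ 5)"
    "C $ 2 $ 3 = (\<Sum>k\<in>UNIV. \<Sum>l\<in>UNIV. B $ 2 $ l * B $ l $ k * B $ k $ 3)"
    "C $ 2 $ 4 = (\<Sum>k\<in>UNIV. \<Sum>l\<in>UNIV. B $ 2 $ l * B $ l $ k * B $ k $ 4)"
    "C $ 2 $ 5 = (\<Sum>k\<in>UNIV. \<Sum>l\<in>UNIV. B $ 2 $ l * B $ l $ k * B $ k $ 5)"
    "C $ 3 $ 4 = (\<Sum>k\<in>UNIV. \<Sum>l\<in>UNIV. B $ 3 $ l * B $ l $ k * B $ k $ 4)"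
    "C $ 3 $ 5 = (\<Sum>k\<in>UNIV. \<Sum>l\<in>UNIV. B $ 3 $ l * B $ l $ k * B $ k $ 5)"
    "C $ 4 $ 5 = (\<Sum>k\<in>UNIV. \<Sum>l\<in>UNIV. B $ 4 $ l * B $ l $ k * B $ k $ 5)"
    by (simp_all only: C_def cube_rest [OF B])
  note c' = c [simplified sum_6 S mult_zero_left mult_zero_right add_0_left add_0_right]
  \<comment> \<open>One identity for each of the five Pfaffian components, with the entries of
    \<open>C\<close> inserted as cubic polynomials in those of \<open>B\<close>.\<close>
  have a: "2 * (B $ 2 $ 3 * C $ 4 $ 5 - B $ 2 $ 4 * C $ 3 $ 5 + B $ 2 $ 5 * C $ 3 $ 4 + B $ 3 $ 4 * C $ 2 $ 5 - B $ 3 $ 5 * C $ 2 $ 4 + B $ 4 $ 5 * C $ 2 $ 3) =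
      - S * (B $ 2 $ 3 * B $ 4 $ 5 - B $ 2 $ 4 * B $ 3 $ 5 + B $ 2 $ 5 * B $ 3 $ 4 + B $ 3 $ 4 * B $ 2 $ 5 - B $ 3 $ 5 * B $ 2 $ 4 + B $ 4 $ 5 * B $ 2 $ 3)"
    "2 * (B $ 1 $ 3 * C $ 4 $ 5 - B $ 1 $ 4 * C $ 3 $ 5 + B $ 1 $ 5 * C $ 3 $ 4 + B $ 3 $ 4 * C $ 1 $ 5 - B $ 3 $ 5 * C $ 1 $ 4 + B $ 4 $ 5 * C $ 1 $ 3) =
      - S * (B $ 1 $ 3 * B $ 4 $ 5 - B $ 1 $ 4 * B $ 3 $ 5 + B $ 1 $ 5 * B $ 3 $ 4 + B $ 3 $ 4 * B $ 1 $ 5 - B $ 3 $ 5 * B $ 1 $ 4 + B $ 4 $ 5 * B $ 1 $ 3)"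
    "2 * (B $ 1 $ 2 * C $ 4 $ 5 - B $ 1 $ 4 * C $ 2 $ 5 + B $ 1 $ 5 * C $ 2 $ 4 + B $ 2 $ 4 * C $ 1 $ 5 - B $ 2 $ 5 * C $ 1 $ 4 + B $ 4 $ 5 * C $ 1 $ 2) =
      - S * (B $ 1 $ 2 * B $ 4 $ 5 - B $ 1 $ 4 * B $ 2 $ 5 + B $ 1 $ 5 * B $ 2 $ 4 + B $ 2 $ 4 * B $ 1 $ 5 - B $ 2 $ 5 * B $ 1 $ 4 + B $ 4 $ 5 * B $ 1 $ 2)"
    "2 * (B $ 1 $ 2 * C $ 3 $ 5 - B $ 1 $ 3 * C $ 2 $ 5 + B $ 1 $ 5 * C $ 2 $ 3 + B $ 2 $ 3 * C $ 1 $ 5 - B $ 2 $ 5 * C $ 1 $ 3 + B $ 3 $ 5 * C $ 1 $ 2) =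
      - S * (B $ 1 $ 2 * B $ 3 $ 5 - B $ 1 $ 3 * B $ 2 $ 5 + B $ 1 $ 5 * B $ 2 $ 3 + B $ 2 $ 3 * B $ 1 $ 5 - B $ 2 $ 5 * B $ 1 $ 3 + B $ 3 $ 5 * B $ 1 $ 2)"
    "2 * (B $ 1 $ 2 * C $ 3 $ 4 - B $ 1 $ 3 * C $ 2 $ 4 + B $ 1 $ 4 * C $ 2 $ 3 + B $ 2 $ 3 * C $ 1 $ 4 - B $ 2 $ 4 * C $ 1 $ 3 + B $ 3 $ 4 * C $ 1 $ 2) =
      - S * (B $ 1 $ 2 * B $ 3 $ 4 - B $ 1 $ 3 * B $ 2 $ 4 + B $ 1 $ 4 * B $ 2 $ 3 + B $ 2 $ 3 * B $ 1 $ 4 - B $ 2 $ 4 * B $ 1 $ 3 + B $ 3 $ 4 * B $ 1 $ 2)"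
    unfolding S_def c' by algebra+
  show ?a
    unfolding omega_rest [OF B C] omega_rest [OF B B] s using a by algebra
  have b: "2 * (C $ 2 $ 3 * C $ 4 $ 5 - C $ 2 $ 4 * C $ 3 $ 5 + C $ 2 $ 5 * C $ 3 $ 4 + C $ 3 $ 4 * C $ 2 $ 5 - C $ 3 $ 5 * C $ 2 $ 4 + C $ 4 $ 5 * C $ 2 $ 3) =
      (S * S + T) * (B $ 2 $ 3 * B $ 4 $ 5 - B $ 2 $ 4 * B $ 3 $ 5 + B $ 2 $ 5 * B $ 3 $ 4 + B $ 3 $ 4 * B $ 2 $ 5 - B $ 3 $ 5 * B $ 2 $ 4 + B $ 4 $ 5 * B $ 2 $ 3)"
    "2 * (C $ 1 $ 3 * C $ 4 $ 5 - C $ 1 $ 4 * C $ 3 $ 5 + C $ 1 $ 5 * C $ 3 $ 4 + C $ 3 $ 4 * C $ 1 $ 5 - C $ 3 $ 5 * C $ 1 $ 4 + C $ 4 $ 5 * C $ 1 $ 3) =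
      (S * S + T) * (B $ 1 $ 3 * B $ 4 $ 5 - B $ 1 $ 4 * B $ 3 $ 5 + B $ 1 $ 5 * B $ 3 $ 4 + B $ 3 $ 4 * B $ 1 $ 5 - B $ 3 $ 5 * B $ 1 $ 4 + B $ 4 $ 5 * B $ 1 $ 3)"
    "2 * (C $ 1 $ 2 * C $ 4 $ 5 - C $ 1 $ 4 * C $ 2 $ 5 + C $ 1 $ 5 * C $ 2 $ 4 + C $ 2 $ 4 * C $ 1 $ 5 - C $ 2 $ 5 * C $ 1 $ 4 + C $ 4 $ 5 * C $ 1 $ 2) =
      (S * S + T) * (B $ 1 $ 2 * B $ 4 $ 5 - B $ 1 $ 4 * B $ 2 $ 5 + B $ 1 $ 5 * B $ 2 $ 4 + B $ 2 $ 4 * B $ 1 $ 5 - B $ 2 $ 5 * B $ 1 $ 4 + B $ 4 $ 5 * B $ 1 $ 2)"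
    "2 * (C $ 1 $ 2 * C $ 3 $ 5 - C $ 1 $ 3 * C $ 2 $ 5 + C $ 1 $ 5 * C $ 2 $ 3 + C $ 2 $ 3 * C $ 1 $ 5 - C $ 2 $ 5 * C $ 1 $ 3 + C $ 3 $ 5 * C $ 1 $ 2) =
      (S * S + T) * (B $ 1 $ 2 * B $ 3 $ 5 - B $ 1 $ 3 * B $ 2 $ 5 + B $ 1 $ 5 * B $ 2 $ 3 + B $ 2 $ 3 * B $ 1 $ 5 - B $ 2 $ 5 * B $ 1 $ 3 + B $ 3 $ 5 * B $ 1 $ 2)"
    "2 * (C $ 1 $ 2 * C $ 3 $ 4 - C $ 1 $ 3 * C $ 2 $ 4 + C $ 1 $ 4 * C $ 2 $ 3 + C $ 2 $ 3 * C $ 1 $ 4 - C $ 2 $ 4 * C $ 1 $ 3 + C $ 3 $ 4 * C $ 1 $ 2) =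
      (S * S + T) * (B $ 1 $ 2 * B $ 3 $ 4 - B $ 1 $ 3 * B $ 2 $ 4 + B $ 1 $ 4 * B $ 2 $ 3 + B $ 2 $ 3 * B $ 1 $ 4 - B $ 2 $ 4 * B $ 1 $ 3 + B $ 3 $ 4 * B $ 1 $ 2)"
    unfolding S_def T_def c' by algebra+
  have sD: "2 * s * s + D = (S * S + T) / 2" by (simp add: s D)
  show ?b
    unfolding omega_rest [OF C C] omega_rest [OF B B] sD using b by algebra
  \<comment> \<open>Each bracket is twice a Pfaffian, so \<open>2 * s * s + D\<close> is the sum of
    the five squared Pfaffians, the squared length of \<open>p_vec\<close> in the rest
    frame.\<close>
  have Q: "2 * (S * S + T) = (B $ 2 $ 3 * B $ 4 $ 5 - B $ 2 $ 4 * B $ 3 $ 5 + B $ 2 $ 5 * B $ 3 $ 4 + B $ 3 $ 4 * B $ 2 $ 5 - B $ 3 $ 5 * B $ 2 $ 4 + B $ 4 $ 5 * B $ 2 $ 3)\<^sup>2 + (B $ 1 $ 3 * B $ 4 $ 5 - B $ 1 $ 4 * B $ 3 $ 5 + B $ 1 $ 5 * B $ 3 $ 4 + B $ 3 $ 4 * B $ 1 $ 5 - B $ 3 $ 5 * B $ 1 $ 4 + B $ 4 $ 5 * B $ 1 $ 3)\<^sup>2 + (B $ 1 $ 2 * B $ 4 $ 5 - B $ 1 $ 4 * B $ 2 $ 5 + B $ 1 $ 5 * B $ 2 $ 4 + B $ 2 $ 4 * B $ 1 $ 5 - B $ 2 $ 5 * B $ 1 $ 4 + B $ 4 $ 5 *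 B $ 1 $ 2)\<^sup>2 + (B $ 1 $ 2 * B $ 3 $ 5 - B $ 1 $ 3 * B $ 2 $ 5 + B $ 1 $ 5 * B $ 2 $ 3 + B $ 2 $ 3 * B $ 1 $ 5 - B $ 2 $ 5 * B $ 1 $ 3 + B $ 3 $ 5 * B $ 1 $ 2)\<^sup>2 + (B $ 1 $ 2 * B $ 3 $ 4 - B $ 1 $ 3 * B $ 2 $ 4 + B $ 1 $ 4 * B $ 2 $ 3 + B $ 2 $ 3 * B $ 1 $ 4 - B $ 2 $ 4 * B $ 1 $ 3 + B $ 3 $ 4 * B $ 1 $ 2)\<^sup>2"
    unfolding S_def T_def c' by algebra
  have U: "(UNIV :: 6 set) - {0} = {1, 2, 3, 4, 5}"
    unfolding UNIV_6 by auto
  have sD64: "64 * (2 * s * s + D) = 16 * (2 * (S * S + T))" by (simp add: sD)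
  show ?c
    unfolding omega_rest [OF B B] sD64 U Q by (simp add: axis_def) algebra
qed

section \<open>Algebraic identities for unit timelike vectors\<close>

lemma linear_contr: "linear (\<lambda>F. contr F u)" "linear (contr F)"
  by (rule linearI; simp add: contr_def vec_eq_iff sum.distrib sum_distrib_left algebra_simps)+

lemma linear_tensor: "linear (\<lambda>X. tensor X u)" "linear (tensor X)"
  by (rule linearI; simp add: tensor_def vec_eq_iff algebra_simps)+

lemma linear_raise1: "linear (raise1 g)"
  unfolding raise1_def by (rule matrix_vector_mul_linear)

lemma linear_raise2: "linear (raise2 g)"
  by (rule linearI)
    (simp_all add: raise2_def vec_eq_iff matrix_entry sum.distrib sum_distrib_left sum_distrib_right algebra_simps)

lemma linear_dual: "linear (dual g)"
  unfolding dual_eq using linear_compose_scale_right [OF linear_epsc] by blast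

lemma linear_ldual: "linear (ldual g)"
  using linear_compose [OF linear_dual linear_frame_three_form] by (simp add: ldual_def [abs_def] o_def)

lemma bilinear_electric: "bilinear (electric g)"
  unfolding bilinear_def electric_eq
  using linear_contr(1) linear_compose [OF linear_raise1 linear_contr(2)] by (auto simp: o_def)

lemma bilinear_magnetic:
  assumes "lorentzian g"
  shows "bilinear (magnetic g)"
proof -
  have "magnetic g = (\<lambda>F. electric g (ldual g F))"
    by (intro ext) (simp add: magnetic_eq_electric lorentzian_transpose lorentzian_invertible assms)
  then show ?thesis
    using bilinear_electric [of g] linear_compose [OF linear_ldual, of "\<lambda>F. electric g F v" g for v]
    by (simp add: bilinear_def o_def)
qed

lemma bilinear_ip: "bilinear (ip g)"
  unfolding bilinear_def ip_def
  by (auto intro!: linearI simp: inner_simps linear_add [OF linear_raise2] linear_scale [OF linear_raise2])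

lemma bilinear_matrix_mult: "bilinear ((**) :: real^6^6 \<Rightarrow> real^6^6 \<Rightarrow> real^6^6)"
  unfolding bilinear_def
  by (auto intro!: linearI
      simp: vec_eq_iff matrix_entry sum.distrib sum_distrib_left algebra_simps)

lemma ip_commute:
  assumes "transpose g = g" "invertible g"
  shows "ip g X Y = ip g Y X"
proof -
  have "X \<bullet> (transpose (matrix_inv g) ** Y ** matrix_inv g) = (matrix_inv g ** X ** transpose (matrix_inv g)) \<bullet> Y"
    using inner_congruence [of "transpose (matrix_inv g)" X Y] by simp
  then show ?thesis
    by (simp add: ip_def raise2_def transpose_matrix_inv assms inner_commute)
qed

lemma omega_self: "omega S S = 0"
  using omega_commute [of S S] by simp

locale unit_timelike =
  fixes g :: "real^6^6" and F :: "real^6^6^6" and v :: "real^6"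
  assumes g: "lorentzian g" and F: "alternating F" and v: "v \<bullet> raise1 g v = - 1"
begin

abbreviation "E \<equiv> electric g F v"
abbreviation "B \<equiv> magnetic g F v"
abbreviation "s \<equiv> s_inv g F v"
abbreviation "p \<equiv> p_inv g F v"
abbreviation "C \<equiv> cube g B"

lemma sym: "transpose g = g" "invertible g" "det g < 0"
  using lorentzian_transpose lorentzian_invertible lorentzian_det g by blast+

lemma transverse_E: "antisym E" "E *v raise1 g v = 0"
  by (simp_all add: electric_eq antisym_contr contr_contr F)

lemma transverse_B: "antisym B" "B *v raise1 g v = 0"
  by (simp_all add: magnetic_eq_electric sym electric_eq antisym_contr contr_contr alternating_ldual)

lemma transverse_C: "antisym C" "C *v raise1 g v = 0"
proof -
  show "antisym C" by (rule antisym_cube [OF sym(1,2) transverse_B(1)])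
  have "C *v raise1 g v = B ** raise2 g B *v (B *v raise1 g v)"
    by (simp only: cube_def matrix_vector_mul_assoc)
  then show "C *v raise1 g v = 0" by (simp add: transverse_B)
qed

lemma antisym_combination:
  assumes "antisym X" "antisym Y"
  shows "antisym (a *\<^sub>R X + b *\<^sub>R Y)"
proof (rule antisymI)
  fix i j
  show "(a *\<^sub>R X + b *\<^sub>R Y) $ j $ i = - ((a *\<^sub>R X + b *\<^sub>R Y) $ i $ j)"
    using antisymD [OF assms(1), of j i] antisymD [OF assms(2), of j i] by simp
qed

lemma transverse_constitutive:
  "antisym (constitutive H g B s p)" "constitutive H g B s p *v raise1 g v = 0"
  unfolding constitutive_def
  by (rule antisym_combination [OF transverse_B(1) transverse_C(1)])
    (simp add: matrix_vector_mult_add_rdistrib transverse_B transverse_C flip: scaleR_matrix_vector_assoc)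

text \<open>All terms are invariant or scale with \<open>det P\<close> under a change of frame, so
  the identities of the rest frame carry over after cancelling the positive determinant.\<close>

lemma
  shows omega_B_C: "omega (tensor B u) (tensor C v) = - s * omega (tensor B u) (tensor B v)"
    and omega_C_C: "omega (tensor C u) (tensor C v) =
      (2 * s * s + ip g C B / 4) * omega (tensor B u) (tensor B v)"
    and p_vec_sq: "p_vec g F v \<bullet> (g *v p_vec g F v) = 2 * s * s + ip g C B / 4"
proof -
  obtain P where P: "det P > 0" "frame_metric P g = minkowski" "frame_covector P v = axis 0 1"
    using exists_rest_frame [OF g v] .
  define F' where "F' = frame_three_form P F"
  define B' where "B' = congr P B"
  define u' where "u' = frame_covector P u"
  note cov = g P(1)
  have B': "magnetic minkowski F' (axis 0 1) = B'"
    using magnetic_frame [OF cov, of F v] by (simp add: P F'_def B'_def)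
  have F': "alternating F'" unfolding F'_def by (rule alternating_frame [OF F])
  have mink: "transpose minkowski = minkowski" "invertible minkowski"
    using lorentzian_transpose lorentzian_invertible lorentzian_minkowski by blast+
  have "raise1 minkowski (axis 0 1) = - axis 0 1"
    by (simp add: raise1_def matrix_inv_minkowski minkowski_mult axis_def vec_eq_iff)
  moreover have "antisym B'" "B' *v raise1 minkowski (axis 0 1) = 0"
    unfolding B' [symmetric]
    by (simp_all add: magnetic_eq_electric mink electric_eq antisym_contr contr_contr alternating_ldual)
  ultimately have aB: "antisym B'" and "- (B' *v axis 0 1) = 0"
    using linear_neg [OF matrix_vector_mul_linear [of B'], of "axis 0 1"] by metis+
  then have "column 0 B' = 0"
    by (simp add: matrix_vector_mult_basis)
  then have col: "B' $ j $ 0 = 0" for j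
    by (simp add: column_def vec_eq_iff)
  have sB': "spatial B'"
    unfolding spatial_def
  proof (intro conjI allI aB)
    show "B' $ 0 $ j = 0" for j
      using antisymD [OF aB, of 0 j] col [of j] by linarith
  qed
  have C': "cube minkowski B' = congr P C"
    using cube_frame [OF cov, of B] by (simp add: P B'_def)
  have s': "ip minkowski B' B' / 4 = s"
    using ip_frame [OF cov, of B B] by (simp add: P B'_def s_inv_eq)
  have D': "ip minkowski (cube minkowski B') B' = ip g C B"
    unfolding C' unfolding B'_def using ip_frame [OF cov, of C B] by (simp add: P)
  have om: "det P * omega (tensor X u) (tensor Y v) = omega (tensor (congr P X) u') (tensor (congr P Y) (axis 0 1))"
    for X Y using omega_tensor_frame [OF cov, of X u Y v] by (simp add: P u'_def)
  note id = rest_frame_identities [OF sB', unfolded s' D', unfolded C']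
  have "det P * omega (tensor B u) (tensor C v) = det P * (- s * omega (tensor B u) (tensor B v))"
    using id(1) [of u'] om [of B B] om [of B C] by (simp add: B'_def [symmetric])
  then show "omega (tensor B u) (tensor C v) = - s * omega (tensor B u) (tensor B v)"
    using P(1) by (subst (asm) mult_cancel_left) simp
  have "det P * omega (tensor C u) (tensor C v) = det P * ((2 * s * s + ip g C B / 4) * omega (tensor B u) (tensor B v))"
    using id(2) [of u'] om [of B B] om [of C C] by (simp add: B'_def [symmetric])
  then show "omega (tensor C u) (tensor C v) =
      (2 * s * s + ip g C B / 4) * omega (tensor B u) (tensor B v)" using P(1) by simp
  define q where "q = p_vec minkowski F' (axis 0 1)"
  have q: "q $ m = - omega (tensor B' (axis m 1)) (tensor B' (axis 0 1)) / 8" for m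
    using inner_p_vec [of "axis m 1" minkowski F' "axis 0 1"]
    by (simp add: q_def B' inner_axis' det_minkowski)
  \<comment> \<open>In the rest frame \<open>p_vec\<close> is purely spatial, so its Minkowski
    square is the Euclidean sum over the other five components.\<close>
  have q0: "q $ 0 = 0" by (simp add: q omega_self)
  have "p_vec g F v \<bullet> (g *v p_vec g F v) = q \<bullet> (minkowski *v q)"
    using inner_frame_metric [OF cov, of q q] p_vec_frame [OF cov, of F v] by (simp add: P q_def F'_def)
  also have "\<dots> = (\<Sum>m\<in>UNIV - {0}. (q $ m)\<^sup>2)"
    by (simp add: inner_vec_def minkowski_mult sum.remove [of UNIV 0] q0 power2_eq_square)
  also have "\<dots> = (\<Sum>m\<in>UNIV - {0}. (omega (tensor B' (axis m 1)) (tensor B' (axis 0 1)))\<^sup>2) / 64"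
    by (simp add: q power2_eq_square sum_divide_distrib)
  also have "\<dots> = 2 * s * s + ip g C B / 4"
    using id(3) by simp
  finally show "p_vec g F v \<bullet> (g *v p_vec g F v) = 2 * s * s + ip g C B / 4" .
qed

lemma p_inv_eq: "p = sqrt (2 * s * s + ip g C B / 4)"
  by (simp add: p_inv_def p_vec_sq)

text \<open>Eliminates the quartic trace invariant of \<open>B\<close> in favour of \<open>s\<close>
  and \<open>p\<close>.\<close>

lemma ip_C_B: "p > 0 \<Longrightarrow> ip g C B = 4 * (p * p - 2 * s * s)"
  by (simp add: p_inv_eq)

text \<open>Writing \<open>Q = a B + b C\<close>, the quadratic form is multiplied by
  \<open>a * a - 2 * s * a * b + b * b * p * p\<close>. With \<open>a = H_s + 2 * s * b\<close> and
  \<open>b * p = H_p\<close> this is the left-hand side of the gauge-invariance condition.\<close>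

lemma omega_constitutive:
  assumes p: "p > 0"
    and pst: "(H_s H s p)\<^sup>2 + 2 * s / p * H_s H s p * H_p H s p + (H_p H s p)\<^sup>2 = 1"
  defines "Q \<equiv> constitutive H g B s p"
  shows "omega (tensor Q u) (tensor Q v) = omega (tensor B u) (tensor B v)"
proof -
  define a b w where "a = H_s H s p + 2 * s / p * H_p H s p" and "b = H_p H s p / p"
    and "w = omega (tensor B u) (tensor B v)"
  have Q: "Q = a *\<^sub>R B + b *\<^sub>R C"
    by (simp add: Q_def constitutive_def a_def b_def)
  have CB: "omega (tensor C u) (tensor B v) = - s * w"
    using omega_B_C [of u] omega_tensor_commute [of C u B v] by (simp add: w_def)
  have CC: "omega (tensor C u) (tensor C v) = p * p * w"
  proof -
    have "2 * s * s + ip g C B / 4 = p * p" using ip_C_B [OF p] by (simp add: field_simps)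
    then show ?thesis using omega_C_C [of u] by (simp only: w_def)
  qed
  have "omega (tensor Q u) (tensor Q v) = a * a * w + 2 * (a * b * (- s * w)) + b * b * (p * p * w)"
    using omega_B_C [of u] CC CB
    by (simp add: Q linear_add [OF linear_tensor(1)] linear_scale [OF linear_tensor(1)]
        bilinear_ladd [OF bilinear_omega] bilinear_radd [OF bilinear_omega]
        bilinear_lmul [OF bilinear_omega] bilinear_rmul [OF bilinear_omega] w_def algebra_simps)
  also have "\<dots> = (a * a - 2 * s * a * b + b * b * (p * p)) * w" by (simp add: algebra_simps)
  also have "a * a - 2 * s * a * b + b * b * (p * p) = 1"
  proof -
    have bp: "b * p = H_p H s p" and "a = H_s H s p + 2 * s * b"
      using p by (simp_all add: a_def b_def)
    moreover have "b * b * (p * p) = (H_p H s p)\<^sup>2"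
      by (simp add: power2_eq_square flip: bp)
    moreover have "2 * s / p * H_s H s p * H_p H s p = 2 * s * H_s H s p * b"
      by (simp add: b_def)
    ultimately show ?thesis using pst by (simp add: power2_eq_square algebra_simps)
  qed
  finally show ?thesis by (simp add: w_def)
qed

text \<open>The contributions \<open>8 * s * s * H_p / p\<close> of the two summands of
  \<open>constitutive\<close> cancel after inserting \<open>ip_C_B\<close>.\<close>

lemma ip_constitutive:
  assumes "p > 0"
  shows "ip g (constitutive H g B s p) B = 4 * (s * H_s H s p + p * H_p H s p)"
proof -
  have "ip g B B = 4 * s" by (simp add: s_inv_eq)
  then show ?thesis
    using assms by (simp add: constitutive_def bilinear_ladd [OF bilinear_ip] bilinear_lmul [OF bilinear_ip]
        ip_C_B field_simps)
qed

lemma pst_lagrangian_eq: "pst_lagrangian H g F v = ip g E B / 4 - H s p"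
  by (simp only: pst_lagrangian_def ip_commute [OF sym(1,2), of E B]) (simp add: ip_sum mult.commute)

lemma pst_lagrangian_on_shell:
  assumes "p > 0" "self_dual H g F v"
  shows "pst_lagrangian H g F v = onshell_lagrangian H g F v"
proof -
  have "E = constitutive H g B s p"
    using assms(2) by (simp add: self_dual_def H_tensor_eq)
  then show ?thesis
    using ip_constitutive [OF assms(1), of H]
    by (simp add: pst_lagrangian_eq onshell_lagrangian_def Let_def)
qed

end

section \<open>Variation of the Lagrangian\<close>

text \<open>Both sides are minus the trace of a product of the four matrices interleaved with the
  inverse metric, and the trace is cyclic.\<close>

lemma quartic_cycle:
  assumes g: "transpose g = g" "invertible g"
    and "antisym X" "antisym Y" "antisym Z" "antisym W"
  shows "ip g (X ** raise2 g Y ** Z) W = ip g (W ** raise2 g X ** Y) Z"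
proof -
  define R where "R = matrix_inv g"
  have R: "transpose R = R" by (simp add: R_def transpose_matrix_inv g)
  have tr: "A \<bullet> B = trace (transpose A ** B)" for A B :: "real^6^6"
    by (simp add: inner_vec_def trace_def matrix_entry transpose_def) (rule sum.swap)
  have neg: "(- A) ** B = - (A ** B)" "A ** (- B) = - (A ** B)" for A B :: "real^6^6"
    by (simp_all add: vec_eq_iff matrix_entry sum_negf)
  have *: "ip g (X ** raise2 g Y ** Z) W = - trace (Z ** R ** Y ** R ** X ** R ** W ** R)"
    if "antisym X" "antisym Y" "antisym Z" "antisym W" for X Y Z W
    using that unfolding antisym_def
    by (simp add: ip_def raise2_def tr matrix_transpose_mul R matrix_mul_assoc neg flip: R_def)
      (simp add: trace_def sum_negf)
  have "trace ((Z ** R) ** (Y ** R ** X ** R ** W ** R)) = trace ((Y ** R ** X ** R ** W ** R) ** (Z ** R))"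
    by (rule trace_mul_sym)
  then show ?thesis
    using assms by (simp add: * matrix_mul_assoc)
qed

text \<open>\<open>H_s\<close> and \<open>H_p\<close> are defined as one-variable derivatives; joint
  differentiability is what makes the chain rule along curves in the \<open>(s, p)\<close> plane
  available.\<close>

lemma
  assumes D: "(\<lambda>(s, p). H s p) differentiable (at (s, p))"
  shows H_has_derivative: "((\<lambda>(s, p). H s p) has_derivative (\<lambda>(x, y). H_s H s p * x + H_p H s p * y)) (at (s, p))"
proof -
  obtain L where L: "((\<lambda>(s, p). H s p) has_derivative L) (at (s, p))"
    using D by (auto simp: differentiable_def)
  then interpret L: linear L by (rule has_derivative_linear)
  have "((\<lambda>t. (t, p)) has_derivative (\<lambda>x. (x, 0))) (at s)"
    by (auto intro!: derivative_eq_intros)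
  from diff_chain_at [OF this, of "\<lambda>(s, p). H s p" L] L
  have "((\<lambda>t. H t p) has_derivative (\<lambda>x. L (x, 0))) (at s)" by (simp add: o_def)
  moreover have "(\<lambda>x. L (x, 0)) = (*) (L (1, 0))"
  proof
    show "L (x, 0) = L (1, 0) * x" for x
      using L.scale [of x "(1, 0)"] by (simp add: mult.commute)
  qed
  ultimately have "((\<lambda>t. H t p) has_field_derivative L (1, 0)) (at s)"
    by (simp only: has_field_derivative_def)
  then have s: "H_s H s p = L (1, 0)"
    by (simp add: H_s_def DERIV_imp_deriv)
  have "((\<lambda>t. (s, t)) has_derivative (\<lambda>x. (0, x))) (at p)"
    by (auto intro!: derivative_eq_intros)
  from diff_chain_at [OF this, of "\<lambda>(s, p). H s p" L] L
  have "((\<lambda>t. H s t) has_derivative (\<lambda>x. L (0, x))) (at p)" by (simp add: o_def)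
  moreover have "(\<lambda>x. L (0, x)) = (*) (L (0, 1))"
  proof
    show "L (0, x) = L (0, 1) * x" for x
      using L.scale [of x "(0, 1)"] by (simp add: mult.commute)
  qed
  ultimately have "((\<lambda>t. H s t) has_field_derivative L (0, 1)) (at p)"
    by (simp only: has_field_derivative_def)
  then have p: "H_p H s p = L (0, 1)"
    by (simp add: H_p_def DERIV_imp_deriv)
  have "L (x, y) = H_s H s p * x + H_p H s p * y" for x y
    using L.add [of "x *\<^sub>R (1, 0)" "y *\<^sub>R (0, 1)"] L.scale [of x "(1, 0)"] L.scale [of y "(0, 1)"]
    by (simp add: s p mult.commute)
  then have "L = (\<lambda>(x, y). H_s H s p * x + H_p H s p * y)" by auto
  then show ?thesis using L by simp
qed

lemma H_chain:
  assumes "(\<lambda>(s, p). H s p) differentiable (at (f t, h t))"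
    and f: "(f has_real_derivative f') (at t)" and h: "(h has_real_derivative h') (at t)"
  shows "((\<lambda>t. H (f t) (h t)) has_real_derivative (H_s H (f t) (h t) * f' + H_p H (f t) (h t) * h')) (at t)"
proof -
  have "((\<lambda>t. (f t, h t)) has_derivative (\<lambda>x. (f' * x, h' * x))) (at t)"
    using f h by (intro has_derivative_Pair) (simp_all add: has_field_derivative_def)
  from diff_chain_at [OF this H_has_derivative [OF assms(1)]]
  have "((\<lambda>t. H (f t) (h t)) has_derivative
      (\<lambda>x. H_s H (f t) (h t) * (f' * x) + H_p H (f t) (h t) * (h' * x))) (at t)"
    by (simp add: o_def)
  moreover have "(\<lambda>x. H_s H (f t) (h t) * (f' * x) + H_p H (f t) (h t) * (h' * x)) =
      (*) (H_s H (f t) (h t) * f' + H_p H (f t) (h t) * h')"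
    by (simp add: fun_eq_iff algebra_simps)
  ultimately show ?thesis by (simp only: has_field_derivative_def)
qed

lemma bilinear_has_vector_derivative:
  fixes b :: "'a::euclidean_space \<Rightarrow> 'b::euclidean_space \<Rightarrow> 'c::real_normed_vector"
  assumes "bilinear b" "(X has_vector_derivative X') (at t)" "(Y has_vector_derivative Y') (at t)"
  shows "((\<lambda>t. b (X t) (Y t)) has_vector_derivative b (X t) Y' + b X' (Y t)) (at t)"
  using bounded_bilinear.has_vector_derivative [OF _ assms(2,3)] assms(1)
  by (simp add: bilinear_conv_bounded_bilinear)

lemma ip_has_derivative:
  assumes "(X has_vector_derivative X') (at t)" "(Y has_vector_derivative Y') (at t)"
  shows "((\<lambda>t. ip g (X t) (Y t)) has_real_derivative ip g (X t) Y' + ip g X' (Y t)) (at t)"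
  using bilinear_has_vector_derivative [OF bilinear_ip assms]
  by (simp add: has_real_derivative_iff_has_vector_derivative)

text \<open>The trace has four slots, and by \<open>quartic_cycle\<close> each contributes the same
  derivative.\<close>

lemma ip_cube_has_derivative:
  assumes g: "transpose g = g" "invertible g"
    and X: "(X has_vector_derivative X') (at t)" and a: "antisym (X t)" "antisym X'"
  shows "((\<lambda>t. ip g (cube g (X t)) (X t)) has_real_derivative 4 * ip g (cube g (X t)) X') (at t)"
proof -
  have R: "((\<lambda>t. raise2 g (X t)) has_vector_derivative raise2 g X') (at t)"
    using bounded_linear.has_vector_derivative [OF _ X] linear_raise2 linear_conv_bounded_linear by blast
  note mult = bilinear_has_vector_derivative [OF bilinear_matrix_mult]
  define Z where "Z = X t"
  have "((\<lambda>t. cube g (X t)) has_vector_derivative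
      Z ** raise2 g Z ** X' + (Z ** raise2 g X' + X' ** raise2 g Z) ** Z) (at t)"
    unfolding cube_def Z_def by (rule mult [OF mult [OF X R] X])
  from ip_has_derivative [OF this X, of g]
  have "((\<lambda>t. ip g (cube g (X t)) (X t)) has_real_derivative
     ip g (cube g Z) X' + (ip g (Z ** raise2 g Z ** X') Z +
       (ip g (Z ** raise2 g X' ** Z) Z + ip g (X' ** raise2 g Z ** Z) Z))) (at t)"
    by (simp add: bilinear_ladd [OF bilinear_matrix_mult] bilinear_ladd [OF bilinear_ip] Z_def)
  moreover have "ip g (Z ** raise2 g Z ** X') Z = ip g (cube g Z) X'"
    "ip g (Z ** raise2 g X' ** Z) Z = ip g (cube g Z) X'"
    "ip g (X' ** raise2 g Z ** Z) Z = ip g (cube g Z) X'"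
    using a quartic_cycle [OF g, of Z Z X' Z] quartic_cycle [OF g, of Z X' Z Z] quartic_cycle [OF g, of X' Z Z Z]
    by (simp_all add: Z_def cube_def)
  ultimately show ?thesis by (simp add: Z_def)
qed

text \<open>One formula covers variations of \<open>F\<close> and of \<open>v\<close>. The invariant
  \<open>p\<close> is differentiated in the form of \<open>p_inv_eq\<close>, through the quartic
  trace, because this produces \<open>H_tensor\<close> directly. That form holds for unit
  \<open>v\<close>, whence the condition on all parameters near \<open>0\<close>.\<close>

lemma pst_lagrangian_has_derivative:
  fixes F :: "real \<Rightarrow> real^6^6^6" and v :: "real \<Rightarrow> real^6"
  assumes g: "lorentzian g" and F: "\<And>t. alternating (F t)" "alternating F'"
    and v: "eventually (\<lambda>t. v t \<bullet> raise1 g (v t) = - 1) (nhds 0)"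
    and F_deriv: "(F has_vector_derivative F') (at 0)" and v_deriv: "(v has_vector_derivative v') (at 0)"
    and p: "p_inv g (F 0) (v 0) > 0"
    and H: "(\<lambda>(s, p). H s p) differentiable (at (s_inv g (F 0) (v 0), p_inv g (F 0) (v 0)))"
  defines "E \<equiv> electric g (F 0) (v 0)" and "B \<equiv> magnetic g (F 0) (v 0)"
    and "e \<equiv> electric g (F 0) v' + electric g F' (v 0)"
    and "b \<equiv> magnetic g (F 0) v' + magnetic g F' (v 0)"
  shows "((\<lambda>t. pst_lagrangian H g (F t) (v t)) has_real_derivative
     (ip g e B + ip g E b) / 4 - ip g (H_tensor H g (F 0) (v 0)) b / 2) (at 0)"
proof -
  note sym = lorentzian_transpose [OF g] lorentzian_invertible [OF g]
  define Et Bt where "Et = (\<lambda>t. electric g (F t) (v t))" and "Bt = (\<lambda>t. magnetic g (F t) (v t))"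
  define s p where "s = (\<lambda>t. ip g (Bt t) (Bt t) / 4)"
    and "p = (\<lambda>t. sqrt (2 * s t * s t + ip g (cube g (Bt t)) (Bt t) / 4))"
  have v0: "v 0 \<bullet> raise1 g (v 0) = - 1" using v by (rule eventually_nhds_x_imp_x)
  then interpret u: unit_timelike g "F 0" "v 0" using g F by unfold_locales
  have E': "(Et has_vector_derivative e) (at 0)" and B': "(Bt has_vector_derivative b) (at 0)"
    unfolding Et_def Bt_def e_def b_def
    by (rule bilinear_has_vector_derivative [OF bilinear_electric F_deriv v_deriv]
        bilinear_has_vector_derivative [OF bilinear_magnetic [OF g] F_deriv v_deriv])+
  have anti: "antisym (magnetic g G w)" if "alternating G" for G w
    by (simp add: magnetic_eq_electric sym electric_eq antisym_contr alternating_ldual)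
  have aB: "antisym (Bt 0)" "antisym b"
    using u.antisym_combination [OF anti [OF F(1)] anti [OF F(2)], of 1 0 v' 1 "v 0"]
    by (simp_all add: Bt_def b_def anti F)
  have s0: "s 0 = s_inv g (F 0) (v 0)" and p0: "p 0 = p_inv g (F 0) (v 0)"
    by (simp_all add: s_def p_def Bt_def s_inv_eq u.p_inv_eq)
  have s': "(s has_real_derivative ip g B b / 2) (at 0)"
    unfolding s_def
    using DERIV_cdivide [OF ip_has_derivative [OF B' B', of g], of 4]
    by (simp add: B_def Bt_def ip_commute [OF sym, of b])
  have pos: "2 * s 0 * s 0 + ip g (cube g (Bt 0)) (Bt 0) / 4 > 0"
  proof -
    have "p 0 > 0" using p p0 by simp
    then show ?thesis by (simp add: p_def)
  qed
  have p': "(p has_real_derivative (2 * s 0 * ip g B b + ip g (cube g B) b) / (2 * p 0)) (at 0)"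
  proof -
    have "((\<lambda>t. 2 * (s t * s t) + ip g (cube g (Bt t)) (Bt t) / 4) has_real_derivative
        2 * (ip g B b / 2 * s 0 + ip g B b / 2 * s 0) + 4 * ip g (cube g (Bt 0)) b / 4) (at 0)"
      by (intro DERIV_add DERIV_cmult DERIV_mult DERIV_cdivide s' ip_cube_has_derivative [OF sym B' aB])
    from DERIV_chain2 [OF DERIV_real_sqrt this] pos show ?thesis
      by (simp add: p_def B_def Bt_def field_simps)
  qed
  have eq: "pst_lagrangian H g (F t) (v t) = ip g (Et t) (Bt t) / 4 - H (s t) (p t)"
    if "v t \<bullet> raise1 g (v t) = - 1" for t
  proof -
    interpret unit_timelike g "F t" "v t" using g F that by unfold_locales
    show ?thesis by (simp add: pst_lagrangian_eq s_def p_def Et_def Bt_def s_inv_eq p_inv_eq)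
  qed
  have HD: "((\<lambda>t. H (s t) (p t)) has_real_derivative
      (H_s H (s 0) (p 0) * (ip g B b / 2) +
       H_p H (s 0) (p 0) * ((2 * s 0 * ip g B b + ip g (cube g B) b) / (2 * p 0)))) (at 0)"
    by (rule H_chain [OF _ s' p']) (use H s0 p0 in simp)
  have "((\<lambda>t. ip g (Et t) (Bt t) / 4 - H (s t) (p t)) has_real_derivative
      (ip g E b + ip g e B) / 4 - (H_s H (s 0) (p 0) * (ip g B b / 2) +
       H_p H (s 0) (p 0) * ((2 * s 0 * ip g B b + ip g (cube g B) b) / (2 * p 0)))) (at 0)"
    using DERIV_diff [OF DERIV_cdivide [OF ip_has_derivative [OF E' B', of g], of 4] HD]
    by (simp add: E_def B_def Et_def Bt_def)
  moreover have "H_s H (s 0) (p 0) * (ip g B b / 2) +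
       H_p H (s 0) (p 0) * ((2 * s 0 * ip g B b + ip g (cube g B) b) / (2 * p 0)) =
      ip g (H_tensor H g (F 0) (v 0)) b / 2"
    using p by (simp add: H_tensor_eq constitutive_def bilinear_ladd [OF bilinear_ip]
        bilinear_lmul [OF bilinear_ip] s0 p0 flip: B_def) (simp add: field_simps)
  ultimately have "((\<lambda>t. ip g (Et t) (Bt t) / 4 - H (s t) (p t)) has_real_derivative
      (ip g e B + ip g E b) / 4 - ip g (H_tensor H g (F 0) (v 0)) b / 2) (at 0)"
    by (simp only: add.commute [of "ip g e B"])
  then show ?thesis
    by (subst DERIV_cong_ev [OF refl _ refl]) (use v in \<open>auto elim!: eventually_mono simp: eq\<close>)
qed

section \<open>Normalised covectors along straight lines\<close>

definition timelike :: "real^6^6 \<Rightarrow> real^6 \<Rightarrow> bool" where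
  "timelike g u \<longleftrightarrow> u \<bullet> raise1 g u < 0"

definition len :: "real^6^6 \<Rightarrow> real^6 \<Rightarrow> real" where
  "len g u = sqrt (- (u \<bullet> raise1 g u))"

text \<open>Normalising an arbitrary timelike covector allows variations along straight lines, which
  is also how a change of the scalar field acts on its gradient.\<close>

definition unitv :: "real^6^6 \<Rightarrow> real^6 \<Rightarrow> real^6" where
  "unitv g u = (1 / len g u) *\<^sub>R u"

lemma len_pos: "timelike g u \<Longrightarrow> len g u > 0"
  by (simp add: timelike_def len_def)

lemma unitv_unit:
  assumes "timelike g u"
  shows "unitv g u \<bullet> raise1 g (unitv g u) = - 1"
proof -
  have "len g u * len g u = - (u \<bullet> raise1 g u)"
    using assms by (simp add: timelike_def len_def)
  then show ?thesis
    using len_pos [OF assms] assms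
    by (simp add: unitv_def timelike_def linear_scale [OF linear_raise1] field_simps)
qed

lemma unitv_of_unit: "u \<bullet> raise1 g u = - 1 \<Longrightarrow> unitv g u = u" "u \<bullet> raise1 g u = - 1 \<Longrightarrow> timelike g u"
  by (simp_all add: unitv_def len_def timelike_def)

lemma bilinear_raise1: "bilinear (\<lambda>u w. u \<bullet> raise1 g w)"
  unfolding bilinear_def
  by (auto intro!: linearI simp: inner_simps linear_add [OF linear_raise1] linear_scale [OF linear_raise1])

lemma timelike_line:
  assumes "timelike g u"
  shows "eventually (\<lambda>t. timelike g (u + t *\<^sub>R k)) (nhds (0::real))"
proof -
  define f where "f = (\<lambda>t::real. (u + t *\<^sub>R k) \<bullet> raise1 g (u + t *\<^sub>R k))"
  have line: "((\<lambda>t. u + t *\<^sub>R k) has_vector_derivative k) (at 0)"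
    by (auto intro!: derivative_eq_intros)
  have "(f has_vector_derivative u \<bullet> raise1 g k + k \<bullet> raise1 g u) (at 0)"
    using bilinear_has_vector_derivative [OF bilinear_raise1 line line, of g] by (simp add: f_def)
  then have "isCont f 0" by (rule has_vector_derivative_continuous)
  then have "(f \<longlongrightarrow> f 0) (at 0)" by (simp add: isCont_def)
  moreover have "f 0 < 0" using assms by (simp add: f_def timelike_def)
  ultimately have "eventually (\<lambda>t. f t < 0) (at 0)" by (rule order_tendstoD(2))
  then have "eventually (\<lambda>t. f t < 0) (nhds 0)"
    using \<open>f 0 < 0\<close> by (simp add: eventually_nhds_conv_at)
  then show ?thesis by (simp add: f_def timelike_def)
qed

text \<open>A curve of unit vectors has a tangent orthogonal to it, which is what the transverse
  formulas require. The multiple of \<open>unitv g u\<close> that achieves this later drops out by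
  \<open>omega_self\<close>.\<close>

lemma unitv_line_has_derivative:
  assumes g: "lorentzian g" and u: "timelike g u"
  obtains v' c where "((\<lambda>t. unitv g (u + t *\<^sub>R k)) has_vector_derivative v') (at 0)"
    "v' = (1 / len g u) *\<^sub>R k + c *\<^sub>R unitv g u" "v' \<bullet> raise1 g (unitv g u) = 0"
proof -
  note sym = lorentzian_transpose [OF g] lorentzian_invertible [OF g]
  define N where "N = len g u"
  have N: "N > 0" unfolding N_def by (rule len_pos [OF u])
  have NN: "N * N = - (u \<bullet> raise1 g u)"
    using u by (simp add: N_def len_def timelike_def)
  define m where "m = k \<bullet> raise1 g u"
  have line: "((\<lambda>t. u + t *\<^sub>R k) has_vector_derivative k) (at 0)"
    by (auto intro!: derivative_eq_intros)
  have "((\<lambda>t. (u + t *\<^sub>R k) \<bullet> raise1 g (u + t *\<^sub>R k)) has_real_derivative 2 * m) (at 0)"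
    using bilinear_has_vector_derivative [OF bilinear_raise1 line line, of g] raise1_commute [OF sym, of u k]
    by (simp add: m_def inner_commute has_real_derivative_iff_has_vector_derivative)
  then have "((\<lambda>t. - ((u + t *\<^sub>R k) \<bullet> raise1 g (u + t *\<^sub>R k))) has_real_derivative - (2 * m)) (at 0)"
    by (rule DERIV_minus)
  from DERIV_chain2 [OF DERIV_real_sqrt this]
  have len': "((\<lambda>t. len g (u + t *\<^sub>R k)) has_real_derivative - m / N) (at 0)"
    using u by (simp add: len_def timelike_def N_def field_simps)
  then have "((\<lambda>t. 1 / len g (u + t *\<^sub>R k)) has_real_derivative m / (N * N * N)) (at 0)"
    using DERIV_inverse_fun [OF len'] N by (simp add: N_def divide_inverse power2_eq_square mult_ac)
  from has_vector_derivative_scaleR [OF this line]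
  have D: "((\<lambda>t. unitv g (u + t *\<^sub>R k)) has_vector_derivative
      (1 / N) *\<^sub>R k + (m / (N * N * N)) *\<^sub>R u) (at 0)"
    by (simp add: unitv_def N_def)
  have "((1 / N) *\<^sub>R k + (m / (N * N * N)) *\<^sub>R u) \<bullet> raise1 g u = m / N + m / (N * N * N) * - (N * N)"
    by (simp add: inner_simps NN m_def)
  also have "\<dots> = 0" using N by (simp add: field_simps)
  finally have "((1 / N) *\<^sub>R k + (m / (N * N * N)) *\<^sub>R u) \<bullet> raise1 g (unitv g u) = 0"
    by (simp add: unitv_def linear_scale [OF linear_raise1])
  moreover have "(m / (N * N * N)) *\<^sub>R u = (m / (N * N)) *\<^sub>R unitv g u"
    using N by (simp add: unitv_def flip: N_def)
  ultimately show thesis using that D by (simp add: N_def)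
qed

definition defect ::
    "(real \<Rightarrow> real \<Rightarrow> real) \<Rightarrow> real^6^6 \<Rightarrow> real^6^6^6 \<Rightarrow> real^6 \<Rightarrow> real^6^6" where
  "defect H g F v = electric g F v - H_tensor H g F v"

lemma self_dual_iff_defect: "self_dual H g F v \<longleftrightarrow> defect H g F v = 0"
  by (simp add: self_dual_def defect_def)

lemma (in unit_timelike) transverse_defect:
  "antisym (defect H g F v)" "defect H g F v *v raise1 g v = 0"
  using antisym_combination [OF transverse_E(1) transverse_constitutive(1), of 1 "- 1" H]
    transverse_E transverse_constitutive(2) [of H]
  by (simp_all add: defect_def H_tensor_eq matrix_vector_mult_diff_rdistrib)

lemma omega_tensor_diff:
  "omega (tensor (X - Y) u) (tensor (X - Y) v) = omega (tensor X u) (tensor X v)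
    + omega (tensor Y u) (tensor Y v) - 2 * omega (tensor Y u) (tensor X v)"
  using omega_tensor_commute [of X u Y v]
  by (simp add: linear_diff [OF linear_tensor(1)] bilinear_lsub [OF bilinear_omega]
      bilinear_rsub [OF bilinear_omega])

text \<open>
  By the gauge-invariance condition the quadratic terms of the variation combine to the square of
  the duality defect.
\<close>

theorem variation_of_aux_vector:
  assumes g: "lorentzian g" and F: "alternating F" and u: "timelike g u"
    and p: "p_inv g F (unitv g u) > 0"
    and H: "(\<lambda>(s, p). H s p) differentiable (at (s_inv g F (unitv g u), p_inv g F (unitv g u)))"
    and pst: "\<And>s p. s = s_inv g F (unitv g u) \<Longrightarrow> p = p_inv g F (unitv g u) \<Longrightarrow>
      (H_s H s p)\<^sup>2 + 2 * s / p * H_s H s p * H_p H s p + (H_p H s p)\<^sup>2 = 1"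
  defines "\<Delta> \<equiv> defect H g F (unitv g u)"
  shows "((\<lambda>t. pst_lagrangian H g F (unitv g (u + t *\<^sub>R k))) has_real_derivative
    - 1 / (8 * sqrt (- det g) * len g u) * omega (tensor \<Delta> k) (tensor \<Delta> (unitv g u))) (at 0)"
proof -
  define v where "v = unitv g u"
  obtain v' c where v': "((\<lambda>t. unitv g (u + t *\<^sub>R k)) has_vector_derivative v') (at 0)"
    "v' = (1 / len g u) *\<^sub>R k + c *\<^sub>R v" "v' \<bullet> raise1 g v = 0"
    unfolding v_def by (rule unitv_line_has_derivative [OF g u])
  interpret unit_timelike g F v
    using g F unitv_unit [OF u] by unfold_locales (simp_all add: v_def)
  define Q where "Q = H_tensor H g F v"
  define K where "K = - 1 / (2 * sqrt (- det g))"
  have Q: "Q = constitutive H g B s p" by (simp add: Q_def H_tensor_eq)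
  have tQ: "antisym Q" "Q *v raise1 g v = 0" unfolding Q by (rule transverse_constitutive)+
  have ev: "eventually (\<lambda>t. unitv g (u + t *\<^sub>R k) \<bullet> raise1 g (unitv g (u + t *\<^sub>R k)) = - 1) (nhds 0)"
    using timelike_line [OF u] by (rule eventually_mono) (rule unitv_unit)
  have const: "((\<lambda>t::real. F) has_vector_derivative 0) (at 0)" by simp
  have zero: "electric g 0 w = 0" "magnetic g 0 w = 0" for w
    by (rule bilinear_lzero bilinear_electric bilinear_magnetic [OF g])+
  have a0: "alternating 0" by (simp add: alternating_def)
  note ip = ip_magnetic_transverse [OF g F v _ _ v'(3), folded K_def]
    ip_electric_transverse [OF g F v _ _ v'(3), folded K_def]
  have "((\<lambda>t. pst_lagrangian H g F (unitv g (u + t *\<^sub>R k))) has_real_derivative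
     (ip g (electric g F v') B + ip g E (magnetic g F v')) / 4 - ip g Q (magnetic g F v') / 2) (at 0)"
    using pst_lagrangian_has_derivative [OF g F a0 ev const v'(1), of H] p H
    by (simp add: zero v_def Q_def)
  also have "(ip g (electric g F v') B + ip g E (magnetic g F v')) / 4 - ip g Q (magnetic g F v') / 2 =
      K / 4 * (omega (tensor B v') (tensor B v) + omega (tensor E v') (tensor E v)
        - 2 * omega (tensor Q v') (tensor E v))"
    by (simp add: ip_commute [OF sym(1,2), of _ B] ip transverse_B transverse_E tQ field_simps)
  \<comment> \<open>The only use of the gauge-invariance condition: it replaces \<open>B\<close> by
    \<open>Q\<close> and so completes the square of \<open>E - Q\<close>.\<close>
  also have "omega (tensor B v') (tensor B v) = omega (tensor Q v') (tensor Q v)"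
    unfolding Q using p pst by (subst omega_constitutive) (auto simp: v_def)
  also have "omega (tensor Q v') (tensor Q v) + omega (tensor E v') (tensor E v)
      - 2 * omega (tensor Q v') (tensor E v) = omega (tensor \<Delta> v') (tensor \<Delta> v)"
    by (simp add: \<Delta>_def defect_def omega_tensor_diff Q_def v_def)
  \<comment> \<open>The part of \<open>v'\<close> along \<open>v\<close> contributes
    \<open>omega\<close> of a tensor with itself, which is zero.\<close>
  also have "omega (tensor \<Delta> v') (tensor \<Delta> v) = 1 / len g u * omega (tensor \<Delta> k) (tensor \<Delta> v)"
    by (simp add: v'(2) linear_add [OF linear_tensor(2)] linear_scale [OF linear_tensor(2)]
        bilinear_ladd [OF bilinear_omega] bilinear_lmul [OF bilinear_omega] omega_self)
  finally show ?thesis by (simp add: K_def v_def)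
qed

text \<open>The general formula rearranged so that the defect appears; the remainder is a quarter of
  \<open>cross_term\<close>.\<close>

lemma variation_of_field:
  assumes g: "lorentzian g" and F: "alternating F" "alternating G" and v: "v \<bullet> raise1 g v = - 1"
    and p: "p_inv g F v > 0"
    and H: "(\<lambda>(s, p). H s p) differentiable (at (s_inv g F v, p_inv g F v))"
  shows "((\<lambda>t. pst_lagrangian H g (F + t *\<^sub>R G) v) has_real_derivative
    ip g (defect H g F v) (magnetic g G v) / 2 +
    (ip g (electric g G v) (magnetic g F v) - ip g (electric g F v) (magnetic g G v)) / 4) (at 0)"
proof -
  have a: "alternating (F + t *\<^sub>R G)" for t
    unfolding alternating_def
  proof (intro allI conjI)
    fix i j k
    show "(F + t *\<^sub>R G) $ j $ i $ k = - ((F + t *\<^sub>R G) $ i $ j $ k)"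
      "(F + t *\<^sub>R G) $ i $ k $ j = - ((F + t *\<^sub>R G) $ i $ j $ k)"
      using alternatingD(1) [OF F(1), of j i k] alternatingD(1) [OF F(2), of j i k]
        alternatingD(2) [OF F(1), of i k j] alternatingD(2) [OF F(2), of i k j]
      by simp_all
  qed
  have d: "((\<lambda>t. F + t *\<^sub>R G) has_vector_derivative G) (at 0)"
    by (auto intro!: derivative_eq_intros)
  have const: "((\<lambda>t::real. v) has_vector_derivative 0) (at 0)" by simp
  have zero: "electric g F 0 = 0" "magnetic g F 0 = 0"
    by (rule bilinear_rzero bilinear_electric bilinear_magnetic [OF g])+
  have "((\<lambda>t. pst_lagrangian H g (F + t *\<^sub>R G) v) has_real_derivative
     (ip g (electric g G v) (magnetic g F v) + ip g (electric g F v) (magnetic g G v)) / 4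
      - ip g (H_tensor H g F v) (magnetic g G v) / 2) (at 0)"
    using pst_lagrangian_has_derivative [OF g a F(2) _ d const, of H] p H v by (simp add: zero)
  then show ?thesis
    by (simp add: defect_def bilinear_lsub [OF bilinear_ip] field_simps)
qed

text \<open>Up to a constant factor, the wedge product of \<open>F\<close> and \<open>G\<close>
  split along a unit vector \<open>v\<close>, which explains its independence of
  \<open>v\<close>.\<close>

definition cross_term :: "real^6^6 \<Rightarrow> real^6^6^6 \<Rightarrow> real^6^6^6 \<Rightarrow> real^6 \<Rightarrow> real" where
  "cross_term g F G v = ip g (electric g G v) (magnetic g F v) - ip g (electric g F v) (magnetic g G v)"

text \<open>The transverse formulas turn all four terms of the derivative into \<open>omega\<close>
  expressions, which \<open>omega_tensor_commute\<close> pairs off.\<close>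

lemma cross_term_stationary:
  assumes g: "lorentzian g" and F: "alternating F" "alternating G" and u: "timelike g u"
  shows "((\<lambda>t. cross_term g F G (unitv g (u + t *\<^sub>R k))) has_real_derivative 0) (at 0)"
proof -
  define v where "v = unitv g u"
  obtain v' c where v': "((\<lambda>t. unitv g (u + t *\<^sub>R k)) has_vector_derivative v') (at 0)"
    "v' = (1 / len g u) *\<^sub>R k + c *\<^sub>R v" "v' \<bullet> raise1 g v = 0"
    unfolding v_def by (rule unitv_line_has_derivative [OF g u])
  interpret F: unit_timelike g F v
    using g F unitv_unit [OF u] by unfold_locales (simp_all add: v_def)
  interpret G: unit_timelike g G v
    using g F unitv_unit [OF u] by unfold_locales (simp_all add: v_def)
  have lin: "((\<lambda>t. b X (unitv g (u + t *\<^sub>R k))) has_vector_derivative b X v') (at 0)"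
    if "bilinear b" for X and b :: "real^6^6^6 \<Rightarrow> real^6 \<Rightarrow> real^6^6"
    using bounded_linear.has_vector_derivative [OF _ v'(1)] that
    by (auto simp: bilinear_def linear_conv_bounded_linear)
  note E = lin [OF bilinear_electric [of g]] and B = lin [OF bilinear_magnetic [OF g]]
  have "((\<lambda>t. cross_term g F G (unitv g (u + t *\<^sub>R k))) has_real_derivative
      (ip g G.E (magnetic g F v') + ip g (electric g G v') F.B)
      - (ip g F.E (magnetic g G v') + ip g (electric g F v') G.B)) (at 0)"
    unfolding cross_term_def
    using DERIV_diff [OF ip_has_derivative [OF E [of G] B [of F], of g] ip_has_derivative [OF E [of F] B [of G], of g]]
    by (simp add: v_def)
  moreover have "ip g G.E (magnetic g F v') + ip g (electric g G v') F.B =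
      ip g F.E (magnetic g G v') + ip g (electric g F v') G.B"
    using omega_tensor_commute [of G.E v' F.E v] omega_tensor_commute [of F.B v' G.B v]
    by (simp add: ip_commute [OF F.sym(1,2), of _ F.B] ip_commute [OF F.sym(1,2), of _ G.B]
        ip_magnetic_transverse [OF g F(1) F.v _ _ v'(3)] ip_magnetic_transverse [OF g F(2) F.v _ _ v'(3)]
        ip_electric_transverse [OF g F(1) F.v _ _ v'(3)] ip_electric_transverse [OF g F(2) F.v _ _ v'(3)]
        F.transverse_E F.transverse_B G.transverse_E G.transverse_B)
  ultimately show ?thesis by simp
qed

section \<open>Continuously differentiable functions\<close>

text \<open>The derivative is an explicit witness, so that sums, products and compositions can be
  handled by exhibiting one; continuity in each fixed direction is enough in finite
  dimension.\<close>

definition C1_on :: "('a::euclidean_space \<Rightarrow> real) \<Rightarrow> 'a set \<Rightarrow> bool" where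
  "C1_on f S \<longleftrightarrow> (\<exists>f'. (\<forall>x\<in>S. (f has_derivative f' x) (at x)) \<and> (\<forall>h. continuous_on S (\<lambda>x. f' x h)))"

named_theorems C1_intros

lemma C1_onI:
  "(\<And>x. x \<in> S \<Longrightarrow> (f has_derivative f' x) (at x)) \<Longrightarrow> (\<And>h. continuous_on S (\<lambda>x. f' x h)) \<Longrightarrow> C1_on f S"
  unfolding C1_on_def by blast

lemma C1_onE:
  assumes "C1_on f S"
  obtains f' where "\<And>x. x \<in> S \<Longrightarrow> (f has_derivative f' x) (at x)" "\<And>h. continuous_on S (\<lambda>x. f' x h)"
  using assms unfolding C1_on_def by blast

lemma C1_on_differentiable: "C1_on f S \<Longrightarrow> x \<in> S \<Longrightarrow> f differentiable (at x)"
  unfolding C1_on_def differentiable_def by blast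

lemma C1_on_frechet: "C1_on f S \<Longrightarrow> continuous_on S (\<lambda>x. frechet_derivative f (at x) h)"
proof (erule C1_onE)
  fix f' assume f': "\<And>x. x \<in> S \<Longrightarrow> (f has_derivative f' x) (at x)" "\<And>h. continuous_on S (\<lambda>x. f' x h)"
  then have "frechet_derivative f (at x) h = f' x h" if "x \<in> S" for x
    using frechet_derivative_at that by metis
  then show "continuous_on S (\<lambda>x. frechet_derivative f (at x) h)"
    using f'(2) [of h] by (simp cong: continuous_on_cong)
qed

lemma C1_on_continuous: "C1_on f S \<Longrightarrow> continuous_on S f"
  by (meson C1_on_differentiable continuous_at_imp_continuous_on differentiable_imp_continuous_within)

lemma C1_on_subset: "C1_on f T \<Longrightarrow> S \<subseteq> T \<Longrightarrow> C1_on f S"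
  unfolding C1_on_def by (meson continuous_on_subset subsetD)

lemma C1_on_cong:
  assumes "C1_on f S" "open S" "\<And>x. x \<in> S \<Longrightarrow> f x = h x"
  shows "C1_on h S"
  using assms unfolding C1_on_def by (metis has_derivative_transform_within_open)

lemma C1_on_const [C1_intros]: "C1_on (\<lambda>x. c) S"
  by (rule C1_onI [where f' = "\<lambda>x h. 0"]) auto

lemma C1_on_linear:
  assumes "bounded_linear L"
  shows "C1_on L S"
  by (rule C1_onI [where f' = "\<lambda>x. L"]) (use assms bounded_linear_imp_has_derivative in auto)

lemma C1_on_add [C1_intros]:
  assumes "C1_on f S" "C1_on h S"
  shows "C1_on (\<lambda>x. f x + h x) S"
  using assms(1)
proof (rule C1_onE)
  fix f' assume f: "\<And>x. x \<in> S \<Longrightarrow> (f has_derivative f' x) (at x)" "\<And>h. continuous_on S (\<lambda>x. f' x h)"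
  obtain h' where h: "\<And>x. x \<in> S \<Longrightarrow> (h has_derivative h' x) (at x)" "\<And>k. continuous_on S (\<lambda>x. h' x k)"
    using assms(2) unfolding C1_on_def by blast
  show ?thesis
    by (rule C1_onI [where f' = "\<lambda>x k. f' x k + h' x k"])
      (use f h in \<open>auto intro!: has_derivative_add continuous_on_add\<close>)
qed

lemma C1_on_mult [C1_intros]:
  assumes "C1_on f S" "C1_on h S"
  shows "C1_on (\<lambda>x. f x * h x) S"
  using assms(1)
proof (rule C1_onE)
  fix f' assume f: "\<And>x. x \<in> S \<Longrightarrow> (f has_derivative f' x) (at x)" "\<And>h. continuous_on S (\<lambda>x. f' x h)"
  obtain h' where h: "\<And>x. x \<in> S \<Longrightarrow> (h has_derivative h' x) (at x)" "\<And>k. continuous_on S (\<lambda>x. h' x k)"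
    using assms(2) unfolding C1_on_def by blast
  show ?thesis
    by (rule C1_onI [where f' = "\<lambda>x k. f x * h' x k + f' x k * h x"])
      (use f h C1_on_continuous [OF assms(1)] C1_on_continuous [OF assms(2)] in
        \<open>auto intro!: has_derivative_mult continuous_intros\<close>)
qed

lemma C1_on_compose_real:
  assumes f: "C1_on f S" and h: "\<And>x. x \<in> S \<Longrightarrow> (h has_real_derivative h' (f x)) (at (f x))"
    and h': "continuous_on S (\<lambda>x. h' (f x))"
  shows "C1_on (\<lambda>x. h (f x)) S"
  using f
proof (rule C1_onE)
  fix f' assume f': "\<And>x. x \<in> S \<Longrightarrow> (f has_derivative f' x) (at x)" "\<And>h. continuous_on S (\<lambda>x. f' x h)"
  show ?thesis
  proof (rule C1_onI [where f' = "\<lambda>x k. f' x k * h' (f x)"])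
    show "((\<lambda>x. h (f x)) has_derivative (\<lambda>k. f' x k * h' (f x))) (at x)" if "x \<in> S" for x
      by (rule DERIV_compose_FDERIV [OF h [OF that] f'(1) [OF that]])
  qed (intro continuous_intros f' h')
qed

lemma C1_on_minus [C1_intros]: "C1_on f S \<Longrightarrow> C1_on (\<lambda>x. - f x) S"
  using C1_on_mult [OF C1_on_const [of "- 1"]] by fastforce

lemma C1_on_diff [C1_intros]: "C1_on f S \<Longrightarrow> C1_on h S \<Longrightarrow> C1_on (\<lambda>x. f x - h x) S"
  using C1_on_add [OF _ C1_on_minus] by fastforce

lemma C1_on_inverse [C1_intros]:
  assumes "C1_on f S" "\<And>x. x \<in> S \<Longrightarrow> f x \<noteq> 0"
  shows "C1_on (\<lambda>x. inverse (f x)) S"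
  by (rule C1_on_compose_real [OF assms(1), where h' = "\<lambda>y. - (inverse y ^ 2)"])
    (use assms C1_on_continuous [OF assms(1)] in
      \<open>auto intro!: derivative_eq_intros continuous_intros simp: power2_eq_square\<close>)

lemma C1_on_divide [C1_intros]:
  "C1_on f S \<Longrightarrow> C1_on h S \<Longrightarrow> (\<And>x. x \<in> S \<Longrightarrow> h x \<noteq> 0) \<Longrightarrow> C1_on (\<lambda>x. f x / h x) S"
  unfolding divide_inverse by (intro C1_intros)

lemma C1_on_sqrt [C1_intros]:
  assumes "C1_on f S" "\<And>x. x \<in> S \<Longrightarrow> f x > 0"
  shows "C1_on (\<lambda>x. sqrt (f x)) S"
  by (rule C1_on_compose_real [OF assms(1), where h' = "\<lambda>y. inverse (sqrt y) / 2"])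
    (use assms C1_on_continuous [OF assms(1)] in
      \<open>fastforce intro!: DERIV_real_sqrt continuous_intros\<close>)+

lemma C1_on_sum [C1_intros]: "(\<And>i. i \<in> I \<Longrightarrow> C1_on (f i) S) \<Longrightarrow> C1_on (\<lambda>x. \<Sum>i\<in>I. f i x) S"
  by (induction I rule: infinite_finite_induct) (auto intro!: C1_intros)

lemma C1_on_prod [C1_intros]: "(\<And>i. i \<in> I \<Longrightarrow> C1_on (f i) S) \<Longrightarrow> C1_on (\<lambda>x. \<Prod>i\<in>I. f i x) S"
  by (induction I rule: infinite_finite_induct) (auto intro!: C1_intros)

lemma C1_on_compose_linear:
  assumes f: "C1_on f T" and L: "bounded_linear L" and LS: "L ` S \<subseteq> T"
  shows "C1_on (\<lambda>x. f (L x)) S"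
  using f
proof (rule C1_onE)
  fix f' assume f': "\<And>x. x \<in> T \<Longrightarrow> (f has_derivative f' x) (at x)" "\<And>h. continuous_on T (\<lambda>x. f' x h)"
  show ?thesis
  proof (rule C1_onI [where f' = "\<lambda>x k. f' (L x) (L k)"])
    fix x assume "x \<in> S"
    then have "(f has_derivative f' (L x)) (at (L x))" using f' LS by auto
    from diff_chain_at [OF bounded_linear_imp_has_derivative [OF L] this]
    show "((\<lambda>x. f (L x)) has_derivative (\<lambda>k. f' (L x) (L k))) (at x)" by (simp add: o_def)
  next
    show "continuous_on S (\<lambda>x. f' (L x) (L k))" for k
      using continuous_on_compose2 [OF f'(2) linear_continuous_on [OF L] LS] .
  qed
qed

lemma C1_on_compose_pair:
  fixes f :: "real \<times> real \<Rightarrow> real"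
  assumes f: "C1_on f T" and a: "C1_on a S" and b: "C1_on b S" and T: "\<And>x. x \<in> S \<Longrightarrow> (a x, b x) \<in> T"
  shows "C1_on (\<lambda>x. f (a x, b x)) S"
proof -
  obtain f' where f': "\<And>x. x \<in> T \<Longrightarrow> (f has_derivative f' x) (at x)" "\<And>h. continuous_on T (\<lambda>x. f' x h)"
    using f unfolding C1_on_def by blast
  obtain a' where a': "\<And>x. x \<in> S \<Longrightarrow> (a has_derivative a' x) (at x)" "\<And>k. continuous_on S (\<lambda>x. a' x k)"
    using a unfolding C1_on_def by blast
  obtain b' where b': "\<And>x. x \<in> S \<Longrightarrow> (b has_derivative b' x) (at x)" "\<And>k. continuous_on S (\<lambda>x. b' x k)"
    using b unfolding C1_on_def by blast
  have split: "f' y (h, k) = h * f' y (1, 0) + k * f' y (0, 1)" if "y \<in> T" for y h k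
  proof -
    interpret linear "f' y" using f'(1) [OF that] by (rule has_derivative_linear)
    show ?thesis using add [of "h *\<^sub>R (1, 0)" "k *\<^sub>R (0, 1)"] scale [of h "(1, 0)"] scale [of k "(0, 1)"] by simp
  qed
  have cont: "continuous_on S (\<lambda>x. f' (a x, b x) h)" for h
  proof (rule continuous_on_compose2 [OF f'(2)])
    show "continuous_on S (\<lambda>x. (a x, b x))"
      by (intro continuous_on_Pair C1_on_continuous [OF a] C1_on_continuous [OF b])
  qed (use T in auto)
  show ?thesis
  proof (rule C1_onI [where f' = "\<lambda>x k. a' x k * f' (a x, b x) (1, 0) + b' x k * f' (a x, b x) (0, 1)"])
    fix x assume x: "x \<in> S"
    have "((\<lambda>x. (a x, b x)) has_derivative (\<lambda>k. (a' x k, b' x k))) (at x)"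
      using a' b' x by (intro has_derivative_Pair) auto
    from diff_chain_at [OF this f'(1) [OF T [OF x]]]
    have "((\<lambda>x. f (a x, b x)) has_derivative (\<lambda>k. f' (a x, b x) (a' x k, b' x k))) (at x)"
      by (simp add: o_def)
    moreover have "(\<lambda>k. f' (a x, b x) (a' x k, b' x k)) =
        (\<lambda>k. a' x k * f' (a x, b x) (1, 0) + b' x k * f' (a x, b x) (0, 1))"
      by (rule ext) (rule split [OF T [OF x]])
    ultimately show "((\<lambda>x. f (a x, b x)) has_derivative
        (\<lambda>k. a' x k * f' (a x, b x) (1, 0) + b' x k * f' (a x, b x) (0, 1))) (at x)"
      by simp
  qed (intro continuous_intros a' b' cont)
qed

lemma Ck_on_1_imp_C1_on:
  assumes "Ck_on (Suc 0) f S"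
  shows "C1_on f S"
proof (rule C1_onI)
  fix x assume "x \<in> S"
  then have "f differentiable (at x)" using assms by simp
  then show "(f has_derivative frechet_derivative f (at x)) (at x)"
    by (rule frechet_derivative_works [THEN iffD1])
next
  fix h
  have "frechet_derivative f (at x) h = (\<Sum>b\<in>Basis. (h \<bullet> b) * frechet_derivative f (at x) b)" if "x \<in> S" for x
  proof -
    have "linear (frechet_derivative f (at x))"
      using assms that by (intro linear_frechet_derivative) simp
    then show ?thesis
      by (subst euclidean_representation [symmetric, of h]) (simp add: linear_sum linear_scale)
  qed
  moreover have "continuous_on S (\<lambda>x. \<Sum>b\<in>Basis. (h \<bullet> b) * frechet_derivative f (at x) b)"
    using assms by (auto intro!: continuous_intros)
  ultimately show "continuous_on S (\<lambda>x. frechet_derivative f (at x) h)"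
    by (simp cong: continuous_on_cong)
qed

lemma Ck_on_2_imp_C1_on:
  assumes "Ck_on 2 f S"
  shows "C1_on f S" and "b \<in> Basis \<Longrightarrow> C1_on (\<lambda>x. frechet_derivative f (at x) b) S"
proof -
  have f: "\<forall>x\<in>S. f differentiable (at x)"
    and f': "\<forall>b\<in>Basis. Ck_on (Suc 0) (\<lambda>x. frechet_derivative f (at x) b) S"
    using assms by (auto simp: numeral_2_eq_2)
  show "b \<in> Basis \<Longrightarrow> C1_on (\<lambda>x. frechet_derivative f (at x) b) S"
    using f' Ck_on_1_imp_C1_on by blast
  have "\<forall>b\<in>Basis. continuous_on S (\<lambda>x. frechet_derivative f (at x) b)"
    using f' Ck_on_1_imp_C1_on C1_on_continuous by blast
  then have "Ck_on (Suc 0) f S" using f by simp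
  then show "C1_on f S" by (rule Ck_on_1_imp_C1_on)
qed

section \<open>Regularity of the tensor fields\<close>

lemma C1_on_det [C1_intros]:
  fixes A :: "'a::euclidean_space \<Rightarrow> real^'n^'n"
  assumes "\<And>i j. C1_on (\<lambda>z. A z $ i $ j) S"
  shows "C1_on (\<lambda>z. det (A z)) S"
  unfolding det_def by (intro C1_intros assms)

text \<open>Cramer's rule exhibits the entries of the inverse as rational functions, from which
  their smoothness follows.\<close>

lemma matrix_inv_cramer:
  fixes A :: "real^'n^'n"
  assumes "det A \<noteq> 0"
  shows "matrix_inv A $ i $ j = det (\<chi> k l. if l = i then axis j 1 $ k else A $ k $ l) / det A"
proof -
  have "invertible A" using assms by (simp add: invertible_det_nz)
  then have "A *v (matrix_inv A *v axis j 1) = axis j 1"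
    by (simp add: matrix_vector_mul_assoc matrix_inv_mult)
  then have "matrix_inv A *v axis j 1 = (\<chi> i. det (\<chi> k l. if l = i then axis j 1 $ k else A $ k $ l) / det A)"
    using cramer [OF assms] by blast
  moreover have "(matrix_inv A *v axis j 1) $ i = matrix_inv A $ i $ j"
    by (simp add: matrix_vector_mult_basis column_def)
  ultimately show ?thesis by simp
qed

lemma C1_on_matrix_inv:
  fixes A :: "'a::euclidean_space \<Rightarrow> real^'n^'n"
  assumes A: "\<And>i j. C1_on (\<lambda>z. A z $ i $ j) S" and S: "open S" and nz: "\<And>z. z \<in> S \<Longrightarrow> det (A z) \<noteq> 0"
  shows "C1_on (\<lambda>z. matrix_inv (A z) $ i $ j) S"
proof (rule C1_on_cong [OF _ S])
  show "C1_on (\<lambda>z. det (\<chi> k l. if l = i then axis j 1 $ k else A z $ k $ l) / det (A z)) S"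
  proof (intro C1_intros nz A)
    show "C1_on (\<lambda>z. (\<chi> k l. if l = i then axis j 1 $ k else A z $ k $ l) $ k $ l) S" for k l
      by (cases "l = i") (simp_all add: A C1_on_const)
  qed
qed (simp add: matrix_inv_cramer nz)

text \<open>The parameter space is left general, because it is instantiated with space-time, with
  the deformation parameter times space-time, and with pairs of a perturbation of \<open>F\<close>
  and a covector.\<close>

locale C1_fields =
  fixes S :: "'a::euclidean_space set" and g :: "'a \<Rightarrow> real^6^6" and F :: "'a \<Rightarrow> real^6^6^6"
    and v :: "'a \<Rightarrow> real^6"
  assumes S: "open S" and g_lorentzian: "\<And>z. z \<in> S \<Longrightarrow> lorentzian (g z)"
    and g [C1_intros]: "\<And>i j. C1_on (\<lambda>z. g z $ i $ j) S"
    and F [C1_intros]: "\<And>i j k. C1_on (\<lambda>z. F z $ i $ j $ k) S"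
    and v [C1_intros]: "\<And>i. C1_on (\<lambda>z. v z $ i) S"
begin

lemma det_neg: "z \<in> S \<Longrightarrow> - det (g z) > 0"
  using g_lorentzian lorentzian_det by fastforce

lemma sqrt_det [C1_intros]: "C1_on (\<lambda>z. sqrt (- det (g z))) S"
  by (intro C1_intros det_neg)

lemma inv [C1_intros]: "C1_on (\<lambda>z. matrix_inv (g z) $ i $ j) S"
  using det_neg by (intro C1_on_matrix_inv g S) force

lemma raise1 [C1_intros]:
  assumes [C1_intros]: "\<And>i. C1_on (\<lambda>z. u z $ i) S"
  shows "C1_on (\<lambda>z. raise1 (g z) (u z) $ i) S"
  unfolding raise1_def matrix_vector_mult_def by simp (intro C1_intros)

lemma raise2 [C1_intros]:
  assumes [C1_intros]: "\<And>i j. C1_on (\<lambda>z. T z $ i $ j) S"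
  shows "C1_on (\<lambda>z. raise2 (g z) (T z) $ i $ j) S"
  unfolding raise2_def matrix_entry transpose_def by simp (intro C1_intros)

lemma lower2 [C1_intros]:
  assumes [C1_intros]: "\<And>i j. C1_on (\<lambda>z. T z $ i $ j) S"
  shows "C1_on (\<lambda>z. lower2 (g z) (T z) $ i $ j) S"
  unfolding lower2_def matrix_entry transpose_def by simp (intro C1_intros)

lemma electric [C1_intros]: "C1_on (\<lambda>z. electric (g z) (F z) (v z) $ i $ j) S"
  unfolding electric_def by simp (intro C1_intros)

lemma dual [C1_intros]: "C1_on (\<lambda>z. dual (g z) (F z) $ i $ j $ k) S"
  unfolding dual_eq epsc_def by (simp add: divide_inverse [symmetric])
    (intro C1_intros, use det_neg in fastforce)

lemma magnetic [C1_intros]: "C1_on (\<lambda>z. magnetic (g z) (F z) (v z) $ i $ j) S"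
  unfolding magnetic_def by (rule lower2) (simp, intro C1_intros)

lemma ip [C1_intros]:
  assumes [C1_intros]: "\<And>i j. C1_on (\<lambda>z. X z $ i $ j) S" "\<And>i j. C1_on (\<lambda>z. Y z $ i $ j) S"
  shows "C1_on (\<lambda>z. ip (g z) (X z) (Y z)) S"
  unfolding ip_sum by (intro C1_intros)

lemma cube [C1_intros]:
  assumes [C1_intros]: "\<And>i j. C1_on (\<lambda>z. X z $ i $ j) S"
  shows "C1_on (\<lambda>z. cube (g z) (X z) $ i $ j) S"
  unfolding cube_def matrix_entry by (intro C1_intros)

lemma s_inv [C1_intros]: "C1_on (\<lambda>z. s_inv (g z) (F z) (v z)) S"
  unfolding s_inv_eq by (intro C1_intros)

lemma p_vec [C1_intros]: "C1_on (\<lambda>z. p_vec (g z) (F z) (v z) $ i) S"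
  unfolding p_vec_def by simp (intro C1_intros, use det_neg in fastforce)

text \<open>The square of \<open>p_inv\<close> is regular everywhere; this already gives continuity
  of \<open>p_inv\<close>, which \<open>open_dual_domain\<close> needs before positivity is
  known.\<close>

lemma p_inv_sq [C1_intros]: "C1_on (\<lambda>z. p_vec (g z) (F z) (v z) \<bullet> (g z *v p_vec (g z) (F z) (v z))) S"
  unfolding inner_vec_def matrix_vector_mult_def by simp (intro C1_intros)

end

locale C1_dual_fields = C1_fields +
  fixes H :: "real \<Rightarrow> real \<Rightarrow> real" and U :: "(real \<times> real) set"
  assumes U: "open U" and U_pos: "\<And>s p. (s, p) \<in> U \<Longrightarrow> p > 0"
    and H_C2: "Ck_on 2 (\<lambda>(s, p). H s p) U"
    and domain: "\<And>z. z \<in> S \<Longrightarrow> (s_inv (g z) (F z) (v z), p_inv (g z) (F z) (v z)) \<in> U"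
begin

lemma p_pos: "z \<in> S \<Longrightarrow> p_inv (g z) (F z) (v z) > 0"
  using domain U_pos by blast

lemma p_inv [C1_intros]: "C1_on (\<lambda>z. p_inv (g z) (F z) (v z)) S"
  unfolding p_inv_def using p_pos by (intro C1_intros) (simp add: p_inv_def)

lemma H_differentiable: "(s, p) \<in> U \<Longrightarrow> (\<lambda>(s, p). H s p) differentiable (at (s, p))"
  using C1_on_differentiable [OF Ck_on_2_imp_C1_on(1) [OF H_C2]] by blast

lemma H_partial:
  assumes "(s, p) \<in> U"
  shows "H_s H s p = frechet_derivative (\<lambda>(s, p). H s p) (at (s, p)) (1, 0)"
    "H_p H s p = frechet_derivative (\<lambda>(s, p). H s p) (at (s, p)) (0, 1)"
  using frechet_derivative_at [OF H_has_derivative [OF H_differentiable [OF assms]], symmetric] by simp_all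

lemma H_partials_C1: "C1_on (\<lambda>(s, p). H_s H s p) U" "C1_on (\<lambda>(s, p). H_p H s p) U"
proof -
  have "(1, 0) \<in> (Basis :: (real \<times> real) set)" "(0, 1) \<in> (Basis :: (real \<times> real) set)"
    by (simp_all add: Basis_prod_def)
  note C = Ck_on_2_imp_C1_on(2) [OF H_C2 this(1)] Ck_on_2_imp_C1_on(2) [OF H_C2 this(2)]
  show "C1_on (\<lambda>(s, p). H_s H s p) U" "C1_on (\<lambda>(s, p). H_p H s p) U"
    by (rule C1_on_cong [OF C(1) U]; auto simp: H_partial) (rule C1_on_cong [OF C(2) U]; auto simp: H_partial)
qed

lemma H_value [C1_intros]: "C1_on (\<lambda>z. H (s_inv (g z) (F z) (v z)) (p_inv (g z) (F z) (v z))) S"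
  using C1_on_compose_pair [OF Ck_on_2_imp_C1_on(1) [OF H_C2] s_inv p_inv domain] by simp

lemma H_s_value [C1_intros]: "C1_on (\<lambda>z. H_s H (s_inv (g z) (F z) (v z)) (p_inv (g z) (F z) (v z))) S"
  using C1_on_compose_pair [OF H_partials_C1(1) s_inv p_inv domain] by simp

lemma H_p_value [C1_intros]: "C1_on (\<lambda>z. H_p H (s_inv (g z) (F z) (v z)) (p_inv (g z) (F z) (v z))) S"
  using C1_on_compose_pair [OF H_partials_C1(2) s_inv p_inv domain] by simp

lemma H_tensor [C1_intros]: "C1_on (\<lambda>z. H_tensor H (g z) (F z) (v z) $ i $ j) S"
  unfolding H_tensor_eq constitutive_def using p_pos by simp (intro C1_intros; force)

lemma defect [C1_intros]: "C1_on (\<lambda>z. defect H (g z) (F z) (v z) $ i $ j) S"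
  unfolding defect_def by simp (intro C1_intros)

lemma lagrangian: "C1_on (\<lambda>z. pst_lagrangian H (g z) (F z) (v z)) S"
  unfolding pst_lagrangian_def by (intro C1_intros)

end

section \<open>Calculus of variations\<close>

lemma integrable_on_compact:
  fixes f :: "'a::euclidean_space \<Rightarrow> real"
  assumes "compact K" "continuous_on K f"
  shows "f integrable_on K"
  using borel_integrable_compact [OF assms] set_borel_integral_eq_integral(1)
  unfolding set_integrable_def by blast

text \<open>Compactness yields a uniform strip around \<open>t = 0\<close> inside \<open>W\<close>,
  and uniform continuity of \<open>f'\<close> there makes the difference quotients converge
  uniformly on \<open>K\<close>. The set \<open>W\<close> accommodates deformations that remain
  timelike, with invariants in \<open>U\<close>, only near \<open>t = 0\<close>.\<close>

lemma integral_has_derivative_compact: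
  fixes f :: "real \<Rightarrow> 'a::euclidean_space \<Rightarrow> real"
  assumes K: "compact K" and W: "open W" "{0} \<times> K \<subseteq> W"
    and f': "\<And>t x. (t, x) \<in> W \<Longrightarrow> ((\<lambda>t. f t x) has_real_derivative f' t x) (at t)"
    and cont': "continuous_on W (\<lambda>(t, x). f' t x)"
    and cont: "continuous_on W (\<lambda>(t, x). f t x)"
  shows "((\<lambda>t. integral K (f t)) has_real_derivative integral K (f' 0)) (at 0)"
proof -
  have "compact ({0} \<times> K :: (real \<times> 'a) set)" using K by (intro compact_Times) auto
  then obtain \<epsilon> where \<epsilon>: "\<epsilon> > 0" "(\<Union>z\<in>{0} \<times> K. ball z \<epsilon>) \<subseteq> W"
    using compact_subset_open_imp_ball_epsilon_subset [OF _ W] by blast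
  define d where "d = \<epsilon> / 2"
  have d: "d > 0" using \<epsilon> by (simp add: d_def)
  have KW: "{-d..d} \<times> K \<subseteq> W"
  proof
    fix z assume "z \<in> {-d..d} \<times> K"
    then obtain t x where z: "z = (t, x)" "\<bar>t\<bar> \<le> d" "x \<in> K" by auto
    then have "dist (0, x) (t, x) < \<epsilon>" using d by (simp add: dist_Pair_Pair dist_real_def d_def)
    then show "z \<in> W" using \<epsilon>(2) z by (force simp: ball_def)
  qed
  have slice: "continuous_on K (f t)" "continuous_on K (f' t)" if "\<bar>t\<bar> \<le> d" for t
  proof -
    have "(\<lambda>x. (t, x)) ` K \<subseteq> W" using that by (auto simp: abs_le_iff intro!: subsetD [OF KW])
    moreover have "continuous_on K (\<lambda>x. (t, x))"
      by (intro continuous_on_Pair continuous_on_const continuous_on_id)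
    ultimately show "continuous_on K (f t)" "continuous_on K (f' t)"
      using continuous_on_compose2 [OF cont, of K "\<lambda>x. (t, x)"]
        continuous_on_compose2 [OF cont', of K "\<lambda>x. (t, x)"] by simp_all
  qed
  have int: "f t integrable_on K" "f' t integrable_on K" if "\<bar>t\<bar> \<le> d" for t
    using slice [OF that] K by (simp_all add: integrable_on_compact)
  define M where "M = integral K (\<lambda>x. 1 :: real)"
  have int1: "(\<lambda>x. 1 :: real) integrable_on K"
    using K by (intro integrable_on_compact) auto
  have M: "M \<ge> 0" unfolding M_def by (rule integral_nonneg [OF int1]) simp
  have "uniformly_continuous_on ({-d..d} \<times> K) (\<lambda>(t, x). f' t x)"
    by (rule compact_uniformly_continuous [OF continuous_on_subset [OF cont' KW]])
      (use K in \<open>auto intro: compact_Times\<close>)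
  then have unif: "\<exists>\<delta>>0. \<forall>t x. \<bar>t\<bar> \<le> d \<longrightarrow> \<bar>t\<bar> < \<delta> \<longrightarrow> x \<in> K \<longrightarrow> \<bar>f' t x - f' 0 x\<bar> < e" if e: "e > 0" for e
  proof -
    obtain \<delta> where "\<delta> > 0" and \<delta>: "\<And>z z'. z \<in> {-d..d} \<times> K \<Longrightarrow> z' \<in> {-d..d} \<times> K \<Longrightarrow> dist z' z < \<delta> \<Longrightarrow>
        dist ((\<lambda>(t, x). f' t x) z') ((\<lambda>(t, x). f' t x) z) < e"
      using \<open>uniformly_continuous_on _ _\<close> e unfolding uniformly_continuous_on_def by metis
    have "\<bar>f' t x - f' 0 x\<bar> < e" if "\<bar>t\<bar> \<le> d" "\<bar>t\<bar> < \<delta>" "x \<in> K" for t x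
      using \<delta> [of "(0, x)" "(t, x)"] that d by (auto simp: dist_Pair_Pair dist_real_def abs_le_iff)
    then show ?thesis using \<open>\<delta> > 0\<close> by blast
  qed
  show ?thesis
    unfolding DERIV_def
  proof (rule LIM_I)
    fix r :: real assume "r > 0"
    \<comment> \<open>\<open>M\<close> is the volume of \<open>K\<close> and may be zero, hence
      \<open>M + 1\<close>; the factor 2 keeps the final inequality strict.\<close>
    define e where "e = r / (2 * (M + 1))"
    have e: "e > 0" using \<open>r > 0\<close> M by (simp add: e_def)
    have eM: "e * M < r"
    proof -
      have "e * M \<le> e * (M + 1)" using e by simp
      also have "\<dots> = r / 2" using M by (simp add: e_def field_simps)
      finally show ?thesis using \<open>r > 0\<close> by simp
    qed
    obtain \<delta> where \<delta>: "\<delta> > 0" "\<And>t x. \<bar>t\<bar> \<le> d \<Longrightarrow> \<bar>t\<bar> < \<delta> \<Longrightarrow> x \<in> K \<Longrightarrow> \<bar>f' t x - f' 0 x\<bar> < e"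
      using unif [OF e] by blast
    have "\<bar>(integral K (f (0 + h)) - integral K (f 0)) / h - integral K (f' 0)\<bar> < r"
      if h: "h \<noteq> 0" "\<bar>h\<bar> < min \<delta> d" for h
    proof -
      \<comment> \<open>The mean value bound for \<open>f t x - t * f' 0 x\<close>, whose derivative
        in \<open>t\<close> is smaller than \<open>e\<close>.\<close>
      have pt: "\<bar>f h x - f 0 x - h * f' 0 x\<bar> \<le> e * \<bar>h\<bar>" if x: "x \<in> K" for x
      proof -
        have D: "((\<lambda>t. f t x - t * f' 0 x) has_real_derivative f' t x - f' 0 x) (at t within {-\<bar>h\<bar>..\<bar>h\<bar>})"
          if "t \<in> {-\<bar>h\<bar>..\<bar>h\<bar>}" for t
        proof -
          have "(t, x) \<in> W" using that KW x h by auto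
          then show ?thesis
            by (auto intro!: derivative_eq_intros DERIV_subset [OF f'])
        qed
        have "norm ((f h x - h * f' 0 x) - (f 0 x - 0 * f' 0 x)) \<le> e * norm (h - 0)"
        proof (rule field_differentiable_bound [OF _ D])
          show "norm (f' t x - f' 0 x) \<le> e" if "t \<in> {-\<bar>h\<bar>..\<bar>h\<bar>}" for t
            using \<delta>(2) [of t x] x h that by fastforce
        qed auto
        then show ?thesis by (simp add: algebra_simps)
      qed
      have hd: "\<bar>h\<bar> \<le> d" using h by simp
      have d0: "\<bar>0 :: real\<bar> \<le> d" using d by simp
      have i1: "(\<lambda>x. f h x - f 0 x - h * f' 0 x) integrable_on K"
        using int [OF hd] int [OF d0] by (intro integrable_diff integrable_on_mult_right)
      have "norm (integral K (\<lambda>x. f h x - f 0 x - h * f' 0 x)) \<le> integral K (\<lambda>x. e * \<bar>h\<bar> * 1)"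
        by (rule integral_norm_bound_integral [OF i1 integrable_on_mult_right [OF int1]])
          (use pt in auto)
      moreover have "integral K (\<lambda>x. f h x - f 0 x - h * f' 0 x) =
          integral K (f h) - integral K (f 0) - h * integral K (f' 0)"
        using int [OF hd] int [OF d0]
        by (simp add: Henstock_Kurzweil_Integration.integral_diff integrable_diff integrable_on_mult_right)
      moreover have "integral K (\<lambda>x. e * \<bar>h\<bar> * 1) = e * \<bar>h\<bar> * M"
        by (simp only: M_def Henstock_Kurzweil_Integration.integral_mult_right)
      ultimately have *: "\<bar>integral K (f h) - integral K (f 0) - h * integral K (f' 0)\<bar> \<le> e * M * \<bar>h\<bar>"
        by (simp only: real_norm_def mult_ac)
      have "(integral K (f (0 + h)) - integral K (f 0)) / h - integral K (f' 0) =
          (integral K (f h) - integral K (f 0) - h * integral K (f' 0)) / h"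
        using h by (simp add: field_simps)
      then have "\<bar>(integral K (f (0 + h)) - integral K (f 0)) / h - integral K (f' 0)\<bar> \<le> e * M"
        using * h by (simp add: abs_divide pos_divide_le_eq)
      then show ?thesis using eM by simp
    qed
    then show "\<exists>s>0. \<forall>h. h \<noteq> 0 \<and> norm (h - 0) < s \<longrightarrow>
        norm ((integral K (f (0 + h)) - integral K (f 0)) / h - integral K (f' 0)) < r"
      using \<delta>(1) d by (intro exI [of _ "min \<delta> d"]) auto
  qed
qed

lemma frechet_derivative_line:
  assumes "f differentiable (at (x + t *\<^sub>R h))"
  shows "((\<lambda>t. f (x + t *\<^sub>R h)) has_real_derivative frechet_derivative f (at (x + t *\<^sub>R h)) h) (at t)"
proof -
  have D: "(f has_derivative frechet_derivative f (at (x + t *\<^sub>R h))) (at (x + t *\<^sub>R h))"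
    using assms by (rule frechet_derivative_works [THEN iffD1])
  have "((\<lambda>t. x + t *\<^sub>R h) has_derivative (\<lambda>s. s *\<^sub>R h)) (at t)"
    by (auto intro!: derivative_eq_intros)
  from diff_chain_at [OF this D]
  have "((\<lambda>t. f (x + t *\<^sub>R h)) has_derivative (\<lambda>s. frechet_derivative f (at (x + t *\<^sub>R h)) (s *\<^sub>R h))) (at t)"
    by (simp add: o_def)
  then show ?thesis
    using linear_scale [OF has_derivative_linear [OF D], of _ h]
    by (simp add: has_field_derivative_def mult_commute_abs)
qed

text \<open>Differentiating the translation-invariant integral of \<open>f\<close> avoids Fubini's theorem.\<close>

lemma integral_derivative_eq_0:
  fixes f :: "'a::euclidean_space \<Rightarrow> real"
  assumes f: "C1_on f UNIV" and K: "compact K" and zero: "\<And>x. x \<notin> K \<Longrightarrow> f x = 0"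
  shows "integral K (\<lambda>x. frechet_derivative f (at x) h) = 0"
proof -
  \<comment> \<open>\<open>Q\<close> collects all translates of \<open>K\<close> by at most
    \<open>h\<close>. A box around it contains the support of every translate of \<open>f\<close>,
    so the box integral of the translates is constant for \<open>t\<close> between
    \<open>- 1\<close> and \<open>1\<close>.\<close>
  define Q where "Q = (\<lambda>(x, t). x - t *\<^sub>R h) ` (K \<times> {-1..1::real})"
  have "compact Q"
    unfolding Q_def
    by (intro compact_continuous_image compact_Times K compact_Icc)
      (auto intro!: continuous_intros simp: case_prod_unfold)
  then have "bounded Q" by (rule compact_imp_bounded)
  then obtain a b where ab: "Q \<subseteq> cbox a b"
    using bounded_subset_cbox_symmetric by metis
  have Kab: "K \<subseteq> cbox (a + t *\<^sub>R h) (b + t *\<^sub>R h)" if "t \<in> {-1..1}" for t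
  proof
    fix x assume "x \<in> K"
    then have "x - t *\<^sub>R h \<in> Q" unfolding Q_def using that by (intro image_eqI [of _ _ "(x, t)"]) auto
    then have "x - t *\<^sub>R h \<in> cbox a b" using ab by blast
    then show "x \<in> cbox (a + t *\<^sub>R h) (b + t *\<^sub>R h)"
      by (auto simp: mem_box algebra_simps inner_simps)
  qed
  have cont: "continuous_on UNIV f" using f by (rule C1_on_continuous)
  then have "(f has_integral integral K f) K"
    using K by (meson continuous_on_subset integrable_integral integrable_on_compact subset_UNIV)
  then have int: "(f has_integral integral K f) (cbox (a + t *\<^sub>R h) (b + t *\<^sub>R h))" if "t \<in> {-1..1}" for t
    using has_integral_on_superset zero Kab [OF that] by blast
  have const: "integral (cbox a b) (\<lambda>x. f (x + t *\<^sub>R h)) = integral K f" if "t \<in> {-1..1}" for t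
  proof -
    have "((f \<circ> (+) (t *\<^sub>R h)) has_integral integral K f) (cbox a b)"
      using int [OF that] has_integral_shift_cbox_iff by blast
    then show ?thesis by (simp add: o_def add.commute integral_unique)
  qed
  have diff: "f differentiable (at x)" for x using C1_on_differentiable [OF f] by simp
  have fr: "continuous_on UNIV (\<lambda>x. frechet_derivative f (at x) h)"
    by (rule C1_on_frechet [OF f])
  have D1: "((\<lambda>t. integral (cbox a b) (\<lambda>x. f (x + t *\<^sub>R h))) has_real_derivative
      integral (cbox a b) (\<lambda>x. frechet_derivative f (at (x + 0 *\<^sub>R h)) h)) (at 0)"
  proof (rule integral_has_derivative_compact [where W = UNIV and f' = "\<lambda>t x. frechet_derivative f (at (x + t *\<^sub>R h)) h"])
    show "((\<lambda>t. f (x + t *\<^sub>R h)) has_real_derivative frechet_derivative f (at (x + t *\<^sub>R h)) h) (at t)" for x t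
      by (rule frechet_derivative_line [OF diff])
    have "continuous_on UNIV (\<lambda>(t, x). x + t *\<^sub>R h)"
      by (auto intro!: continuous_intros simp: case_prod_unfold)
    from continuous_on_compose2 [OF fr this] continuous_on_compose2 [OF cont this]
    show "continuous_on UNIV (\<lambda>(t, x). frechet_derivative f (at (x + t *\<^sub>R h)) h)"
      "continuous_on UNIV (\<lambda>(t, x). f (x + t *\<^sub>R h))"
      by (simp_all add: case_prod_unfold)
  qed auto
  have D0: "((\<lambda>t. integral (cbox a b) (\<lambda>x. f (x + t *\<^sub>R h))) has_real_derivative 0) (at 0)"
  proof (rule has_field_derivative_transform_within_open [where f = "\<lambda>t. integral K f" and S = "{-1<..<1}"])
    show "integral K f = integral (cbox a b) (\<lambda>x. f (x + t *\<^sub>R h))" if "t \<in> {-1<..<1}" for t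
      using const [of t] that by simp
  qed auto
  have zero_int: "integral (cbox a b) (\<lambda>x. frechet_derivative f (at x) h) = 0"
    using DERIV_unique [OF D1 D0] by simp
  \<comment> \<open>The complement of \<open>K\<close> is open, so \<open>f\<close> vanishes near
    such a point; the integral over the box therefore reduces to that over \<open>K\<close>.\<close>
  have "frechet_derivative f (at x) h = 0" if "x \<notin> K" for x
  proof -
    have "(f has_derivative (\<lambda>h. 0)) (at x)"
    proof (rule has_derivative_transform_within_open)
      show "((\<lambda>x. 0) has_derivative (\<lambda>h. 0)) (at x)" by simp
      show "open (- K)" using K by (simp add: compact_imp_closed open_Compl)
    qed (use that zero in auto)
    from fun_cong [OF frechet_derivative_at [OF this], of h] show ?thesis by simp
  qed
  moreover have "K \<subseteq> cbox a b" using Kab [of 0] by simp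
  ultimately have "((\<lambda>x. frechet_derivative f (at x) h) has_integral
      integral K (\<lambda>x. frechet_derivative f (at x) h)) (cbox a b)"
    by (intro has_integral_on_superset [OF integrable_integral [OF integrable_on_compact [OF K]]]
        continuous_on_subset [OF fr]) auto
  with zero_int show ?thesis by (simp add: integral_unique)
qed

lemma C1_on_Un:
  assumes "C1_on f S" "C1_on f T" "open S" "open T"
  shows "C1_on f (S \<union> T)"
proof (rule C1_onI [where f' = "\<lambda>x. frechet_derivative f (at x)"])
  show "(f has_derivative frechet_derivative f (at x)) (at x)" if "x \<in> S \<union> T" for x
    using that assms C1_on_differentiable by (intro frechet_derivative_works [THEN iffD1]) blast
  show "continuous_on (S \<union> T) (\<lambda>x. frechet_derivative f (at x) h)" for h
    using assms by (intro continuous_on_open_Un C1_on_frechet)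
qed

text \<open>The product extended by zero is differentiable on all of space, because \<open>X\<close>
  and the complement of the support of \<phi> are open and together cover it. The integral of its
  derivative is zero, and the product rule splits it.\<close>

lemma integration_by_parts_compact:
  fixes f \<phi> :: "'a::euclidean_space \<Rightarrow> real"
  assumes X: "open X" and K: "compact K" "K \<subseteq> X" and f: "C1_on f X" and \<phi>: "C1_on \<phi> UNIV"
    and supp: "closure {x. \<phi> x \<noteq> 0} \<subseteq> K"
  shows "integral K (\<lambda>x. f x * frechet_derivative \<phi> (at x) h) =
    - integral K (\<lambda>x. frechet_derivative f (at x) h * \<phi> x)"
proof -
  define u where "u = (\<lambda>x. if x \<in> X then f x * \<phi> x else 0)"
  define V where "V = - closure {x. \<phi> x \<noteq> 0}"
  have V: "open V" "\<And>x. x \<in> V \<Longrightarrow> \<phi> x = 0"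
    using closure_subset [of "{x. \<phi> x \<noteq> 0}"] by (auto simp: V_def)
  have f\<phi>: "C1_on (\<lambda>x. f x * \<phi> x) X"
    by (intro C1_intros f C1_on_subset [OF \<phi>]) auto
  have "C1_on u X" by (rule C1_on_cong [OF f\<phi> X]) (simp add: u_def)
  moreover have "C1_on u V"
    by (rule C1_on_cong [OF C1_on_const [of 0] V(1)]) (simp add: u_def V)
  ultimately have "C1_on u (X \<union> V)" using X V by (intro C1_on_Un)
  moreover have "X \<union> V = UNIV" using supp K by (auto simp: V_def)
  ultimately have u: "C1_on u UNIV" by simp
  have "u x = 0" if "x \<notin> K" for x
    using that V(2) [of x] supp by (auto simp: u_def V_def)
  from integral_derivative_eq_0 [OF u K(1) this, of h]
  have "integral K (\<lambda>x. frechet_derivative u (at x) h) = 0" .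
  also have "integral K (\<lambda>x. frechet_derivative u (at x) h) =
    integral K (\<lambda>x. f x * frechet_derivative \<phi> (at x) h + frechet_derivative f (at x) h * \<phi> x)"
  proof (rule integral_cong)
    fix x assume "x \<in> K"
    then have x: "x \<in> X" using K by auto
    have D: "f differentiable (at x)" "\<phi> differentiable (at x)"
      using C1_on_differentiable [OF f x] C1_on_differentiable [OF \<phi>, of x] by auto
    have "((\<lambda>x. f x * \<phi> x) has_derivative
        (\<lambda>h. f x * frechet_derivative \<phi> (at x) h + frechet_derivative f (at x) h * \<phi> x)) (at x)"
      by (intro has_derivative_mult frechet_derivative_works [THEN iffD1] D)
    then have "(u has_derivative
        (\<lambda>h. f x * frechet_derivative \<phi> (at x) h + frechet_derivative f (at x) h * \<phi> x)) (at x)"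
      by (rule has_derivative_transform_within_open [OF _ X x]) (simp add: u_def)
    from fun_cong [OF frechet_derivative_at [OF this]]
    show "frechet_derivative u (at x) h =
        f x * frechet_derivative \<phi> (at x) h + frechet_derivative f (at x) h * \<phi> x"
      by (rule sym)
  qed
  also have "\<dots> = integral K (\<lambda>x. f x * frechet_derivative \<phi> (at x) h)
      + integral K (\<lambda>x. frechet_derivative f (at x) h * \<phi> x)"
  proof (rule Henstock_Kurzweil_Integration.integral_add; rule integrable_on_compact [OF K(1)])
    note c = continuous_on_subset [OF C1_on_continuous [OF f] K(2)]
      continuous_on_subset [OF C1_on_frechet [OF f, of h] K(2)]
      continuous_on_subset [OF C1_on_continuous [OF \<phi>] subset_UNIV, of K]
      continuous_on_subset [OF C1_on_frechet [OF \<phi>, of h] subset_UNIV, of K]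
    show "continuous_on K (\<lambda>x. f x * frechet_derivative \<phi> (at x) h)"
      "continuous_on K (\<lambda>x. frechet_derivative f (at x) h * \<phi> x)"
      by (intro continuous_on_mult c)+
  qed
  finally show ?thesis by linarith
qed

text \<open>Two applications of the mean value theorem, first to the difference in direction
  \<open>w\<close> as a function along \<open>u\<close>, then to the derivative along
  \<open>w\<close>.\<close>

lemma second_difference:
  fixes f :: "'a::euclidean_space \<Rightarrow> real"
  assumes h: "h > 0" and box: "\<And>s t. 0 \<le> s \<Longrightarrow> s \<le> h \<Longrightarrow> 0 \<le> t \<Longrightarrow> t \<le> h \<Longrightarrow> x + s *\<^sub>R u + t *\<^sub>R w \<in> X"
    and f: "\<And>y. y \<in> X \<Longrightarrow> f differentiable (at y)"
    and f': "\<And>y. y \<in> X \<Longrightarrow> (\<lambda>y. frechet_derivative f (at y) u) differentiable (at y)"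
  obtains s t where "0 < s" "s < h" "0 < t" "t < h"
    "f (x + h *\<^sub>R u + h *\<^sub>R w) - f (x + h *\<^sub>R u) - f (x + h *\<^sub>R w) + f x =
      h * h * frechet_derivative (\<lambda>y. frechet_derivative f (at y) u) (at (x + s *\<^sub>R u + t *\<^sub>R w)) w"
proof -
  define fu where "fu = (\<lambda>y. frechet_derivative f (at y) u)"
  define \<phi> where "\<phi> = (\<lambda>s. f ((x + h *\<^sub>R w) + s *\<^sub>R u) - f (x + s *\<^sub>R u))"
  have "\<exists>s>0. s < h \<and> \<phi> h - \<phi> 0 = (h - 0) * (fu ((x + h *\<^sub>R w) + s *\<^sub>R u) - fu (x + s *\<^sub>R u))"
    unfolding fu_def \<phi>_def
  proof (rule MVT2 [OF h], rule DERIV_diff; rule frechet_derivative_line [OF f])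
    fix s assume "0 \<le> s" "s \<le> h"
    then show "x + h *\<^sub>R w + s *\<^sub>R u \<in> X" "x + s *\<^sub>R u \<in> X"
      using box [of s h] box [of s 0] h by (simp_all add: algebra_simps)
  qed
  then obtain s where s: "0 < s" "s < h"
    "\<phi> h - \<phi> 0 = h * (fu ((x + s *\<^sub>R u) + h *\<^sub>R w) - fu (x + s *\<^sub>R u))"
    by (auto simp: algebra_simps)
  define \<psi> where "\<psi> = (\<lambda>t. fu ((x + s *\<^sub>R u) + t *\<^sub>R w))"
  have "\<exists>t>0. t < h \<and> \<psi> h - \<psi> 0 = (h - 0) * frechet_derivative fu (at ((x + s *\<^sub>R u) + t *\<^sub>R w)) w"
    unfolding \<psi>_def fu_def
  proof (rule MVT2 [OF h], rule frechet_derivative_line [OF f'])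
    fix t assume "0 \<le> t" "t \<le> h"
    then show "x + s *\<^sub>R u + t *\<^sub>R w \<in> X" using box [of s t] s by simp
  qed
  then obtain t where t: "0 < t" "t < h"
    "fu ((x + s *\<^sub>R u) + h *\<^sub>R w) - fu (x + s *\<^sub>R u) = h * frechet_derivative fu (at (x + s *\<^sub>R u + t *\<^sub>R w)) w"
    by (auto simp: \<psi>_def)
  have "f (x + h *\<^sub>R u + h *\<^sub>R w) - f (x + h *\<^sub>R u) - f (x + h *\<^sub>R w) + f x = \<phi> h - \<phi> 0"
    by (simp add: \<phi>_def algebra_simps)
  then show thesis using that [OF s(1,2) t(1,2)] s(3) t(3) by (simp add: fu_def)
qed

text \<open>The second difference is symmetric in \<open>u\<close> and \<open>w\<close>, so
  \<open>second_difference\<close> gives both mixed derivatives the same value at two nearby points;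
  their continuity excludes different values at \<open>x\<close>.\<close>

lemma symmetric_second_derivative:
  fixes f :: "'a::euclidean_space \<Rightarrow> real"
  assumes X: "open X" "x \<in> X" and f: "Ck_on 2 f X" and uw: "u \<in> Basis" "w \<in> Basis"
  shows "frechet_derivative (\<lambda>y. frechet_derivative f (at y) u) (at x) w =
    frechet_derivative (\<lambda>y. frechet_derivative f (at y) w) (at x) u" (is "?a x = ?b x")
proof (rule ccontr)
  assume ne: "?a x \<noteq> ?b x"
  note C1 = Ck_on_2_imp_C1_on [OF f]
  have cont: "isCont ?a x" "isCont ?b x"
    using C1_on_frechet [OF C1(2) [OF uw(1)], of w] C1_on_frechet [OF C1(2) [OF uw(2)], of u] X
    by (simp_all add: continuous_on_eq_continuous_at)
  define e where "e = \<bar>?a x - ?b x\<bar> / 2"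
  have e: "e > 0" using ne by (simp add: e_def)
  obtain d1 where d1: "d1 > 0" "\<And>y. dist y x < d1 \<Longrightarrow> dist (?a y) (?a x) < e"
    using cont(1) e unfolding continuous_at_eps_delta by blast
  obtain d2 where d2: "d2 > 0" "\<And>y. dist y x < d2 \<Longrightarrow> dist (?b y) (?b x) < e"
    using cont(2) e unfolding continuous_at_eps_delta by blast
  obtain d3 where d3: "d3 > 0" "\<And>y. dist y x < d3 \<Longrightarrow> y \<in> X"
    using X unfolding open_dist by blast
  \<comment> \<open>Basis vectors have length one, so the parallelogram lies within
    \<open>2 * h\<close> of \<open>x\<close> and hence in all three balls.\<close>
  define h where "h = min d1 (min d2 d3) / 3"
  have h: "h > 0" "2 * h < d1" "2 * h < d2" "2 * h < d3" using d1 d2 d3 by (auto simp: h_def)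
  have near: "dist (x + s *\<^sub>R u + t *\<^sub>R w) x \<le> 2 * h" if "0 \<le> s" "s \<le> h" "0 \<le> t" "t \<le> h" for s t
  proof -
    have "dist (x + s *\<^sub>R u + t *\<^sub>R w) x = norm (s *\<^sub>R u + t *\<^sub>R w)" by (simp add: dist_norm)
    also have "\<dots> \<le> norm (s *\<^sub>R u) + norm (t *\<^sub>R w)" by (rule norm_triangle_ineq)
    also have "\<dots> \<le> 2 * h" using that uw by simp
    finally show ?thesis .
  qed
  define \<Delta> where "\<Delta> = f (x + h *\<^sub>R u + h *\<^sub>R w) - f (x + h *\<^sub>R u) - f (x + h *\<^sub>R w) + f x"
  obtain s t where st: "0 < s" "s < h" "0 < t" "t < h" "\<Delta> = h * h * ?a (x + s *\<^sub>R u + t *\<^sub>R w)"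
    unfolding \<Delta>_def
  proof (rule second_difference [where X = X and f = f and u = u and w = w and x = x and h = h])
    show "x + s *\<^sub>R u + t *\<^sub>R w \<in> X" if "0 \<le> s" "s \<le> h" "0 \<le> t" "t \<le> h" for s t
      using near [OF that] h d3(2) by fastforce
  qed (use h C1_on_differentiable [OF C1(1)] C1_on_differentiable [OF C1(2) [OF uw(1)]] in auto)
  obtain s' t' where st': "0 < s'" "s' < h" "0 < t'" "t' < h" "\<Delta> = h * h * ?b (x + t' *\<^sub>R u + s' *\<^sub>R w)"
  proof (rule second_difference [where X = X and f = f and u = w and w = u and x = x and h = h])
    show "x + s *\<^sub>R w + t *\<^sub>R u \<in> X" if "0 \<le> s" "s \<le> h" "0 \<le> t" "t \<le> h" for s t
      using near [OF that(3,4,1,2)] h d3(2) by (fastforce simp: algebra_simps)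
  qed (use h C1_on_differentiable [OF C1(1)] C1_on_differentiable [OF C1(2) [OF uw(2)]] that in
      \<open>auto simp: \<Delta>_def algebra_simps\<close>)
  have eq: "?b (x + t' *\<^sub>R u + s' *\<^sub>R w) = ?a (x + s *\<^sub>R u + t *\<^sub>R w)"
    using st(5) st'(5) h(1) by simp
  have "dist (?a x) (?a (x + s *\<^sub>R u + t *\<^sub>R w)) < e"
    using near [of s t] st h by (subst dist_commute, intro d1(2)) linarith
  moreover have "dist (?b x) (?a (x + s *\<^sub>R u + t *\<^sub>R w)) < e"
    unfolding eq [symmetric]
    using near [of t' s'] st' h by (subst dist_commute, intro d2(2)) linarith
  ultimately have "dist (?a x) (?b x) < e + e" by (rule dist_triangle_less_add)
  then show False by (simp add: dist_real_def e_def)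
qed

text \<open>Regularity is obtained in two stages: on the open set where \<open>u\<close> is timelike
  the normalisation is smooth and the invariants are continuous, so the preimage of \<open>U\<close>
  is again open and \<open>p\<close> is positive on it.\<close>

lemma open_dual_domain:
  fixes Z :: "'a::euclidean_space set" and u :: "'a \<Rightarrow> real^6"
  assumes Z: "open Z" and g_lorentzian: "\<And>z. z \<in> Z \<Longrightarrow> lorentzian (g z)"
    and g: "\<And>i j. C1_on (\<lambda>z. g z $ i $ j) Z" and F: "\<And>i j k. C1_on (\<lambda>z. F z $ i $ j $ k) Z"
    and u: "\<And>i. C1_on (\<lambda>z. u z $ i) Z"
    and U: "open U" "\<And>s p. (s, p) \<in> U \<Longrightarrow> p > 0" "Ck_on 2 (\<lambda>(s, p). H s p) U"
  defines "W \<equiv> {z \<in> Z. timelike (g z) (u z) \<and>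
    (s_inv (g z) (F z) (unitv (g z) (u z)), p_inv (g z) (F z) (unitv (g z) (u z))) \<in> U}"
  shows "C1_dual_fields W g F (\<lambda>z. unitv (g z) (u z)) H U"
    and "C1_on (\<lambda>z. len (g z) (u z)) W"
proof -
  interpret Z: C1_fields Z g F u
    using Z g_lorentzian g F u by unfold_locales
  have uu: "C1_on (\<lambda>z. u z \<bullet> raise1 (g z) (u z)) Z"
    unfolding inner_vec_def by simp (intro C1_intros u)
  define Y where "Y = {z \<in> Z. timelike (g z) (u z)}"
  have "Y = Z \<inter> (\<lambda>z. u z \<bullet> raise1 (g z) (u z)) -` {..<0}"
    by (auto simp: Y_def timelike_def)
  then have Y: "open Y"
    using continuous_open_preimage [OF C1_on_continuous [OF uu] Z open_lessThan] by simp
  have YZ: "Y \<subseteq> Z" by (auto simp: Y_def)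
  note sub = C1_on_subset [OF _ YZ]
  have len: "C1_on (\<lambda>z. len (g z) (u z)) Y"
    unfolding len_def by (intro C1_on_sqrt C1_on_minus sub [OF uu]) (simp add: Y_def timelike_def)
  have unitv: "C1_on (\<lambda>z. unitv (g z) (u z) $ i) Y" for i
    unfolding unitv_def by simp (intro C1_intros sub u len, use len_pos in \<open>force simp: Y_def\<close>)
  interpret Y: C1_fields Y g F "\<lambda>z. unitv (g z) (u z)"
    using Y YZ g_lorentzian by unfold_locales (auto intro: sub g F unitv)
  have "continuous_on Y (\<lambda>z. (s_inv (g z) (F z) (unitv (g z) (u z)), p_inv (g z) (F z) (unitv (g z) (u z))))"
    unfolding p_inv_def
    by (intro continuous_on_Pair continuous_on_real_sqrt C1_on_continuous Y.s_inv Y.p_inv_sq)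
  moreover have "W = Y \<inter> (\<lambda>z. (s_inv (g z) (F z) (unitv (g z) (u z)),
      p_inv (g z) (F z) (unitv (g z) (u z)))) -` U"
    by (auto simp: W_def Y_def)
  ultimately have W: "open W"
    using continuous_open_preimage [OF _ Y U(1)] by simp
  have WY: "W \<subseteq> Y" by (auto simp: W_def Y_def)
  then have WZ: "W \<subseteq> Z" using YZ by blast
  show "C1_dual_fields W g F (\<lambda>z. unitv (g z) (u z)) H U"
    using W WZ WY g_lorentzian U
    by unfold_locales (auto intro: C1_on_subset [OF g] C1_on_subset [OF F] C1_on_subset [OF unitv] simp: W_def)
  show "C1_on (\<lambda>z. len (g z) (u z)) W" by (rule C1_on_subset [OF len WY])
qed

section \<open>Partial derivatives and contractions in components\<close>

lemma axis_Basis: "axis \<mu> 1 \<in> (Basis :: (real^6) set)"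
  by (simp add: axis_in_Basis_iff)

lemma C1_on_partial_deriv: "Ck_on 2 f X \<Longrightarrow> C1_on (partial_deriv \<mu> f) X"
  using Ck_on_2_imp_C1_on(2) [OF _ axis_Basis] by (simp add: partial_deriv_def [abs_def])

lemma partial_deriv_eqI:
  assumes "(f has_derivative f') (at x)"
  shows "partial_deriv \<mu> f x = f' (axis \<mu> 1)"
  using fun_cong [OF frechet_derivative_at [OF assms], of "axis \<mu> 1"] by (simp add: partial_deriv_def)

lemma partial_deriv_cong:
  assumes "open X" "x \<in> X" "\<And>y. y \<in> X \<Longrightarrow> f y = h y" "f differentiable (at x)"
  shows "partial_deriv \<mu> h x = partial_deriv \<mu> f x"
proof -
  have D: "(f has_derivative frechet_derivative f (at x)) (at x)"
    using assms(4) by (rule frechet_derivative_works [THEN iffD1])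
  from has_derivative_transform_within_open [OF D assms(1,2,3)]
  have "(h has_derivative frechet_derivative f (at x)) (at x)" .
  from partial_deriv_eqI [OF this] show ?thesis by (simp add: partial_deriv_def)
qed

lemma partial_deriv_add:
  "f differentiable (at x) \<Longrightarrow> h differentiable (at x) \<Longrightarrow>
    partial_deriv \<mu> (\<lambda>x. f x + h x) x = partial_deriv \<mu> f x + partial_deriv \<mu> h x"
  by (subst partial_deriv_eqI [OF has_derivative_add [OF frechet_derivative_works [THEN iffD1]
        frechet_derivative_works [THEN iffD1]]]) (auto simp: partial_deriv_def)

lemma partial_deriv_mult:
  "f differentiable (at x) \<Longrightarrow> h differentiable (at x) \<Longrightarrow>
    partial_deriv \<mu> (\<lambda>x. f x * h x) x = f x * partial_deriv \<mu> h x + partial_deriv \<mu> f x * h x"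
  by (subst partial_deriv_eqI [OF has_derivative_mult [OF frechet_derivative_works [THEN iffD1]
        frechet_derivative_works [THEN iffD1]]]) (auto simp: partial_deriv_def)

lemma partial_deriv_cmult:
  "f differentiable (at x) \<Longrightarrow> partial_deriv \<mu> (\<lambda>x. c * f x) x = c * partial_deriv \<mu> f x"
  by (subst partial_deriv_eqI [OF has_derivative_mult_right [OF frechet_derivative_works [THEN iffD1]]])
    (auto simp: partial_deriv_def)

lemma partial_deriv_sum5:
  assumes "\<And>i j l m n. f i j l m n differentiable (at x)"
  shows "partial_deriv k (\<lambda>x. c * (\<Sum>i\<in>I. \<Sum>j\<in>I. \<Sum>l\<in>I. \<Sum>m\<in>I. \<Sum>n\<in>I. f i j l m n x)) x =
    c * (\<Sum>i\<in>I. \<Sum>j\<in>I. \<Sum>l\<in>I. \<Sum>m\<in>I. \<Sum>n\<in>I. partial_deriv k (f i j l m n) x)"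
proof -
  have "((\<lambda>x. c * (\<Sum>i\<in>I. \<Sum>j\<in>I. \<Sum>l\<in>I. \<Sum>m\<in>I. \<Sum>n\<in>I. f i j l m n x)) has_derivative
      (\<lambda>h. c * (\<Sum>i\<in>I. \<Sum>j\<in>I. \<Sum>l\<in>I. \<Sum>m\<in>I. \<Sum>n\<in>I. frechet_derivative (f i j l m n) (at x) h))) (at x)"
    by (intro has_derivative_mult_right has_derivative_sum frechet_derivative_works [THEN iffD1] assms)
  from partial_deriv_eqI [OF this] show ?thesis by (simp add: partial_deriv_def)
qed

lemma omega_tensor_axis:
  "omega (tensor X (axis \<rho> 1)) (tensor Y v) =
    (\<Sum>i\<in>UNIV. \<Sum>j\<in>UNIV. \<Sum>l\<in>UNIV. \<Sum>m\<in>UNIV. \<Sum>n\<in>UNIV.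
      eps i j \<rho> l m n * X $ i $ j * Y $ l $ m * v $ n)"
proof -
  have "(\<Sum>k\<in>UNIV. \<Sum>l\<in>UNIV. \<Sum>m\<in>UNIV. \<Sum>n\<in>UNIV. eps i j k l m n * X $ i $ j * axis \<rho> 1 $ k * Y $ l $ m * v $ n)
    = (\<Sum>k\<in>UNIV. if k = \<rho> then \<Sum>l\<in>UNIV. \<Sum>m\<in>UNIV. \<Sum>n\<in>UNIV. eps i j k l m n * X $ i $ j * Y $ l $ m * v $ n else 0)"
    for i j
    by (intro sum.cong refl) (auto simp: axis_def)
  then show ?thesis by (simp add: omega_tensor)
qed

lemma omega_tensor_components:
  "omega (tensor X k) T = (\<Sum>\<rho>\<in>UNIV. k $ \<rho> * omega (tensor X (axis \<rho> 1)) T)"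
proof -
  have k: "k = (\<Sum>\<rho>\<in>UNIV. k $ \<rho> *\<^sub>R axis \<rho> 1)"
    using basis_expansion [of k] by (simp add: scalar_mult_eq_scaleR)
  have lin: "linear (\<lambda>k. omega (tensor X k) T)"
    using linear_compose [OF linear_tensor(2), of "\<lambda>S. omega S T"] bilinear_omega
    by (simp add: bilinear_def o_def)
  show ?thesis
    by (subst k) (simp add: linear_sum [OF lin] linear_scale [OF lin])
qed

lemma eps_swap_25: "eps i j n l m k = - eps i j k l m n"
proof -
  have "eps i j n l m k = - eps i j l n m k" by (rule eps_swap)
  also have "\<dots> = eps i j l m n k" by (simp add: eps_swap(4) [of i j l m])
  also have "\<dots> = - eps i j l m k n" by (rule eps_swap)
  also have "\<dots> = eps i j l k m n" by (simp add: eps_swap(4) [of i j l k])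
  also have "\<dots> = - eps i j k l m n" by (rule eps_swap)
  finally show ?thesis .
qed

text \<open>Exchanging the indices \<open>k\<close> and \<open>n\<close> changes the sign of
  \<open>eps\<close> but not of \<open>S\<close>. With symmetric second derivatives this removes the
  second derivatives of \<open>a\<close>.\<close>

lemma sum_eps_symmetric:
  assumes sym: "\<And>k n. S k n = S n k"
  shows "(\<Sum>i\<in>UNIV. \<Sum>j\<in>UNIV. \<Sum>k\<in>UNIV. \<Sum>l\<in>UNIV. \<Sum>m\<in>UNIV. \<Sum>n\<in>UNIV.
    eps i j k l m n * (T i j l m * S k n)) = 0" (is "?L = 0")
proof -
  have "?L = (\<Sum>i\<in>UNIV. \<Sum>j\<in>UNIV. \<Sum>k\<in>UNIV. \<Sum>l\<in>UNIV. \<Sum>m\<in>UNIV. \<Sum>n\<in>UNIV.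
    eps i j n l m k * (T i j l m * S n k))"
    unfolding sum.cartesian_product
    by (rule sum.reindex_bij_witness [where i = "\<lambda>(i, j, k, l, m, n). (i, j, n, l, m, k)"
          and j = "\<lambda>(i, j, k, l, m, n). (i, j, n, l, m, k)"]) auto
  also have "\<dots> = - ?L"
  proof -
    have "eps i j n l m k * (T i j l m * S n k) = - (eps i j k l m n * (T i j l m * S k n))" for i j k l m n
      by (simp add: eps_swap_25 [of i j n l m k] sym [of n k])
    then have "(\<Sum>i\<in>UNIV. \<Sum>j\<in>UNIV. \<Sum>k\<in>UNIV. \<Sum>l\<in>UNIV. \<Sum>m\<in>UNIV. \<Sum>n\<in>UNIV.
        eps i j n l m k * (T i j l m * S n k)) =
      (\<Sum>i\<in>UNIV. \<Sum>j\<in>UNIV. \<Sum>k\<in>UNIV. \<Sum>l\<in>UNIV. \<Sum>m\<in>UNIV. \<Sum>n\<in>UNIV.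
        - (eps i j k l m n * (T i j l m * S k n)))"
      by (intro sum.cong refl)
    then show ?thesis by (simp only: sum_negf)
  qed
  finally show ?thesis by simp
qed

section \<open>The functional derivative of the action with respect to the scalar field\<close>

locale pst =
  fixes X :: "(real^6) set" and g A :: "real^6 \<Rightarrow> real^6^6" and a :: "real^6 \<Rightarrow> real"
    and H :: "real \<Rightarrow> real \<Rightarrow> real" and U :: "(real \<times> real) set"
  assumes X: "open X"
    and g_C2: "\<And>i j. Ck_on 2 (\<lambda>x. g x $ i $ j) X"
    and g_lorentzian: "\<And>x. x \<in> X \<Longrightarrow> lorentzian (g x)"
    and A_C2: "\<And>i j. Ck_on 2 (\<lambda>x. A x $ i $ j) X"
    and A_antisym: "\<And>x i j. x \<in> X \<Longrightarrow> A x $ i $ j = - (A x $ j $ i)"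
    and a_C2: "Ck_on 2 a X"
    and a_timelike: "\<And>x. x \<in> X \<Longrightarrow> gradient a x \<bullet> raise1 (g x) (gradient a x) < 0"
    and U: "open U"
    and U_pos: "\<And>s p. (s, p) \<in> U \<Longrightarrow> p > 0"
    and H_C2: "Ck_on 2 (\<lambda>(s, p). H s p) U"
    and pst_condition: "\<And>s p. (s, p) \<in> U \<Longrightarrow>
      (H_s H s p)\<^sup>2 + 2 * s / p * H_s H s p * H_p H s p + (H_p H s p)\<^sup>2 = 1"
    and domain: "\<And>x. x \<in> X \<Longrightarrow>
      (s_inv (g x) (field_strength A x) (aux_vector g a x),
       p_inv (g x) (field_strength A x) (aux_vector g a x)) \<in> U"
begin

abbreviation "F \<equiv> field_strength A"

lemma aux_vector_eq: "aux_vector g b x = unitv (g x) (gradient b x)"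
  by (simp add: aux_vector_def aux_norm_def unitv_def len_def)

lemma aux_norm_eq: "aux_norm g b x = len (g x) (gradient b x)"
  by (simp add: aux_norm_def len_def)

lemma timelike_gradient: "x \<in> X \<Longrightarrow> timelike (g x) (gradient a x)"
  using a_timelike by (simp add: timelike_def)

lemma duality_defect_eq: "duality_defect H g A a x = defect H (g x) (F x) (aux_vector g a x)"
  by (simp add: duality_defect_def defect_def)

lemma g_C1: "C1_on (\<lambda>x. g x $ i $ j) X"
  by (rule Ck_on_2_imp_C1_on(1) [OF g_C2])

lemma F_C1: "C1_on (\<lambda>x. F x $ i $ j $ k) X"
  unfolding field_strength_def by simp (intro C1_on_add C1_on_partial_deriv A_C2)

lemma gradient_C1: "Ck_on 2 b Y \<Longrightarrow> C1_on (\<lambda>x. gradient b x $ i) Y"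
  unfolding gradient_def by (simp add: C1_on_partial_deriv)

lemma alternating_F:
  assumes x: "x \<in> X"
  shows "alternating (F x)"
proof -
  have D: "(\<lambda>y. A y $ i $ j) differentiable (at x)" for i j
    using C1_on_differentiable [OF Ck_on_2_imp_C1_on(1) [OF A_C2] x] .
  have anti: "partial_deriv \<mu> (\<lambda>y. A y $ i $ j) x = - partial_deriv \<mu> (\<lambda>y. A y $ j $ i) x" for \<mu> i j
  proof -
    have "partial_deriv \<mu> (\<lambda>y. A y $ i $ j) x = partial_deriv \<mu> (\<lambda>y. - 1 * A y $ j $ i) x"
    proof (rule partial_deriv_cong [OF X x])
      show "- 1 * A y $ j $ i = A y $ i $ j" if "y \<in> X" for y
        using A_antisym [OF that, of i j] by linarith
    qed (intro derivative_intros D)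
    then show ?thesis using partial_deriv_cmult [OF D, of \<mu> "- 1"] by simp
  qed
  show ?thesis
    unfolding alternating_def
  proof (intro allI conjI)
    fix i j k
    show "F x $ j $ i $ k = - (F x $ i $ j $ k)"
      using anti [of j i k] anti [of i k j] anti [of k j i]
      by (simp add: field_strength_def)
    show "F x $ i $ k $ j = - (F x $ i $ j $ k)"
      using anti [of i k j] anti [of k j i] anti [of j i k]
      by (simp add: field_strength_def)
  qed
qed

definition \<Delta> :: "real^6 \<Rightarrow> real^6^6" where "\<Delta> x = duality_defect H g A a x"

definition N :: "real^6 \<Rightarrow> real" where "N x = aux_norm g a x"

text \<open>The coefficient of \<open>partial_deriv \<rho> \<phi>\<close> in the first variation,
  with the density factor of the action cancelled against the root in
  \<open>variation_of_aux_vector\<close>.\<close>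

definition flux :: "6 \<Rightarrow> real^6 \<Rightarrow> real" where
  "flux \<rho> x = - 1 / (8 * N x) * omega (tensor (\<Delta> x) (axis \<rho> 1)) (tensor (\<Delta> x) (aux_vector g a x))"

definition D :: "real^6 \<Rightarrow> real" where
  "D x = - (\<Sum>\<rho>\<in>UNIV. partial_deriv \<rho> (flux \<rho>) x)"

lemma on_X: "C1_dual_fields X g F (aux_vector g a) H U" and N_C1: "C1_on N X"
proof -
  have "X = {z \<in> X. timelike (g z) (gradient a z) \<and>
      (s_inv (g z) (F z) (unitv (g z) (gradient a z)), p_inv (g z) (F z) (unitv (g z) (gradient a z))) \<in> U}"
    using timelike_gradient domain by (auto simp: aux_vector_eq)
  then show "C1_dual_fields X g F (aux_vector g a) H U" "C1_on N X"
    using open_dual_domain [OF X g_lorentzian g_C1 F_C1 gradient_C1 [OF a_C2] U U_pos H_C2]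
    by (simp_all add: aux_vector_eq [abs_def] N_def [abs_def] aux_norm_eq)
qed

lemma N_pos: "x \<in> X \<Longrightarrow> N x > 0"
  by (simp add: N_def aux_norm_eq len_pos timelike_gradient)

lemma \<Delta>_C1: "C1_on (\<lambda>x. \<Delta> x $ i $ j) X"
  using C1_dual_fields.defect [OF on_X] by (simp add: \<Delta>_def duality_defect_eq)

lemma v_C1: "C1_on (\<lambda>x. aux_vector g a x $ i) X"
  using on_X by (simp add: C1_dual_fields_def C1_fields_def)

lemma flux_C1: "C1_on (flux \<rho>) X"
proof -
  have "C1_on (\<lambda>x. - 1 / (8 * N x) * omega (tensor (\<Delta> x) (axis \<rho> 1)) (tensor (\<Delta> x) (aux_vector g a x))) X"
    unfolding omega_tensor
    by (intro C1_intros N_C1 \<Delta>_C1 v_C1) (use N_pos in force)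
  then show ?thesis by (simp add: flux_def [abs_def])
qed

lemma continuous_on_D: "continuous_on X D"
  unfolding D_def partial_deriv_def
  by (intro continuous_intros C1_on_frechet flux_C1)

text \<open>Since the auxiliary vector is the gradient of \<open>a\<close> over \<open>N\<close>,
  with \<Psi> equal to \<Delta> over \<open>N\<close> the flux is \<open>- 1 / 8\<close> times
  \<open>eps\<close> contracted with \<Psi>, \<Psi> and the gradient. In the divergence the two
  terms that differentiate \<Psi> agree by exchange of index pairs and the second derivatives of
  \<open>a\<close> cancel. This leaves twice \<open>1 / 8\<close>, while \<open>a_variation\<close>
  reduces to \<open>N\<close> times the same sum.\<close>

lemma D_eq:
  assumes x: "x \<in> X"
  shows "D x = (1 / 4) / N x * a_variation H g A a x"
proof -
  define \<Psi> where "\<Psi> = (\<lambda>i j x. \<Delta> x $ i $ j / N x)"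
  define b where "b = (\<lambda>i x. partial_deriv i a x)"
  have v: "aux_vector g a y $ i = b i y / N y" for i y
    by (simp add: aux_vector_def N_def b_def gradient_def)
  have \<Psi>: "C1_on (\<Psi> i j) X" for i j
    unfolding \<Psi>_def by (intro C1_intros \<Delta>_C1 N_C1) (use N_pos in force)
  have b: "C1_on (b i) X" for i
    unfolding b_def using C1_on_partial_deriv [OF a_C2] .
  note d\<Psi> = C1_on_differentiable [OF \<Psi> x] and db = C1_on_differentiable [OF b x]
  have sym: "partial_deriv k (b n) x = partial_deriv n (b k) x" for k n
    using symmetric_second_derivative [OF X x a_C2 axis_Basis axis_Basis, of n k]
    by (simp add: partial_deriv_def b_def)
  define S1 S2 where
    "S1 = (\<Sum>i\<in>UNIV. \<Sum>j\<in>UNIV. \<Sum>k\<in>UNIV. \<Sum>l\<in>UNIV. \<Sum>m\<in>UNIV. \<Sum>n\<in>UNIV.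
      eps i j k l m n * (partial_deriv k (\<Psi> i j) x * \<Psi> l m x * b n x))" and
    "S2 = (\<Sum>i\<in>UNIV. \<Sum>j\<in>UNIV. \<Sum>k\<in>UNIV. \<Sum>l\<in>UNIV. \<Sum>m\<in>UNIV. \<Sum>n\<in>UNIV.
      eps i j k l m n * (\<Psi> i j x * partial_deriv k (\<Psi> l m) x * b n x))"
  have S3: "(\<Sum>i\<in>UNIV. \<Sum>j\<in>UNIV. \<Sum>k\<in>UNIV. \<Sum>l\<in>UNIV. \<Sum>m\<in>UNIV. \<Sum>n\<in>UNIV.
      eps i j k l m n * (\<Psi> i j x * \<Psi> l m x * partial_deriv k (b n) x)) = 0"
    by (rule sum_eps_symmetric) (rule sym)
  have S12: "S1 = S2"
    unfolding S1_def S2_def by (subst sum_swap_pairs) (simp add: eps_swap_pairs mult_ac)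
  have "partial_deriv k (flux k) x = - 1 / 8 * (\<Sum>i\<in>UNIV. \<Sum>j\<in>UNIV. \<Sum>l\<in>UNIV. \<Sum>m\<in>UNIV. \<Sum>n\<in>UNIV.
      eps i j k l m n * (partial_deriv k (\<Psi> i j) x * \<Psi> l m x * b n x) +
      eps i j k l m n * (\<Psi> i j x * partial_deriv k (\<Psi> l m) x * b n x) +
      eps i j k l m n * (\<Psi> i j x * \<Psi> l m x * partial_deriv k (b n) x))" for k
  proof -
    have "partial_deriv k (flux k) x = partial_deriv k (\<lambda>x. - 1 / 8 * (\<Sum>i\<in>UNIV. \<Sum>j\<in>UNIV. \<Sum>l\<in>UNIV. \<Sum>m\<in>UNIV. \<Sum>n\<in>UNIV.
        eps i j k l m n * (\<Psi> i j x * \<Psi> l m x * b n x))) x"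
    proof (rule partial_deriv_cong [OF X x])
      fix y assume "y \<in> X"
      then have "N y \<noteq> 0" using N_pos by force
      then show "- 1 / 8 * (\<Sum>i\<in>UNIV. \<Sum>j\<in>UNIV. \<Sum>l\<in>UNIV. \<Sum>m\<in>UNIV. \<Sum>n\<in>UNIV.
        eps i j k l m n * (\<Psi> i j y * \<Psi> l m y * b n y)) = flux k y"
        unfolding flux_def omega_tensor_axis
        by (simp add: \<Psi>_def v sum_distrib_left mult_ac)
    qed (rule C1_on_differentiable [OF _ x], intro C1_intros \<Psi> b)
    also have "\<dots> = - 1 / 8 * (\<Sum>i\<in>UNIV. \<Sum>j\<in>UNIV. \<Sum>l\<in>UNIV. \<Sum>m\<in>UNIV. \<Sum>n\<in>UNIV.
        eps i j k l m n * (\<Psi> i j x * \<Psi> l m x * partial_deriv k (b n) x +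
          (\<Psi> i j x * partial_deriv k (\<Psi> l m) x + partial_deriv k (\<Psi> i j) x * \<Psi> l m x) * b n x))"
    proof (subst partial_deriv_sum5)
      show "(\<lambda>x. eps i j k l m n * (\<Psi> i j x * \<Psi> l m x * b n x)) differentiable (at x)" for i j l m n
        by (intro derivative_intros d\<Psi> db)
      have "partial_deriv k (\<lambda>x. eps i j k l m n * (\<Psi> i j x * \<Psi> l m x * b n x)) x =
          eps i j k l m n * (\<Psi> i j x * \<Psi> l m x * partial_deriv k (b n) x +
          (\<Psi> i j x * partial_deriv k (\<Psi> l m) x + partial_deriv k (\<Psi> i j) x * \<Psi> l m x) * b n x)" for i j l m n
      proof -
        have "partial_deriv k (\<lambda>x. eps i j k l m n * (\<Psi> i j x * \<Psi> l m x * b n x)) x =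
            eps i j k l m n * partial_deriv k (\<lambda>x. \<Psi> i j x * \<Psi> l m x * b n x) x"
          by (intro partial_deriv_cmult derivative_intros d\<Psi> db)
        also have "partial_deriv k (\<lambda>x. \<Psi> i j x * \<Psi> l m x * b n x) x =
            \<Psi> i j x * \<Psi> l m x * partial_deriv k (b n) x + partial_deriv k (\<lambda>x. \<Psi> i j x * \<Psi> l m x) x * b n x"
          by (intro partial_deriv_mult derivative_intros d\<Psi> db)
        also have "partial_deriv k (\<lambda>x. \<Psi> i j x * \<Psi> l m x) x =
            \<Psi> i j x * partial_deriv k (\<Psi> l m) x + partial_deriv k (\<Psi> i j) x * \<Psi> l m x"
          by (intro partial_deriv_mult d\<Psi>)
        finally show ?thesis .
      qed
      then show "- 1 / 8 * (\<Sum>i\<in>UNIV. \<Sum>j\<in>UNIV. \<Sum>l\<in>UNIV. \<Sum>m\<in>UNIV. \<Sum>n\<in>UNIV.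
          partial_deriv k (\<lambda>x. eps i j k l m n * (\<Psi> i j x * \<Psi> l m x * b n x)) x) =
        - 1 / 8 * (\<Sum>i\<in>UNIV. \<Sum>j\<in>UNIV. \<Sum>l\<in>UNIV. \<Sum>m\<in>UNIV. \<Sum>n\<in>UNIV.
          eps i j k l m n * (\<Psi> i j x * \<Psi> l m x * partial_deriv k (b n) x +
          (\<Psi> i j x * partial_deriv k (\<Psi> l m) x + partial_deriv k (\<Psi> i j) x * \<Psi> l m x) * b n x))"
        by simp
    qed
    finally show ?thesis by (simp add: algebra_simps)
  qed
  then have "D x = 1 / 8 * (\<Sum>k\<in>UNIV. \<Sum>i\<in>UNIV. \<Sum>j\<in>UNIV. \<Sum>l\<in>UNIV. \<Sum>m\<in>UNIV. \<Sum>n\<in>UNIV.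
      eps i j k l m n * (partial_deriv k (\<Psi> i j) x * \<Psi> l m x * b n x) +
      eps i j k l m n * (\<Psi> i j x * partial_deriv k (\<Psi> l m) x * b n x) +
      eps i j k l m n * (\<Psi> i j x * \<Psi> l m x * partial_deriv k (b n) x))"
    by (simp add: D_def sum_distrib_left sum_negf)
  also have "\<dots> = 1 / 8 * (\<Sum>i\<in>UNIV. \<Sum>j\<in>UNIV. \<Sum>k\<in>UNIV. \<Sum>l\<in>UNIV. \<Sum>m\<in>UNIV. \<Sum>n\<in>UNIV.
      eps i j k l m n * (partial_deriv k (\<Psi> i j) x * \<Psi> l m x * b n x) +
      eps i j k l m n * (\<Psi> i j x * partial_deriv k (\<Psi> l m) x * b n x) +
      eps i j k l m n * (\<Psi> i j x * \<Psi> l m x * partial_deriv k (b n) x))"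
    by (subst sum.swap, rule arg_cong [where f = "\<lambda>y. 1 / 8 * y"], rule sum.cong [OF refl], rule sum.swap)
  also have "\<dots> = 1 / 8 * (S1 + S2)"
    unfolding sum.distrib S3 by (simp add: S1_def S2_def)
  finally have D: "D x = S2 / 4" by (simp add: S12)
  have "a_variation H g A a x = (\<Sum>i\<in>UNIV. \<Sum>j\<in>UNIV. \<Sum>k\<in>UNIV. \<Sum>l\<in>UNIV. \<Sum>m\<in>UNIV. \<Sum>n\<in>UNIV.
      N x * (eps i j k l m n * (\<Psi> i j x * partial_deriv k (\<Psi> l m) x * b n x)) +
      N x * (eps i j k l m n * (\<Psi> i j x * \<Psi> l m x * partial_deriv k (b n) x)))"
    unfolding a_variation_def
  proof (intro sum.cong refl)
    fix i j k l m n
    have "partial_deriv k (\<lambda>y. duality_defect H g A a y $ l $ m * aux_vector g a y $ n) x =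
        partial_deriv k (\<lambda>y. \<Psi> l m y * b n y) x"
    proof (rule partial_deriv_cong [OF X x])
      show "\<Psi> l m y * b n y = duality_defect H g A a y $ l $ m * aux_vector g a y $ n" if "y \<in> X" for y
        by (simp add: \<Psi>_def v \<Delta>_def)
    qed (intro derivative_intros d\<Psi> db)
    also have "\<dots> = \<Psi> l m x * partial_deriv k (b n) x + partial_deriv k (\<Psi> l m) x * b n x"
      by (rule partial_deriv_mult [OF d\<Psi> db])
    finally have *: "partial_deriv k (\<lambda>y. duality_defect H g A a y $ l $ m * aux_vector g a y $ n) x =
        \<Psi> l m x * partial_deriv k (b n) x + partial_deriv k (\<Psi> l m) x * b n x" .
    have "duality_defect H g A a x $ i $ j = N x * \<Psi> i j x"
      using N_pos [OF x] by (simp add: \<Psi>_def \<Delta>_def)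
    then show "eps i j k l m n * duality_defect H g A a x $ i $ j *
          partial_deriv k (\<lambda>y. duality_defect H g A a y $ l $ m * aux_vector g a y $ n) x =
        N x * (eps i j k l m n * (\<Psi> i j x * partial_deriv k (\<Psi> l m) x * b n x)) +
        N x * (eps i j k l m n * (\<Psi> i j x * \<Psi> l m x * partial_deriv k (b n) x))"
      unfolding * by (simp add: algebra_simps)
  qed
  also have "\<dots> = N x * S2"
    unfolding sum.distrib sum_distrib_left [symmetric] S3 by (simp add: S2_def)
  finally show ?thesis using N_pos [OF x] by (simp add: D)
qed

lemma has_functional_derivative_D: "has_functional_derivative X (pst_action H g A) a D"
  unfolding has_functional_derivative_def
proof (intro conjI continuous_on_D allI impI)
  fix K \<phi>
  assume "compact K \<and> K \<subseteq> X \<and> Ck_on 2 \<phi> UNIV \<and> closure {x. \<phi> x \<noteq> 0} \<subseteq> K"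
  then have K: "compact K" "K \<subseteq> X" and \<phi>: "Ck_on 2 \<phi> UNIV" and supp: "closure {x. \<phi> x \<noteq> 0} \<subseteq> K"
    by blast+
  define u where "u = (\<lambda>z. gradient a (snd z) + fst z *\<^sub>R gradient \<phi> (snd z))"
  define Z where "Z = (UNIV :: real set) \<times> X"
  define v where "v = (\<lambda>z. unitv (g (snd z)) (u z))"
  \<comment> \<open>The open set of pairs \<open>(t, x)\<close> for which the deformed gradient is
    timelike and the invariants lie in \<open>U\<close>; it contains
    \<open>{0} \<times> K\<close>.\<close>
  define W where "W = {z \<in> Z. timelike (g (snd z)) (u z) \<and>
    (s_inv (g (snd z)) (F (snd z)) (unitv (g (snd z)) (u z)),
     p_inv (g (snd z)) (F (snd z)) (unitv (g (snd z)) (u z))) \<in> U}"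
  have Z: "open Z" using X by (simp add: Z_def open_Times)
  have snd: "C1_on (\<lambda>z. f (snd z)) Z" if "C1_on f X" for f :: "real^6 \<Rightarrow> real"
    by (rule C1_on_compose_linear [OF that bounded_linear_snd]) (auto simp: Z_def)
  have grad_\<phi>: "C1_on (\<lambda>z. gradient \<phi> (snd z) $ i) Z" for i
    by (rule snd, rule C1_on_subset [OF gradient_C1 [OF \<phi>] subset_UNIV])
  have u: "C1_on (\<lambda>z. u z $ i) Z" for i
    unfolding u_def by simp
      (intro C1_intros snd gradient_C1 [OF a_C2] grad_\<phi> C1_on_linear bounded_linear_fst)
  have lor: "lorentzian (g (snd z))" if "z \<in> Z" for z
    using that g_lorentzian by (auto simp: Z_def)
  note dom = open_dual_domain [OF Z lor snd [OF g_C1] snd [OF F_C1] u U U_pos H_C2, folded W_def v_def]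
  interpret W: C1_dual_fields W "\<lambda>z. g (snd z)" "\<lambda>z. F (snd z)" v H U
    by (rule dom)
  have WZ: "W \<subseteq> Z" by (auto simp: W_def)
  define f where "f = (\<lambda>t x. sqrt (- det (g x)) * pst_lagrangian H (g x) (F x) (v (t, x)))"
  define f' where "f' = (\<lambda>t x. - 1 / (8 * len (g x) (u (t, x))) *
    omega (tensor (defect H (g x) (F x) (v (t, x))) (gradient \<phi> x)) (tensor (defect H (g x) (F x) (v (t, x))) (v (t, x))))"
  have K0: "{0} \<times> K \<subseteq> W"
    using K timelike_gradient domain by (auto simp: W_def Z_def u_def aux_vector_eq)
  have "((\<lambda>t. integral K (f t)) has_real_derivative integral K (f' 0)) (at 0)"
  proof (rule integral_has_derivative_compact [OF K(1) W.S K0])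
    fix t x assume tx: "(t, x) \<in> W"
    then have x: "x \<in> X" and tl: "timelike (g x) (u (t, x))"
      and inU: "(s_inv (g x) (F x) (v (t, x)), p_inv (g x) (F x) (v (t, x))) \<in> U"
      by (auto simp: W_def Z_def v_def)
    \<comment> \<open>The variation formula concerns parameter \<open>0\<close>; based at
      \<open>u (t, x)\<close> and shifted, it gives the derivative at every
      \<open>t\<close>.\<close>
    have "((\<lambda>s. pst_lagrangian H (g x) (F x) (unitv (g x) (u (t, x) + s *\<^sub>R gradient \<phi> x))) has_real_derivative
      - 1 / (8 * sqrt (- det (g x)) * len (g x) (u (t, x))) *
      omega (tensor (defect H (g x) (F x) (unitv (g x) (u (t, x)))) (gradient \<phi> x))
        (tensor (defect H (g x) (F x) (unitv (g x) (u (t, x)))) (unitv (g x) (u (t, x))))) (at 0)"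
      using inU U_pos W.H_differentiable pst_condition
      by (intro variation_of_aux_vector g_lorentzian alternating_F x tl) (auto simp: v_def)
    moreover have "u (t, x) + s *\<^sub>R gradient \<phi> x = u (s + t, x)" for s
      by (simp add: u_def algebra_simps)
    ultimately have "((\<lambda>s. pst_lagrangian H (g x) (F x) (v (s, x))) has_real_derivative
      - 1 / (8 * sqrt (- det (g x)) * len (g x) (u (t, x))) *
      omega (tensor (defect H (g x) (F x) (v (t, x))) (gradient \<phi> x))
        (tensor (defect H (g x) (F x) (v (t, x))) (v (t, x)))) (at (0 + t))"
      by (simp only: DERIV_shift) (simp add: v_def)
    from DERIV_cmult [OF this, of "sqrt (- det (g x))"]
    show "((\<lambda>t. f t x) has_real_derivative f' t x) (at t)"
      using lorentzian_det [OF g_lorentzian [OF x]] by (simp add: f_def f'_def)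
  next
    have len_nz: "8 * len (g (snd z)) (u z) \<noteq> 0" if "z \<in> W" for z
      using len_pos [of "g (snd z)" "u z"] that by (auto simp: W_def)
    have "C1_on (\<lambda>z. - 1 / (8 * len (g (snd z)) (u z)) *
      omega (tensor (defect H (g (snd z)) (F (snd z)) (v z)) (gradient \<phi> (snd z)))
        (tensor (defect H (g (snd z)) (F (snd z)) (v z)) (v z))) W"
      unfolding omega_tensor
      by (intro C1_intros dom(2) W.defect W.v C1_on_subset [OF grad_\<phi> WZ] len_nz)
    then show "continuous_on W (\<lambda>(t, x). f' t x)"
      using C1_on_continuous by (simp add: f'_def case_prod_unfold)
    have "C1_on (\<lambda>z. sqrt (- det (g (snd z))) * pst_lagrangian H (g (snd z)) (F (snd z)) (v z)) W"
      by (intro C1_on_mult W.sqrt_det W.lagrangian)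
    then show "continuous_on W (\<lambda>(t, x). f t x)"
      using C1_on_continuous by (simp add: f_def case_prod_unfold)
  qed
  moreover have "pst_action H g A K (\<lambda>x. a x + t * \<phi> x) = integral K (f t)" for t
    unfolding pst_action_def
  proof (rule integral_cong)
    fix x assume "x \<in> K"
    then have x: "x \<in> X" using K by auto
    have da: "a differentiable (at x)" "\<phi> differentiable (at x)"
      using C1_on_differentiable [OF Ck_on_2_imp_C1_on(1) [OF a_C2] x]
        C1_on_differentiable [OF Ck_on_2_imp_C1_on(1) [OF \<phi>], of x] by auto
    have "gradient (\<lambda>x. a x + t * \<phi> x) x = u (t, x)"
      using da by (simp add: gradient_def u_def vec_eq_iff partial_deriv_add partial_deriv_cmult derivative_intros)
    then show "sqrt (- det (g x)) * pst_lagrangian H (g x) (F x) (aux_vector g (\<lambda>x. a x + t * \<phi> x) x) = f t x"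
      by (simp add: f_def v_def aux_vector_eq)
  qed
  moreover have "integral K (f' 0) = integral K (\<lambda>x. D x * \<phi> x)"
  proof -
    have \<phi>1: "C1_on \<phi> UNIV" using \<phi> by (rule Ck_on_2_imp_C1_on)
    have int: "(\<lambda>x. flux \<rho> x * partial_deriv \<rho> \<phi> x) integrable_on K"
      "(\<lambda>x. partial_deriv \<rho> (flux \<rho>) x * \<phi> x) integrable_on K" for \<rho>
      unfolding partial_deriv_def
      by (intro integrable_on_compact K continuous_on_mult
          continuous_on_subset [OF C1_on_continuous [OF flux_C1] K(2)]
          continuous_on_subset [OF C1_on_frechet [OF flux_C1] K(2)]
          continuous_on_subset [OF C1_on_continuous [OF \<phi>1] subset_UNIV]
          continuous_on_subset [OF C1_on_frechet [OF \<phi>1] subset_UNIV])+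
    \<comment> \<open>Linearity in the gradient of \<phi> isolates its components, so that
      integration by parts applies to each.\<close>
    have f0: "f' 0 x = (\<Sum>\<rho>\<in>UNIV. flux \<rho> x * partial_deriv \<rho> \<phi> x)" for x
      unfolding f'_def
      by (subst omega_tensor_components)
        (simp add: flux_def \<Delta>_def duality_defect_eq N_def aux_norm_eq aux_vector_eq v_def u_def
          gradient_def sum_distrib_left mult_ac)
    have "integral K (f' 0) = (\<Sum>\<rho>\<in>UNIV. integral K (\<lambda>x. flux \<rho> x * partial_deriv \<rho> \<phi> x))"
      unfolding f0 [abs_def] by (rule integral_sum) (auto intro: int)
    also have "\<dots> = (\<Sum>\<rho>\<in>UNIV. - integral K (\<lambda>x. partial_deriv \<rho> (flux \<rho>) x * \<phi> x))"
      unfolding partial_deriv_def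
      by (intro sum.cong refl integration_by_parts_compact [OF X K flux_C1 \<phi>1 supp])
    also have "\<dots> = - integral K (\<lambda>x. \<Sum>\<rho>\<in>UNIV. partial_deriv \<rho> (flux \<rho>) x * \<phi> x)"
      by (subst integral_sum) (auto intro: int simp: sum_negf)
    also have "\<dots> = integral K (\<lambda>x. D x * \<phi> x)"
      by (simp add: D_def sum_distrib_right flip: integral_neg)
    finally show ?thesis .
  qed
  ultimately show "((\<lambda>t. pst_action H g A K (\<lambda>x. a x + t * \<phi> x)) has_real_derivative
      integral K (\<lambda>x. D x * \<phi> x)) (at 0)"
    by simp
qed

lemma D_eq_0:
  assumes "x \<in> X" "self_dual H (g x) (F x) (aux_vector g a x)"
  shows "D x = 0"
proof -
  have "duality_defect H g A a x = 0"
    using assms(2) by (simp add: duality_defect_eq self_dual_iff_defect)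
  then show ?thesis by (simp add: D_eq [OF assms(1)] a_variation_def)
qed

end

section \<open>Independence of the auxiliary vector\<close>

lemma finite_uniform_bound:
  fixes P :: "'i::finite \<Rightarrow> real \<Rightarrow> bool"
  assumes ex: "\<And>i. \<exists>L. P i L" and mono: "\<And>i L L'. P i L \<Longrightarrow> L \<le> L' \<Longrightarrow> P i L'"
  shows "\<exists>L\<ge>0. \<forall>i. P i L"
proof -
  obtain L where L: "\<And>i. P i (L i)" using ex by metis
  define M where "M = (\<Sum>i\<in>UNIV. \<bar>L i\<bar>)"
  have "L i \<le> M" for i
    using member_le_sum [of i UNIV "\<lambda>i. \<bar>L i\<bar>"] by (simp add: M_def)
  then have "\<forall>i. P i M" using L mono by blast
  moreover have "M \<ge> 0" by (simp add: M_def sum_nonneg)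
  ultimately show ?thesis by blast
qed

lemma C1_on_bounded:
  assumes "C1_on f W" "compact C" "C \<subseteq> W"
  shows "\<exists>L. \<forall>z\<in>C. \<bar>f z\<bar> \<le> L"
proof -
  have "compact (f ` C)"
    using assms by (intro compact_continuous_image continuous_on_subset [OF C1_on_continuous])
  then show ?thesis using compact_imp_bounded by (fastforce simp: bounded_iff)
qed

text \<open>The operator norm of the derivative is bounded on a compact set through its values on
  the basis, and convexity keeps the segments of the mean value inequality inside.\<close>

lemma C1_on_Lipschitz:
  assumes f: "C1_on f W" and C: "compact C" "convex C" "C \<subseteq> W"
  shows "\<exists>L. \<forall>y\<in>C. \<forall>z\<in>C. \<bar>f y - f z\<bar> \<le> L * norm (y - z)"
proof -
  obtain f' where f': "\<And>x. x \<in> W \<Longrightarrow> (f has_derivative f' x) (at x)" "\<And>h. continuous_on W (\<lambda>x. f' x h)"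
    using f by (rule C1_onE) blast
  have "\<exists>L. \<forall>z\<in>C. \<bar>f' z b\<bar> \<le> L" for b
  proof -
    have "compact ((\<lambda>z. f' z b) ` C)"
      using C by (intro compact_continuous_image continuous_on_subset [OF f'(2)])
    then show ?thesis using compact_imp_bounded by (fastforce simp: bounded_iff)
  qed
  then obtain L where L: "\<And>b z. z \<in> C \<Longrightarrow> \<bar>f' z b\<bar> \<le> L b" by metis
  define M where "M = (\<Sum>b\<in>Basis. L b)"
  have onorm: "onorm (f' z) \<le> M" if z: "z \<in> C" for z
  proof (rule onorm_le)
    fix h
    interpret linear "f' z" using f'(1) z C by (meson has_derivative_linear subsetD)
    have "\<bar>f' z h\<bar> = \<bar>\<Sum>b\<in>Basis. (h \<bullet> b) * f' z b\<bar>"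
      by (subst euclidean_representation [symmetric, of h]) (simp add: sum scale)
    also have "\<dots> \<le> (\<Sum>b\<in>Basis. \<bar>(h \<bullet> b) * f' z b\<bar>)" by (rule sum_abs)
    also have "\<dots> \<le> (\<Sum>b\<in>Basis. norm h * L b)"
      unfolding abs_mult by (intro sum_mono mult_mono L [OF z] Basis_le_norm) auto
    finally show "norm (f' z h) \<le> M * norm h"
      by (simp add: M_def sum_distrib_left mult.commute)
  qed
  have "norm (f y - f z) \<le> M * norm (y - z)" if "y \<in> C" "z \<in> C" for y z
    using C f'(1) that onorm
    by (intro differentiable_bound [OF C(2), of f f']) (auto intro: has_derivative_at_withinI)
  then show ?thesis by auto
qed

lemma abs_eps_le: "\<bar>eps i j k l m n\<bar> \<le> 1"
  by (simp add: eps_eq eps_fun_def sign_def)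

text \<open>There are \<open>6 ^ 6\<close> summands, each a difference of products of two entries.
  If \<epsilon> is of order \<open>h\<close>, division by \<open>h\<close> leaves in the limit a
  bound linear in \<open>M\<close>, the size of \<open>X\<close>; this is what
  \<open>locally_self_dual\<close> lives on.\<close>

lemma omega_tensor_difference_bound:
  assumes c: "\<And>n. \<bar>c * v $ n\<bar> \<le> V" and k: "norm k \<le> \<kappa>"
    and X: "\<And>i j. \<bar>X $ i $ j\<bar> \<le> M" and Y: "\<And>i j. \<bar>Y $ i $ j - X $ i $ j\<bar> \<le> \<epsilon>"
  shows "\<bar>c * omega (tensor Y k) (tensor Y v) - c * omega (tensor X k) (tensor X v)\<bar>
    \<le> 6 ^ 6 * (\<kappa> * V * (\<epsilon> * (2 * M + \<epsilon>)))"
proof -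
  have pos: "M \<ge> 0" "\<epsilon> \<ge> 0" "V \<ge> 0" "\<kappa> \<ge> 0"
    using X [of 0 0] Y [of 0 0] c [of 0] k abs_ge_zero norm_ge_zero order_trans by blast+
  have summand: "\<bar>eps i j a l m n * (k $ a * (c * v $ n) * (Y $ i $ j * Y $ l $ m - X $ i $ j * X $ l $ m))\<bar>
      \<le> \<kappa> * V * (\<epsilon> * (2 * M + \<epsilon>))" for i j a l m n
  proof -
    have "Y $ i $ j * Y $ l $ m - X $ i $ j * X $ l $ m =
        (Y $ i $ j - X $ i $ j) * (X $ l $ m + (Y $ l $ m - X $ l $ m)) + X $ i $ j * (Y $ l $ m - X $ l $ m)"
      by (simp add: algebra_simps)
    also have "\<bar>\<dots>\<bar> \<le> \<epsilon> * (M + \<epsilon>) + M * \<epsilon>"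
    proof (intro order_trans [OF abs_triangle_ineq] add_mono)
      have "\<bar>X $ l $ m + (Y $ l $ m - X $ l $ m)\<bar> \<le> M + \<epsilon>"
        using X [of l m] Y [of l m] by linarith
      then show "\<bar>(Y $ i $ j - X $ i $ j) * (X $ l $ m + (Y $ l $ m - X $ l $ m))\<bar> \<le> \<epsilon> * (M + \<epsilon>)"
        unfolding abs_mult by (intro mult_mono Y pos abs_ge_zero)
      show "\<bar>X $ i $ j * (Y $ l $ m - X $ l $ m)\<bar> \<le> M * \<epsilon>"
        unfolding abs_mult by (intro mult_mono X Y pos abs_ge_zero)
    qed
    finally have d: "\<bar>Y $ i $ j * Y $ l $ m - X $ i $ j * X $ l $ m\<bar> \<le> \<epsilon> * (2 * M + \<epsilon>)"
      by (simp add: algebra_simps)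
    have ka: "\<bar>k $ a\<bar> \<le> \<kappa>" using component_le_norm_cart [of k a] k by simp
    have "\<bar>eps i j a l m n\<bar> * (\<bar>k $ a\<bar> * \<bar>c * v $ n\<bar> * \<bar>Y $ i $ j * Y $ l $ m - X $ i $ j * X $ l $ m\<bar>)
        \<le> 1 * (\<kappa> * V * (\<epsilon> * (2 * M + \<epsilon>)))"
      by (intro mult_mono abs_eps_le ka c d mult_nonneg_nonneg pos abs_ge_zero) (use pos in auto)
    then show ?thesis by (simp add: abs_mult)
  qed
  have "c * omega (tensor Y k) (tensor Y v) - c * omega (tensor X k) (tensor X v) =
    (\<Sum>i\<in>UNIV. \<Sum>j\<in>UNIV. \<Sum>a\<in>UNIV. \<Sum>l\<in>UNIV. \<Sum>m\<in>UNIV. \<Sum>n\<in>UNIV.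
      eps i j a l m n * (k $ a * (c * v $ n) * (Y $ i $ j * Y $ l $ m - X $ i $ j * X $ l $ m)))"
    by (simp add: omega_tensor sum_distrib_left algebra_simps sum_subtractf)
  also have "\<bar>\<dots>\<bar> \<le> (\<Sum>i\<in>(UNIV :: 6 set). \<Sum>j\<in>(UNIV :: 6 set). \<Sum>a\<in>(UNIV :: 6 set). \<Sum>l\<in>(UNIV :: 6 set).
      \<Sum>m\<in>(UNIV :: 6 set). \<Sum>n\<in>(UNIV :: 6 set). \<kappa> * V * (\<epsilon> * (2 * M + \<epsilon>)))"
    by (intro order_trans [OF sum_abs] sum_mono summand)
  also have "\<dots> = 6 ^ 6 * (\<kappa> * V * (\<epsilon> * (2 * M + \<epsilon>)))" by simp
  finally show ?thesis .
qed

text \<open>\<open>epsc\<close> sees only the antisymmetrisation \<Theta>, with weight one third, so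
  applying it twice yields \<open>- 36 / 3 = - 12\<close> times \<Theta>; contracting \<Theta> with
  \<open>n\<close> returns \<open>- X\<close>. A transverse two-form is thus recovered from its
  pairings with arbitrary forms.\<close>

lemma epsc_epsc_tensor:
  assumes X: "antisym X" "X *v n = 0" and v: "v \<bullet> n = - 1"
  shows "X $ i $ j = 1 / 12 * (\<Sum>k\<in>UNIV. epsc (epsc (tensor X v)) $ i $ j $ k * n $ k)"
proof -
  define \<Theta> where "\<Theta> = tensor X v - (\<chi> i j k. tensor X v $ i $ k $ j) + (\<chi> i j k. tensor X v $ j $ k $ i)"
  have \<Theta>_comp: "\<Theta> $ i $ j $ k = X $ i $ j * v $ k - X $ i $ k * v $ j + X $ j $ k * v $ i" for i j k
    by (simp add: \<Theta>_def tensor_def)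
  have alt: "alternating \<Theta>"
    unfolding alternating_def
  proof (intro allI conjI)
    fix i j k
    show "\<Theta> $ j $ i $ k = - (\<Theta> $ i $ j $ k)" "\<Theta> $ i $ k $ j = - (\<Theta> $ i $ j $ k)"
      unfolding \<Theta>_comp using antisymD [OF X(1), of j i] antisymD [OF X(1), of k j]
      by (simp_all add: algebra_simps)
  qed
  have cyc: "epsc (\<chi> i j k. tensor X v $ j $ k $ i) = epsc (tensor X v)"
    using epsc_permute(2) [of "\<chi> i j k. tensor X v $ i $ k $ j"] epsc_permute(1) [of "tensor X v"]
    by simp
  have "epsc \<Theta> = 3 *\<^sub>R epsc (tensor X v)"
    unfolding \<Theta>_def linear_add [OF linear_epsc] linear_diff [OF linear_epsc] cyc epsc_permute
    by (simp add: vec_eq_iff)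
  then have 36: "3 *\<^sub>R epsc (epsc (tensor X v)) = (- 36) *\<^sub>R \<Theta>"
    using epsc_epsc [OF alt] by (simp add: linear_scale [OF linear_epsc])
  have "3 * epsc (epsc (tensor X v)) $ i $ j $ k = - 36 * \<Theta> $ i $ j $ k" for k
    using arg_cong [OF 36, of "\<lambda>T. T $ i $ j $ k"] by simp
  then have "epsc (epsc (tensor X v)) $ i $ j $ k = - 12 * \<Theta> $ i $ j $ k" for k
    by (simp add: field_simps)
  then have "(\<Sum>k\<in>UNIV. epsc (epsc (tensor X v)) $ i $ j $ k * n $ k) = - 12 * (\<Sum>k\<in>UNIV. \<Theta> $ i $ j $ k * n $ k)"
    by (simp add: sum_distrib_left mult_ac)
  also have "(\<Sum>k\<in>UNIV. \<Theta> $ i $ j $ k * n $ k) = X $ i $ j * (v \<bullet> n) - v $ j * (X *v n) $ i + v $ i * (X *v n) $ j"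
    by (simp add: \<Theta>_comp inner_vec_def matrix_vector_mult_def sum_distrib_left algebra_simps
        sum.distrib sum_subtractf)
  finally show ?thesis by (simp add: X v)
qed

lemma omega_epsc: "omega S (epsc T) = T \<bullet> epsc (epsc S)"
proof -
  have "omega S (epsc T) = - (epsc T \<bullet> epsc S)" by (subst omega_commute) (simp add: omega_def)
  also have "epsc T \<bullet> epsc S = omega (epsc S) T" by (simp add: omega_def inner_commute)
  also have "\<dots> = - omega T (epsc S)" by (rule omega_commute)
  finally show ?thesis by (simp add: omega_def)
qed

section \<open>Propagation of self-duality over auxiliary vectors at a fixed point\<close>

locale pst_function =
  fixes H :: "real \<Rightarrow> real \<Rightarrow> real" and U :: "(real \<times> real) set" and G :: "real^6^6"
  assumes U: "open U" and U_pos: "\<And>s p. (s, p) \<in> U \<Longrightarrow> p > 0"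
    and H_C2: "Ck_on 2 (\<lambda>(s, p). H s p) U"
    and pst_condition: "\<And>s p. (s, p) \<in> U \<Longrightarrow>
      (H_s H s p)\<^sup>2 + 2 * s / p * H_s H s p * H_p H s p + (H_p H s p)\<^sup>2 = 1"
    and G: "lorentzian G"
begin

text \<open>Extends \<open>aux_vectors\<close> to covectors that are not normalised, because
  segments between unit covectors leave the unit hyperboloid.\<close>

definition admissible :: "real^6^6^6 \<Rightarrow> real^6 \<Rightarrow> bool" where
  "admissible F u \<longleftrightarrow> timelike G u \<and> (s_inv G F (unitv G u), p_inv G F (unitv G u)) \<in> U"

lemma H_differentiable: "(s, p) \<in> U \<Longrightarrow> (\<lambda>(s, p). H s p) differentiable (at (s, p))"
  using C1_on_differentiable [OF Ck_on_2_imp_C1_on(1) [OF H_C2]] by blast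

definition slope :: "real^6^6^6 \<Rightarrow> real^6 \<Rightarrow> real^6 \<Rightarrow> real" where
  "slope F u k = - 1 / (8 * sqrt (- det G) * len G u) *
     omega (tensor (defect H G F (unitv G u)) k) (tensor (defect H G F (unitv G u)) (unitv G u))"

lemma line_derivative:
  assumes "alternating F" "admissible F (x + t *\<^sub>R k)"
  shows "((\<lambda>t. pst_lagrangian H G F (unitv G (x + t *\<^sub>R k))) has_real_derivative slope F (x + t *\<^sub>R k) k) (at t)"
proof -
  have "((\<lambda>s. pst_lagrangian H G F (unitv G ((x + t *\<^sub>R k) + s *\<^sub>R k))) has_real_derivative
      slope F (x + t *\<^sub>R k) k) (at 0)"
    unfolding slope_def using assms U_pos H_differentiable pst_condition
    by (intro variation_of_aux_vector G) (auto simp: admissible_def)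
  moreover have "(x + t *\<^sub>R k) + s *\<^sub>R k = x + (s + t) *\<^sub>R k" for s by (simp add: algebra_simps)
  ultimately have "((\<lambda>s. pst_lagrangian H G F (unitv G (x + s *\<^sub>R k))) has_real_derivative
      slope F (x + t *\<^sub>R k) k) (at (0 + t))"
    by (simp only: DERIV_shift)
  then show ?thesis by simp
qed

text \<open>The derivative vanishes all along the segment, so this part of the field variation
  cancels in a mixed difference.\<close>

lemma cross_term_line:
  assumes F: "alternating F" "alternating F'" and tl: "\<And>t. 0 \<le> t \<Longrightarrow> t \<le> 1 \<Longrightarrow> timelike G (x + t *\<^sub>R k)"
  shows "cross_term G F F' (unitv G (x + k)) = cross_term G F F' (unitv G x)"
proof -
  have D: "((\<lambda>s. cross_term G F F' (unitv G (x + s *\<^sub>R k))) has_real_derivative 0) (at t)"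
    if "0 \<le> t" "t \<le> 1" for t
  proof -
    have "((\<lambda>s. cross_term G F F' (unitv G ((x + t *\<^sub>R k) + s *\<^sub>R k))) has_real_derivative 0) (at 0)"
      by (rule cross_term_stationary [OF G F tl [OF that]])
    moreover have "(x + t *\<^sub>R k) + s *\<^sub>R k = x + (s + t) *\<^sub>R k" for s by (simp add: algebra_simps)
    ultimately have "((\<lambda>s. cross_term G F F' (unitv G (x + s *\<^sub>R k))) has_real_derivative 0) (at (0 + t))"
      by (simp only: DERIV_shift)
    then show ?thesis by simp
  qed
  show ?thesis using MVT2 [OF zero_less_one D] by auto
qed

text \<open>
  On shell the \<open>F\<close>-derivative of the Lagrangian is a term independent of the auxiliary vector, and
  its \<open>u\<close>-derivative is quadratic in the duality defect. Comparing the mixed differences bounds the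
  change of the defect by its supremum times the radius of the neighbourhood, so it stays zero.
\<close>

lemma locally_self_dual:
  assumes F: "alternating F" and w0: "w0 \<in> aux_vectors U G F"
  obtains r where "r > 0"
    "\<And>x y. x \<in> aux_vectors U G F \<Longrightarrow> y \<in> aux_vectors U G F \<Longrightarrow> x \<in> ball w0 r \<Longrightarrow> y \<in> ball w0 r \<Longrightarrow>
      self_dual H G F x \<Longrightarrow> self_dual H G F y \<and> pst_lagrangian H G F y = pst_lagrangian H G F x"
proof -
  \<comment> \<open>\<open>epsc\<close> maps arbitrary perturbations to alternating ones.\<close>
  define \<F> where "\<F> = (\<lambda>T. F + epsc T)"
  have \<F>: "alternating (\<F> T)" for T
    unfolding alternating_def
  proof (intro allI conjI)
    fix i j k
    show "\<F> T $ j $ i $ k = - (\<F> T $ i $ j $ k)" "\<F> T $ i $ k $ j = - (\<F> T $ i $ j $ k)"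
      using alternatingD(1) [OF F, of j i k] alternatingD(1) [OF alternating_epsc, of T j i k]
        alternatingD(2) [OF F, of i k j] alternatingD(2) [OF alternating_epsc, of T i k j]
      by (simp_all add: \<F>_def)
  qed
  have \<F>0: "\<F> 0 = F" by (simp add: \<F>_def linear_0 [OF linear_epsc])
  \<comment> \<open>The perturbation of the field and the covector are joint variables, so one
    compact neighbourhood supplies all constants.\<close>
  define W where "W = {z \<in> (UNIV :: ((real^6^6^6) \<times> (real^6)) set). timelike G (snd z) \<and>
    (s_inv G (\<F> (fst z)) (unitv G (snd z)), p_inv G (\<F> (fst z)) (unitv G (snd z))) \<in> U}"
  have W_iff: "(T, u) \<in> W \<longleftrightarrow> admissible (\<F> T) u" for T u
    by (simp add: W_def admissible_def)
  have comp: "bounded_linear (\<lambda>z :: (real^6^6^6) \<times> (real^6). snd z $ i)" for i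
    by (intro bounded_linear_compose [OF bounded_linear_vec_nth bounded_linear_snd])
  have comp3: "bounded_linear (\<lambda>z :: (real^6^6^6) \<times> (real^6). epsc (fst z) $ i $ j $ k)" for i j k
    unfolding linear_conv_bounded_linear [symmetric]
    by (rule linearI) (simp_all add: linear_add [OF linear_epsc] linear_scale [OF linear_epsc])
  have \<F>_C1: "C1_on (\<lambda>z. \<F> (fst z) $ i $ j $ k) (UNIV :: ((real^6^6^6) \<times> (real^6)) set)" for i j k
    unfolding \<F>_def by simp (intro C1_on_add C1_on_const C1_on_linear comp3)
  note dom = open_dual_domain [OF open_UNIV G C1_on_const \<F>_C1 C1_on_linear [OF comp] U U_pos H_C2, folded W_def]
  interpret W: C1_dual_fields W "\<lambda>z. G" "\<lambda>z. \<F> (fst z)" "\<lambda>z. unitv G (snd z)" H U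
    by (rule dom)
  have w0_unit: "w0 \<bullet> raise1 G w0 = - 1" and w0W: "(0, w0) \<in> W"
    using w0 by (auto simp: aux_vectors_def W_iff admissible_def \<F>0 unitv_of_unit)
  obtain d where d: "d > 0" "ball (0, w0) d \<subseteq> W"
    using W.S w0W open_contains_ball by blast
  \<comment> \<open>Points of the product of two balls of radius \<open>d / 3\<close> have distance
    at most \<open>2 * d / 3\<close> from the centre.\<close>
  define r0 where "r0 = d / 3"
  have r0: "r0 > 0" using d by (simp add: r0_def)
  define C :: "((real^6^6^6) \<times> (real^6)) set" where "C = cball 0 r0 \<times> cball w0 r0"
  have C: "compact C" "convex C" by (auto simp: C_def intro: compact_Times convex_Times)
  have CW: "C \<subseteq> W"
  proof
    fix z assume "z \<in> C"
    then obtain T u where z: "z = (T, u)" "norm T \<le> r0" "dist w0 u \<le> r0" by (auto simp: C_def)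
    have "dist (0, w0) (T, u) \<le> dist 0 T + dist w0 u"
      by (simp add: dist_Pair_Pair sqrt_sum_squares_le_sum)
    also have "\<dots> < d" using z r0 by (simp add: r0_def)
    finally show "z \<in> W" using d(2) z(1) by (auto simp: mem_ball)
  qed
  define \<Delta> where "\<Delta> = (\<lambda>T u. defect H G (\<F> T) (unitv G u))"
  define n where "n = (\<lambda>u. raise1 G (unitv G u))"
  define c where "c = (\<lambda>u. - 1 / (8 * sqrt (- det G) * len G u))"
  have detG: "- det G > 0" using lorentzian_det [OF G] by simp
  have nz: "8 * sqrt (- det G) * len G (snd z) \<noteq> 0" if "z \<in> W" for z
    using detG len_pos [of G "snd z"] that by (auto simp: W_def)
  have "\<exists>L\<ge>0. \<forall>ij. \<forall>y\<in>C. \<forall>z\<in>C. \<bar>\<Delta> (fst y) (snd y) $ fst ij $ snd ij - \<Delta> (fst z) (snd z) $ fst ij $ snd ij\<bar>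
      \<le> L * norm (y - z)"
  proof (rule finite_uniform_bound)
    show "\<exists>L. \<forall>y\<in>C. \<forall>z\<in>C. \<bar>\<Delta> (fst y) (snd y) $ fst ij $ snd ij - \<Delta> (fst z) (snd z) $ fst ij $ snd ij\<bar>
      \<le> L * norm (y - z)" for ij
      unfolding \<Delta>_def by (rule C1_on_Lipschitz [OF W.defect C CW])
  next
    fix ij L L'
    assume L: "\<forall>y\<in>C. \<forall>z\<in>C. \<bar>\<Delta> (fst y) (snd y) $ fst ij $ snd ij - \<Delta> (fst z) (snd z) $ fst ij $ snd ij\<bar>
      \<le> L * norm (y - z)" and le: "L \<le> L'"
    show "\<forall>y\<in>C. \<forall>z\<in>C. \<bar>\<Delta> (fst y) (snd y) $ fst ij $ snd ij - \<Delta> (fst z) (snd z) $ fst ij $ snd ij\<bar>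
      \<le> L' * norm (y - z)"
      by (intro ballI order_trans [OF L [rule_format]] mult_right_mono le norm_ge_zero)
  qed
  then obtain L where L: "L \<ge> 0" "\<And>i j y z. y \<in> C \<Longrightarrow> z \<in> C \<Longrightarrow>
      \<bar>\<Delta> (fst y) (snd y) $ i $ j - \<Delta> (fst z) (snd z) $ i $ j\<bar> \<le> L * norm (y - z)"
    by (metis fst_conv snd_conv)
  have "\<exists>V\<ge>0. \<forall>i. \<forall>z\<in>C. \<bar>c (snd z) * unitv G (snd z) $ i\<bar> \<le> V"
  proof (rule finite_uniform_bound)
    show "\<exists>V. \<forall>z\<in>C. \<bar>c (snd z) * unitv G (snd z) $ i\<bar> \<le> V" for i
      unfolding c_def by (rule C1_on_bounded [OF _ C(1) CW]) (intro C1_intros W.v dom(2) nz)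
  qed (meson order_trans)
  then obtain V where V: "V \<ge> 0" "\<And>i. \<forall>z\<in>C. \<bar>c (snd z) * unitv G (snd z) $ i\<bar> \<le> V" by blast
  have "\<exists>B\<ge>0. \<forall>i. \<forall>z\<in>C. \<bar>n (snd z) $ i\<bar> \<le> B"
  proof (rule finite_uniform_bound)
    show "\<exists>V. \<forall>z\<in>C. \<bar>n (snd z) $ i\<bar> \<le> V" for i
      unfolding n_def by (rule C1_on_bounded [OF _ C(1) CW]) (intro W.raise1 W.v)
  qed (meson order_trans)
  then obtain B where B: "B \<ge> 0" "\<And>i. \<forall>z\<in>C. \<bar>n (snd z) $ i\<bar> \<le> B" by blast
  have slope: "slope (\<F> T) u k = c u * omega (tensor (\<Delta> T u) k) (tensor (\<Delta> T u) (unitv G u))" for T u k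
    by (simp add: slope_def c_def \<Delta>_def)
  \<comment> \<open>The losses of the argument below: 36 entries in the sum \<open>S\<close>, the
    \<open>1 / 12\<close> and six terms with factor \<open>B\<close> of
    \<open>epsc_epsc_tensor\<close>, \<open>12 * sqrt (- det G)\<close> from half the pairing in
    \<open>ip_magnetic\<close>, and the rest from \<open>omega_tensor_difference_bound\<close> with
    \<kappa> equal to \<open>2 * r\<close>.\<close>
  define Q where "Q = 36 * (1 / 12 * (6 * (12 * sqrt (- det G) * (6 ^ 6 * (2 * V * (L * 2))) * B)))"
  have Q: "Q \<ge> 0" using V L B detG by (simp add: Q_def)
  define r where "r = min r0 (1 / (Q + 1))"
  have r: "r > 0" "r \<le> r0" "Q * r < 1"
  proof -
    show "r > 0" "r \<le> r0" using r0 Q by (auto simp: r_def)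
    have "Q * r \<le> Q * (1 / (Q + 1))" using Q by (intro mult_left_mono) (auto simp: r_def)
    also have "\<dots> < 1" using Q by simp
    finally show "Q * r < 1" .
  qed
  have in_C: "(T, u) \<in> C" if "norm T \<le> r0" "u \<in> cball w0 r" for T u
    using that r by (auto simp: C_def)
  have adm: "admissible (\<F> T) u" if "norm T \<le> r0" "u \<in> cball w0 r" for T u
    using in_C [OF that] CW W_iff by blast
  have seg: "x + t *\<^sub>R (u - x) \<in> cball w0 r" if "x \<in> cball w0 r" "u \<in> cball w0 r" "0 \<le> t" "t \<le> 1" for x u t
  proof -
    have "(1 - t) *\<^sub>R x + t *\<^sub>R u \<in> cball w0 r"
      using that by (intro convexD [OF convex_cball]) auto
    then show ?thesis by (simp add: algebra_simps)
  qed
  have defect_0: "\<Delta> 0 u = 0" if x: "x \<in> cball w0 r" "\<Delta> 0 x = 0" and u: "u \<in> cball w0 r" for x u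
  proof -
    define S where "S = (\<lambda>u. \<Sum>i\<in>UNIV. \<Sum>j\<in>UNIV. \<bar>\<Delta> 0 u $ i $ j\<bar>)"
    have "continuous_on (cball w0 r) (\<lambda>u. \<Delta> 0 u $ i $ j)" for i j
    proof -
      have "continuous_on (cball w0 r) (\<lambda>u. (0 :: real^6^6^6, u))" by (intro continuous_intros)
      moreover have "(\<lambda>u. (0 :: real^6^6^6, u)) ` cball w0 r \<subseteq> W"
        using in_C [of 0] r0 CW by auto
      ultimately show ?thesis
        using continuous_on_compose2 [OF C1_on_continuous [OF W.defect [of i j]], of "cball w0 r" "\<lambda>u. (0, u)"]
        by (simp add: \<Delta>_def)
    qed
    then have "continuous_on (cball w0 r) S"
      unfolding S_def by (intro continuous_on_sum continuous_on_rabs)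
    \<comment> \<open>The defect, measured by \<open>S\<close>, is largest at \<open>m\<close>; the
      aim is to bound this maximum by \<open>Q * r\<close> times itself.\<close>
    then obtain m where m: "m \<in> cball w0 r" "\<And>u. u \<in> cball w0 r \<Longrightarrow> S u \<le> S m"
      using continuous_attains_sup [of "cball w0 r" S] r by fastforce
    define M where "M = S m"
    have entry: "\<bar>\<Delta> 0 u $ i $ j\<bar> \<le> S u" for u i j
    proof -
      have "\<bar>\<Delta> 0 u $ i $ j\<bar> \<le> (\<Sum>j\<in>UNIV. \<bar>\<Delta> 0 u $ i $ j\<bar>)"
        by (rule member_le_sum) auto
      also have "\<dots> \<le> S u"
        unfolding S_def by (rule member_le_sum [where f = "\<lambda>i. \<Sum>j\<in>UNIV. \<bar>\<Delta> 0 u $ i $ j\<bar>"]) (auto intro: sum_nonneg)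
      finally show ?thesis .
    qed
    have M: "\<bar>\<Delta> 0 u $ i $ j\<bar> \<le> M" if "u \<in> cball w0 r" for u i j
      using entry [of u i j] m(2) [OF that] by (simp add: M_def)
    have M0: "M \<ge> 0" unfolding M_def S_def by (intro sum_nonneg) auto
    define k where "k = m - x"
    have k: "norm k \<le> 2 * r"
    proof -
      have "norm k \<le> dist w0 m + dist w0 x"
        unfolding k_def using dist_triangle3 [of m x w0] by (simp add: dist_norm norm_minus_commute)
      then show ?thesis using m x by simp
    qed
    define K where "K = 6 ^ 6 * (2 * V * (L * 2))"
    have K: "K \<ge> 0" using V L by (simp add: K_def)
    have bound: "\<bar>ip G (\<Delta> 0 m) (magnetic G (epsc T) (unitv G m)) / 2\<bar> \<le> K * r * M"
      if T: "norm T = 1" for T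
    proof -
      define f where "f = (\<lambda>h u. pst_lagrangian H G (\<F> (h *\<^sub>R T)) (unitv G u))"
      have \<F>h: "\<F> (h *\<^sub>R T) = F + h *\<^sub>R epsc T" for h
        by (simp add: \<F>_def linear_scale [OF linear_epsc])
      \<comment> \<open>The mixed difference read along the segment from \<open>x\<close> to
        \<open>m\<close>: the slopes are quadratic in the defect, which the perturbation changes by
        at most \<open>L * h\<close> per entry.\<close>
      have est: "\<bar>(f h m - f 0 m) - (f h x - f 0 x)\<bar> \<le> 6 ^ 6 * (2 * r * V * (L * h * (2 * M + L * h)))"
        if h: "0 < h" "h \<le> r0" for h
      proof -
        define \<phi> where "\<phi> = (\<lambda>t. f h (x + t *\<^sub>R k) - f 0 (x + t *\<^sub>R k))"
        have D: "(\<phi> has_real_derivative slope (\<F> (h *\<^sub>R T)) (x + t *\<^sub>R k) k - slope (\<F> 0) (x + t *\<^sub>R k) k) (at t)"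
          if "0 \<le> t" "t \<le> 1" for t
        proof -
          have "x + t *\<^sub>R k \<in> cball w0 r" using seg [OF x(1) m(1) that] by (simp add: k_def)
          then show ?thesis
            unfolding \<phi>_def f_def using adm [of "h *\<^sub>R T"] adm [of 0] h T r0
            by (intro DERIV_diff line_derivative \<F>) (auto intro: line_derivative \<F>)
        qed
        obtain t where t: "0 < t" "t < 1"
          "\<phi> 1 - \<phi> 0 = (1 - 0) * (slope (\<F> (h *\<^sub>R T)) (x + t *\<^sub>R k) k - slope (\<F> 0) (x + t *\<^sub>R k) k)"
          using MVT2 [of 0 1 \<phi>, OF _ D] by auto
        define y where "y = x + t *\<^sub>R k"
        have y: "y \<in> cball w0 r" using seg [OF x(1) m(1), of t] t by (simp add: k_def y_def)
        have yC: "(0, y) \<in> C" "(h *\<^sub>R T, y) \<in> C"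
          using in_C [OF _ y] h T r0 by auto
        have "\<bar>slope (\<F> (h *\<^sub>R T)) y k - slope (\<F> 0) y k\<bar> \<le> 6 ^ 6 * (2 * r * V * (L * h * (2 * M + L * h)))"
          unfolding slope
        proof (rule omega_tensor_difference_bound [OF _ k M [OF y]])
          show "\<bar>c y * unitv G y $ i\<bar> \<le> V" for i using V(2) [of i] yC by force
          show "\<bar>\<Delta> (h *\<^sub>R T) y $ i $ j - \<Delta> 0 y $ i $ j\<bar> \<le> L * h" for i j
          proof -
            have "norm ((h *\<^sub>R T, y) - (0, y)) = h" using h T by (simp add: norm_Pair)
            then show ?thesis
              using L(2) [OF yC(2) yC(1)] by simp
          qed
        qed
        then show ?thesis using t(3) by (simp add: \<phi>_def k_def y_def algebra_simps)
      qed
      have deriv: "((\<lambda>h. f h u) has_real_derivative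
          ip G (\<Delta> 0 u) (magnetic G (epsc T) (unitv G u)) / 2 + cross_term G F (epsc T) (unitv G u) / 4) (at 0)"
        if u: "u \<in> cball w0 r" for u
      proof -
        have "admissible F u" using adm [of 0 u] u r0 by (simp add: \<F>0)
        then have "((\<lambda>h. pst_lagrangian H G (F + h *\<^sub>R epsc T) (unitv G u)) has_real_derivative
            ip G (defect H G F (unitv G u)) (magnetic G (epsc T) (unitv G u)) / 2 +
            (ip G (electric G (epsc T) (unitv G u)) (magnetic G F (unitv G u))
              - ip G (electric G F (unitv G u)) (magnetic G (epsc T) (unitv G u))) / 4) (at 0)"
          using U_pos H_differentiable
          by (intro variation_of_field G F alternating_epsc unitv_unit) (auto simp: admissible_def)
        then show ?thesis by (simp add: f_def \<F>h \<Delta>_def \<F>0 cross_term_def)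
      qed
      have cross: "cross_term G F (epsc T) (unitv G m) = cross_term G F (epsc T) (unitv G x)"
      proof -
        have "timelike G (x + t *\<^sub>R k)" if "0 \<le> t" "t \<le> 1" for t
          using adm [of 0 "x + t *\<^sub>R k"] seg [OF x(1) m(1) that] r0 by (simp add: k_def admissible_def)
        then show ?thesis using cross_term_line [OF F alternating_epsc, of x k] by (simp add: k_def)
      qed
      \<comment> \<open>The mixed difference read in the other order: divided by \<open>h\<close> it
        tends to the difference of the field variations at \<open>m\<close> and \<open>x\<close>,
        where the cross terms cancel and the defect at \<open>x\<close> is zero.\<close>
      define Y where "Y = ip G (\<Delta> 0 m) (magnetic G (epsc T) (unitv G m)) / 2"
      have "((\<lambda>h. f h m - f h x) has_real_derivative Y) (at 0)"
        using DERIV_diff [OF deriv [OF m(1)] deriv [OF x(1)]] x(2)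
        by (simp add: cross Y_def bilinear_lzero [OF bilinear_ip])
      then have lim: "((\<lambda>h. (f h m - f h x - (f 0 m - f 0 x)) / h) \<longlongrightarrow> Y) (at_right 0)"
        by (simp add: DERIV_def filterlim_at_split)
      \<comment> \<open>The part quadratic in the perturbation disappears in the limit, and the
        bound becomes linear in \<open>M\<close>.\<close>
      have "((\<lambda>h. 6 ^ 6 * (2 * r * V * (L * (2 * M + L * h)))) \<longlongrightarrow>
          6 ^ 6 * (2 * r * V * (L * (2 * M + L * 0)))) (at_right 0)"
        by (intro tendsto_intros)
      moreover have "eventually (\<lambda>h. \<bar>(f h m - f h x - (f 0 m - f 0 x)) / h\<bar> \<le> 6 ^ 6 * (2 * r * V * (L * (2 * M + L * h)))) (at_right 0)"
        using eventually_at_right_real [OF r0]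
      proof (rule eventually_mono)
        fix h assume "h \<in> {0<..<r0}"
        then have h: "0 < h" "h \<le> r0" by auto
        have "f h m - f h x - (f 0 m - f 0 x) = (f h m - f 0 m) - (f h x - f 0 x)" by simp
        then have "\<bar>f h m - f h x - (f 0 m - f 0 x)\<bar> \<le> 6 ^ 6 * (2 * r * V * (L * (2 * M + L * h))) * h"
          using est [OF h] by (simp add: mult_ac)
        then show "\<bar>(f h m - f h x - (f 0 m - f 0 x)) / h\<bar> \<le> 6 ^ 6 * (2 * r * V * (L * (2 * M + L * h)))"
          using h by (simp add: abs_divide pos_divide_le_eq)
      qed
      ultimately have "\<bar>Y\<bar> \<le> 6 ^ 6 * (2 * r * V * (L * (2 * M + L * 0)))"
        using tendsto_le [OF _ _ tendsto_rabs [OF lim]] trivial_limit_at_right_real by blast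
      then show ?thesis by (simp add: Y_def K_def mult_ac)
    qed
    have tl: "timelike G m" using adm [of 0 m] m r0 by (simp add: admissible_def)
    interpret unit_timelike G F "unitv G m"
      using G F unitv_unit [OF tl] by unfold_locales
    have \<Delta>m: "\<Delta> 0 m = defect H G F (unitv G m)" by (simp add: \<Delta>_def \<F>0)
    define \<Omega> where "\<Omega> = epsc (epsc (tensor (\<Delta> 0 m) (unitv G m)))"
    have \<Omega>: "\<bar>\<Omega> $ i $ j $ l\<bar> \<le> 12 * sqrt (- det G) * (K * r * M)" for i j l
    proof -
      \<comment> \<open>Coordinate tensors read off single components of \<Omega>.\<close>
      define T :: "real^6^6^6" where "T = axis i (axis j (axis l 1))"
      have T: "norm T = 1" by (simp add: T_def)
      have "ip G (\<Delta> 0 m) (magnetic G (epsc T) (unitv G m)) = 1 / (6 * sqrt (- det G)) * (T \<bullet> \<Omega>)"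
        by (simp add: ip_magnetic [OF sym(1,2)] omega_epsc \<Omega>_def)
      moreover have "T \<bullet> \<Omega> = \<Omega> $ i $ j $ l" by (simp add: T_def inner_axis')
      ultimately have "\<bar>\<Omega> $ i $ j $ l\<bar> / (12 * sqrt (- det G)) \<le> K * r * M"
        using bound [OF T] detG by (simp add: abs_divide abs_mult)
      then show ?thesis using detG by (simp add: pos_divide_le_eq mult_ac)
    qed
    have "\<bar>\<Delta> 0 m $ i $ j\<bar> \<le> 1 / 12 * (6 * (12 * sqrt (- det G) * (K * r * M) * B))" for i j
    proof -
      have eq: "\<Delta> 0 m $ i $ j = 1 / 12 * (\<Sum>l\<in>UNIV. \<Omega> $ i $ j $ l * n m $ l)"
        unfolding \<Omega>_def n_def \<Delta>m
        by (rule epsc_epsc_tensor [OF transverse_defect unitv_unit [OF tl]])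
      have "\<bar>\<Sum>l\<in>UNIV. \<Omega> $ i $ j $ l * n m $ l\<bar> \<le> (\<Sum>l\<in>(UNIV :: 6 set). 12 * sqrt (- det G) * (K * r * M) * B)"
      proof (intro order_trans [OF sum_abs] sum_mono)
        fix l
        have "\<bar>n m $ l\<bar> \<le> B" using B(2) [of l] in_C [of 0 m] m r0 by force
        then show "\<bar>\<Omega> $ i $ j $ l * n m $ l\<bar> \<le> 12 * sqrt (- det G) * (K * r * M) * B"
          unfolding abs_mult using detG K r M0 by (intro mult_mono \<Omega>) auto
      qed
      then have "\<bar>\<Sum>l\<in>UNIV. \<Omega> $ i $ j $ l * n m $ l\<bar> \<le> 6 * (12 * sqrt (- det G) * (K * r * M) * B)"
        by simp
      then show ?thesis
        unfolding eq abs_mult by (intro mult_mono) simp_all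
    qed
    \<comment> \<open>All 36 entries at the maximum obey the same bound, so \<open>M\<close> is at
      most \<open>Q * r * M\<close> with \<open>Q * r < 1\<close>.\<close>
    then have "M \<le> (\<Sum>i\<in>(UNIV :: 6 set). \<Sum>j\<in>(UNIV :: 6 set). 1 / 12 * (6 * (12 * sqrt (- det G) * (K * r * M) * B)))"
      unfolding M_def S_def by (intro sum_mono)
    also have "\<dots> = Q * r * M" by (simp add: Q_def K_def)
    finally have "M * (1 - Q * r) \<le> 0" by (simp add: algebra_simps)
    then have "M = 0" using r(3) M0 by (simp add: mult_le_0_iff)
    then show ?thesis using M [OF u] by (simp add: vec_eq_iff)
  qed
  show thesis
  proof (rule that [OF r(1)])
    fix x y assume xy: "x \<in> aux_vectors U G F" "y \<in> aux_vectors U G F" "x \<in> ball w0 r" "y \<in> ball w0 r"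
      and sd: "self_dual H G F x"
    have ux: "unitv G x = x" "unitv G y = y" using xy by (auto simp: aux_vectors_def unitv_of_unit)
    have ball: "x \<in> cball w0 r" "y \<in> cball w0 r" using xy by auto
    have "\<Delta> 0 x = 0" using sd by (simp add: \<Delta>_def \<F>0 ux self_dual_iff_defect)
    then have zero: "\<Delta> 0 u = 0" if "u \<in> cball w0 r" for u using defect_0 ball(1) that by blast
    have "self_dual H G F y" using zero [OF ball(2)] by (simp add: \<Delta>_def \<F>0 ux self_dual_iff_defect)
    moreover have "pst_lagrangian H G F y = pst_lagrangian H G F x"
    proof -
      \<comment> \<open>The slope is quadratic in the defect, which is now known to vanish on the
        whole ball.\<close>
      have D: "((\<lambda>t. pst_lagrangian H G F (unitv G (x + t *\<^sub>R (y - x)))) has_real_derivative 0) (at t)"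
        if "0 \<le> t" "t \<le> 1" for t
      proof -
        have u: "x + t *\<^sub>R (y - x) \<in> cball w0 r" by (rule seg [OF ball that])
        have "slope (\<F> 0) (x + t *\<^sub>R (y - x)) (y - x) = 0"
          unfolding slope zero [OF u] by (simp add: linear_0 [OF linear_tensor(1)] bilinear_lzero [OF bilinear_omega])
        then show ?thesis
          using line_derivative [OF F, of x t "y - x"] adm [OF _ u, of 0] r0 by (simp add: \<F>0)
      qed
      show ?thesis using MVT2 [OF zero_less_one D] by (auto simp: ux)
    qed
    ultimately show "self_dual H G F y \<and> pst_lagrangian H G F y = pst_lagrangian H G F x" ..
  qed
qed

text \<open>The property carried along the connected set pairs self-duality with the value of
  \<open>pst_lagrangian\<close>, for which \<open>locally_self_dual\<close> gives local constancy.
  On shell this value is exchanged for \<open>onshell_lagrangian\<close> at both ends.\<close>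

lemma connected_self_dual:
  assumes F: "alternating F" and sd: "self_dual H G F v"
    and vw: "connected_component (aux_vectors U G F) v w"
  shows "self_dual H G F w \<and> onshell_lagrangian H G F w = onshell_lagrangian H G F v"
proof -
  obtain S where S: "connected S" "S \<subseteq> aux_vectors U G F" "v \<in> S" "w \<in> S"
    using vw by (auto simp: connected_component_def)
  have "self_dual H G F w \<and> pst_lagrangian H G F w = pst_lagrangian H G F v"
  proof (rule connected_induction_simple [OF S(1,3,4)])
    fix b assume "b \<in> S"
    obtain r where r: "r > 0"
      "\<And>x y. x \<in> aux_vectors U G F \<Longrightarrow> y \<in> aux_vectors U G F \<Longrightarrow> x \<in> ball b r \<Longrightarrow> y \<in> ball b r \<Longrightarrow>
      self_dual H G F x \<Longrightarrow> self_dual H G F y \<and> pst_lagrangian H G F y = pst_lagrangian H G F x"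
      using locally_self_dual [OF F, of b] \<open>b \<in> S\<close> S(2) by blast
    show "\<exists>T. openin (top_of_set S) T \<and> b \<in> T \<and> (\<forall>x\<in>T. \<forall>y\<in>T.
        self_dual H G F x \<and> pst_lagrangian H G F x = pst_lagrangian H G F v \<longrightarrow>
        self_dual H G F y \<and> pst_lagrangian H G F y = pst_lagrangian H G F v)"
    proof (intro exI conjI)
      show "openin (top_of_set S) (S \<inter> ball b r)" by (simp add: openin_open_Int)
      show "b \<in> S \<inter> ball b r" using \<open>b \<in> S\<close> r(1) by simp
      show "\<forall>x\<in>S \<inter> ball b r. \<forall>y\<in>S \<inter> ball b r.
        self_dual H G F x \<and> pst_lagrangian H G F x = pst_lagrangian H G F v \<longrightarrow>
        self_dual H G F y \<and> pst_lagrangian H G F y = pst_lagrangian H G F v"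
      proof (intro ballI impI)
        fix x y
        assume x: "x \<in> S \<inter> ball b r" and y: "y \<in> S \<inter> ball b r"
          and P: "self_dual H G F x \<and> pst_lagrangian H G F x = pst_lagrangian H G F v"
        show "self_dual H G F y \<and> pst_lagrangian H G F y = pst_lagrangian H G F v"
          using r(2) [of x y] x y P S(2) by auto
      qed
    qed
  qed (simp add: sd)
  moreover have "pst_lagrangian H G F b = onshell_lagrangian H G F b"
    if "b \<in> S" "self_dual H G F b" for b
  proof -
    have "b \<in> aux_vectors U G F" using S that by blast
    then have b: "b \<bullet> raise1 G b = - 1" "p_inv G F b > 0"
      using U_pos by (auto simp: aux_vectors_def)
    interpret unit_timelike G F b using G F b by unfold_locales
    show ?thesis by (rule pst_lagrangian_on_shell [OF b(2) that(2)])
  qed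
  ultimately show ?thesis using S(3,4) sd by metis
qed

lemma
  shows magnetic_minus: "magnetic G F (- v) = - magnetic G F v"
    and electric_minus: "electric G F (- v) = - electric G F v"
  using bilinear_rneg [OF bilinear_magnetic [OF G]] bilinear_rneg [OF bilinear_electric] by simp_all

lemma s_inv_minus: "s_inv G F (- v) = s_inv G F v"
  by (simp add: s_inv_eq magnetic_minus bilinear_lneg [OF bilinear_ip] bilinear_rneg [OF bilinear_ip])

lemma p_inv_minus: "p_inv G F (- v) = p_inv G F v"
proof -
  have "p_vec G F (- v) = - p_vec G F v"
    by (simp add: p_vec_def magnetic_minus vec_eq_iff sum_negf)
  then show ?thesis by (simp add: p_inv_def linear_neg [OF matrix_vector_mul_linear])
qed

text \<open>\<open>E\<close>, \<open>B\<close> and the cubic term are odd in \<open>v\<close>, while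
  \<open>s\<close> and \<open>p\<close> are even; this is what justifies the sign allowed in
  \<open>aux_linked\<close>.\<close>

lemma self_dual_minus: "self_dual H G F v \<Longrightarrow> self_dual H G F (- v)"
proof -
  have "cube G (- B) = - cube G B" for B
    by (simp add: cube_def linear_neg [OF linear_raise2] bilinear_lneg [OF bilinear_matrix_mult]
        bilinear_rneg [OF bilinear_matrix_mult])
  then have "H_tensor H G F (- v) = - H_tensor H G F v"
    by (simp add: H_tensor_eq constitutive_def s_inv_minus p_inv_minus magnetic_minus)
  then show "self_dual H G F v \<Longrightarrow> self_dual H G F (- v)"
    by (simp add: self_dual_def electric_minus)
qed

theorem linked_self_dual:
  assumes F: "alternating F" and sd: "self_dual H G F v" and vw: "aux_linked U G F v w"
  shows "self_dual H G F w" "onshell_lagrangian H G F w = onshell_lagrangian H G F v"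
proof -
  have "onshell_lagrangian H G F (- v) = onshell_lagrangian H G F v"
    by (simp add: onshell_lagrangian_def s_inv_minus p_inv_minus)
  then show "self_dual H G F w" "onshell_lagrangian H G F w = onshell_lagrangian H G F v"
    using vw connected_self_dual [OF F sd] connected_self_dual [OF F self_dual_minus [OF sd]]
    unfolding aux_linked_def by auto
qed

end

theorem corollary1:
  fixes X :: "(real^6) set"
    and g A :: "real^6 \<Rightarrow> real^6^6"
    and a :: "real^6 \<Rightarrow> real"
    and H :: "real \<Rightarrow> real \<Rightarrow> real"
    and U :: "(real \<times> real) set"
  assumes X: "open X"
    and g_C2: "\<And>i j. Ck_on 2 (\<lambda>x. g x $ i $ j) X"
    and g_lorentzian: "\<And>x. x \<in> X \<Longrightarrow> lorentzian (g x)"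
    and A_C2: "\<And>i j. Ck_on 2 (\<lambda>x. A x $ i $ j) X"
    and A_antisym: "\<And>x i j. x \<in> X \<Longrightarrow> A x $ i $ j = - (A x $ j $ i)"
    and a_C2: "Ck_on 2 a X"
    and a_timelike: "\<And>x. x \<in> X \<Longrightarrow> gradient a x \<bullet> raise1 (g x) (gradient a x) < 0"
    and U: "open U"
    and U_pos: "\<And>s p. (s, p) \<in> U \<Longrightarrow> p > 0"
    and H_C2: "Ck_on 2 (\<lambda>(s, p). H s p) U"
    and pst_condition: "\<And>s p. (s, p) \<in> U \<Longrightarrow>
      (H_s H s p)\<^sup>2 + 2 * s / p * H_s H s p * H_p H s p + (H_p H s p)\<^sup>2 = 1"
    and domain: "\<And>x. x \<in> X \<Longrightarrow>
      (s_inv (g x) (field_strength A x) (aux_vector g a x),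
       p_inv (g x) (field_strength A x) (aux_vector g a x)) \<in> U"
  shows "(\<exists>D. has_functional_derivative X (pst_action H g A) a D \<and>
      (\<exists>c. c \<noteq> 0 \<and> (\<forall>x\<in>X. D x = c / aux_norm g a x * a_variation H g A a x)) \<and>
      (\<forall>x\<in>X. self_dual H (g x) (field_strength A x) (aux_vector g a x) \<longrightarrow> D x = 0)) \<and>
    (\<forall>x\<in>X. let G = g x; F = field_strength A x; v = aux_vector g a x in
      self_dual H G F v \<longrightarrow>
        pst_lagrangian H G F v = onshell_lagrangian H G F v \<and>
        (\<forall>w. aux_linked U G F v w \<longrightarrow>
           self_dual H G F w \<and> onshell_lagrangian H G F w = onshell_lagrangian H G F v) \<and>
        (\<forall>P w. det P > 0 \<and>
           aux_linked U (frame_metric P G) (frame_three_form P F) (frame_covector P v) w \<longrightarrow>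
           self_dual H (frame_metric P G) (frame_three_form P F) w \<and>
           onshell_lagrangian H (frame_metric P G) (frame_three_form P F) w =
             onshell_lagrangian H G F v))"
proof -
  interpret pst X g A a H U
    by unfold_locales (fact assms)+
  show ?thesis
    unfolding Let_def
  proof (intro conjI ballI impI)
    show "\<exists>D. has_functional_derivative X (pst_action H g A) a D \<and>
      (\<exists>c. c \<noteq> 0 \<and> (\<forall>x\<in>X. D x = c / aux_norm g a x * a_variation H g A a x)) \<and>
      (\<forall>x\<in>X. self_dual H (g x) (field_strength A x) (aux_vector g a x) \<longrightarrow> D x = 0)"
    proof (intro exI [of _ D] conjI)
      show "\<exists>c. c \<noteq> 0 \<and> (\<forall>x\<in>X. D x = c / aux_norm g a x * a_variation H g A a x)"
        by (intro exI [of _ "1 / 4"] conjI ballI) (simp, simp only: D_eq N_def)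
    qed (use has_functional_derivative_D D_eq_0 in auto)
  next
    fix x assume x: "x \<in> X" and sd: "self_dual H (g x) (F x) (aux_vector g a x)"
    have alt: "alternating (F x)" by (rule alternating_F [OF x])
    interpret v: unit_timelike "g x" "F x" "aux_vector g a x"
      using g_lorentzian [OF x] alt unitv_unit [OF timelike_gradient [OF x]]
      by unfold_locales (simp_all add: aux_vector_eq)
    show "pst_lagrangian H (g x) (F x) (aux_vector g a x) = onshell_lagrangian H (g x) (F x) (aux_vector g a x)"
      using domain [OF x] U_pos by (intro v.pst_lagrangian_on_shell sd) blast
    have pst_function: "pst_function H U G" if "lorentzian G" for G
      by (rule pst_function.intro) (fact U U_pos H_C2 pst_condition that)+
    show "\<forall>w. aux_linked U (g x) (F x) (aux_vector g a x) w \<longrightarrow>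
        self_dual H (g x) (F x) w \<and>
        onshell_lagrangian H (g x) (F x) w = onshell_lagrangian H (g x) (F x) (aux_vector g a x)"
      using pst_function.linked_self_dual [OF pst_function [OF v.g] alt sd] by blast
    show "\<forall>P w. det P > 0 \<and>
        aux_linked U (frame_metric P (g x)) (frame_three_form P (F x)) (frame_covector P (aux_vector g a x)) w \<longrightarrow>
        self_dual H (frame_metric P (g x)) (frame_three_form P (F x)) w \<and>
        onshell_lagrangian H (frame_metric P (g x)) (frame_three_form P (F x)) w =
          onshell_lagrangian H (g x) (F x) (aux_vector g a x)"
      \<comment> \<open>Self-duality and the density pass to the new frame together with the
        transformed \<open>v\<close>; the linkage there then carries them on to
        \<open>w\<close>.\<close>
      using pst_function.linked_self_dual [OF pst_function [OF lorentzian_frame_metric [OF v.g]]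
          alternating_frame [OF alt] self_dual_frame [OF v.g _ sd]]
        onshell_lagrangian_frame [OF v.g]
      by metis
  qed
qed

end
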